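(* Let $A$ be a finite-dimensional associative unital algebra over a field of characteristic zero, with a symmetric, invariant, non-degenerate inner product $\langle\,,\rangle$. Let $C^\bullet(A,A)$ be its Hochschild cochain complex and $\Delta$ the degree $-1$ operator on $C^\bullet(A,A)$ obtained by transferring Connes' $B$-operator via the inner product. Then there is a homologically graded $A_\infty$-structure on $C^\bullet(A,A)[-1]$ which induces an $A_\infty$-structure, given by maps $\{m_n\}_{n \geq 1}$, on the Hochschild cohomology $HH^\bullet(A,A)[-1]$ such that $m_1 = \Delta$ (the operator induced by $\Delta$ on cohomology) and $m_2$ is the Gerstenhaber bracket up to a sign, i.e. $m_2(a,b) = \pm[a,b]$ for homogeneous $a,b \in HH^\bullet(A,A)$.
   Context: $C^n(A,A) = \mathrm{Hom}(A^{\otimes n}, A)$, with the usual Hochschild coboundary $\delta$ of degree $+1$, and $HH^\bullet(A,A)$ is its cohomology. Invariance of the inner product means $\langle ab, c\rangle = \langle a, bc\rangle$. The operator $\Delta : C^n(A,A) \to C^{n-1}(A,A)$ is defined by $$\langle \Delta f(a_1,\dots,a_{n-1}), a_n\rangle = \sum_{i=1}^n (-1)^{i(n-1)} \langle f(a_i,\dots,a_{n-1},a_n,a_1,\dots,a_{i-1}), 1\rangle$$ (and $\Delta = 0$ on $C^0(A,A)$). It is compatible with $\delta$ and so induces an operator, also denoted $\Delta$, on $HH^\bullet(A,A)$. The Gerstenhaber bracket on $HH^\bullet(A,A)$ is induced by $[f,g] = f \circ g - (-1)^{(p-1)(q-1)} g \circ f$ for $f \in C^p(A,A)$, $g \in C^q(A,A)$,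 where $$(f \circ g)(a_1,\dots,a_{p+q-1}) = \sum_{i=1}^{p} (-1)^{(i-1)(q-1)} f(a_1,\dots,a_{i-1}, g(a_i,\dots,a_{i+q-1}), a_{i+q},\dots,a_{p+q-1}).$$ A homologically graded $A_\infty$-structure on $V[-1]$, for a $\mathbb{Z}$-graded vector space $V$, is a collection $\{m_n\}_{n \geq 1}$ of degree $-1$ maps $m_n : V^{\otimes n} \to V$ such that for every $n \geq 1$ $$\sum_{n = i+j+k,\ k \geq 1,\ i,j \geq 0} m_{i+1+j}(id^{\otimes i} \otimes m_k \otimes id^{\otimes j}) = 0,$$ with the Koszul sign rule $(f \otimes g)(x \otimes y) = (-1)^{|g||x|} f(x) \otimes g(y)$. An $A_\infty$-structure on $C^\bullet(A,A)[-1]$ induces one on $HH^\bullet(A,A)[-1]$ when its operations are compatible with the Hochschild coboundary $\delta$ and hence descend to $\delta$-cohomology. *)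

theory Defs
  imports "HOL-Algebra.Module" "HOL-Algebra.AbelCoset" "HOL-Algebra.Algebraic_Closure_Type"
    "HOL-Library.Function_Algebras"
begin

section \<open>Graded vector spaces and \<open>A\<^sub>\<infinity>\<close>-structures\<close>

text \<open>
  Graded vector spaces are families of HOL-Algebra modules over \<^term>\<open>ring_of_type_algebra\<close>,
  the field \<open>'k\<close> viewed as a ring record. The \<open>mult\<close> and \<open>one\<close> fields of such a module record
  play no role.
\<close>

definition graded_vector_space :: "(int \<Rightarrow> ('k::field, 'v) module) \<Rightarrow> bool" where
  "graded_vector_space V \<longleftrightarrow> (\<forall>p. module (ring_of_type_algebra :: 'k ring) (V p))"

definition homogeneous :: "(int \<Rightarrow> ('k, 'v) module) \<Rightarrow> int list \<Rightarrow> 'v list \<Rightarrow> bool" where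
  "homogeneous V ps xs \<longleftrightarrow> list_all2 (\<lambda>p x. x \<in> carrier (V p)) ps xs"

text \<open>\<open>signed M s x\<close> is \<open>(-1)\<^sup>s x\<close> in \<open>M\<close>, and \<open>psign s x\<close> is the same in a type of additive group
  elements. The exponent may be negative.\<close>

definition signed :: "('k, 'v) module \<Rightarrow> int \<Rightarrow> 'v \<Rightarrow> 'v" where
  "signed M s x = (if even s then x else \<ominus>\<^bsub>M\<^esub> x)"

definition psign :: "int \<Rightarrow> 'b::group_add \<Rightarrow> 'b" where
  "psign s x = (if even s then x else - x)"

text \<open>
  A family of linear maps \<open>m\<^sub>n : V\<^sup>\<otimes>\<^sup>n \<rightarrow> V\<close> of degree \<open>-1\<close>, \<open>n \<ge> 1\<close>, amounts to a multilinear map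
  \<open>V\<^sub>p\<^sub>1 \<times> \<dots> \<times> V\<^sub>p\<^sub>n \<rightarrow> V\<^sub>p\<^sub>1\<^sub>+\<^sub>\<dots>\<^sub>+\<^sub>p\<^sub>n\<^sub>-\<^sub>1\<close> for every nonempty list of degrees. This map is
  \<open>m [p1, \<dots>, pn]\<close>, so that the arity \<open>n\<close> is the length of the list of degrees.
\<close>

type_synonym 'v graded_ops = "int list \<Rightarrow> 'v list \<Rightarrow> 'v"

definition degree_minus_one_ops :: "(int \<Rightarrow> ('k::field, 'v) module) \<Rightarrow> 'v graded_ops \<Rightarrow> bool" where
  "degree_minus_one_ops V m \<longleftrightarrow>
    (\<forall>ps xs. ps \<noteq> [] \<and> homogeneous V ps xs \<longrightarrow>
      m ps xs \<in> carrier (V (sum_list ps - 1)) \<and>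
      (\<forall>i < length ps. \<forall>y \<in> carrier (V (ps ! i)). \<forall>c.
        m ps (xs[i := xs ! i \<oplus>\<^bsub>V (ps ! i)\<^esub> y])
          = m ps xs \<oplus>\<^bsub>V (sum_list ps - 1)\<^esub> m ps (xs[i := y]) \<and>
        m ps (xs[i := c \<odot>\<^bsub>V (ps ! i)\<^esub> (xs ! i)]) = c \<odot>\<^bsub>V (sum_list ps - 1)\<^esub> m ps xs))"

text \<open>\<open>insert_op m i k ps xs\<close> is \<open>m\<^sub>i\<^sub>+\<^sub>1\<^sub>+\<^sub>j(x\<^sub>1, \<dots>, x\<^sub>i, m\<^sub>k(x\<^sub>i\<^sub>+\<^sub>1, \<dots>, x\<^sub>i\<^sub>+\<^sub>k), x\<^sub>i\<^sub>+\<^sub>k\<^sub>+\<^sub>1, \<dots>, x\<^sub>n)\<close>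
  without its Koszul sign.\<close>

definition insert_op :: "'v graded_ops \<Rightarrow> nat \<Rightarrow> nat \<Rightarrow> int list \<Rightarrow> 'v list \<Rightarrow> 'v" where
  "insert_op m i k ps xs =
    m (take i ps @ [sum_list (take k (drop i ps)) - 1] @ drop (i + k) ps)
      (take i xs @ [m (take k (drop i ps)) (take k (drop i xs))] @ drop (i + k) xs)"

text \<open>
  The Koszul rule gives
  \<open>(id\<^sup>i \<otimes> m\<^sub>k \<otimes> id\<^sup>j)(x\<^sub>1, \<dots>, x\<^sub>n) = (-1)\<^sup>s x\<^sub>1 \<otimes> \<dots> \<otimes> m\<^sub>k(x\<^sub>i\<^sub>+\<^sub>1, \<dots>, x\<^sub>i\<^sub>+\<^sub>k) \<otimes> \<dots> \<otimes> x\<^sub>n\<close>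
  with \<open>s = |m\<^sub>k| (|x\<^sub>1| + \<dots> + |x\<^sub>i|)\<close>, and \<open>|m\<^sub>k| = -1\<close>.
\<close>

definition A_infinity_structure :: "(int \<Rightarrow> ('k::field, 'v) module) \<Rightarrow> 'v graded_ops \<Rightarrow> bool" where
  "A_infinity_structure V m \<longleftrightarrow>
    graded_vector_space V \<and> degree_minus_one_ops V m \<and>
    (\<forall>ps xs. ps \<noteq> [] \<and> homogeneous V ps xs \<longrightarrow>
      finsum (V (sum_list ps - 2))
        (\<lambda>(i, k). signed (V (sum_list ps - 2)) (- sum_list (take i ps)) (insert_op m i k ps xs))
        {(i, k). 1 \<le> k \<and> i + k \<le> length ps}
      = \<zero>\<^bsub>V (sum_list ps - 2)\<^esub>)"


section \<open>Algebras with an invariant inner product\<close>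

text \<open>The sort \<open>ring\<close> (associative, no unit) with a unit element as a parameter is
  used instead of \<open>ring_1\<close>, whose axiom \<open>0 \<noteq> 1\<close> would exclude the zero algebra.\<close>

locale algebra_with_inner_product =
  finite_dimensional_vector_space scale Basis
  for scale :: "'k::field_char_0 \<Rightarrow> 'a::ring \<Rightarrow> 'a" and Basis :: "'a set" +
  fixes unit :: 'a and ip :: "'a \<Rightarrow> 'a \<Rightarrow> 'k"
  assumes scale_mult_left: "scale r a * b = scale r (a * b)"
    and scale_mult_right: "a * scale r b = scale r (a * b)"
    and unit_left: "unit * a = a"
    and unit_right: "a * unit = a"
    and ip_linear: "Vector_Spaces.linear scale (*) (ip a)"
    and ip_symmetric: "ip a b = ip b a"
    and ip_invariant: "ip (a * b) c = ip a (b * c)"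
    and ip_nondegenerate: "(\<And>b. ip a b = 0) \<Longrightarrow> a = 0"


section \<open>Hochschild cochains and cohomology\<close>

text \<open>
  A cochain of degree \<open>p\<close> is a function on lists that is multilinear on lists of length \<open>p\<close> and
  vanishes on lists of any other length. In particular there is only the zero cochain in
  negative degrees, and in degree \<open>0\<close> a cochain is determined by its value at \<open>[]\<close>.
\<close>

type_synonym 'a cochain = "'a list \<Rightarrow> 'a"

definition cochains :: "('k::field \<Rightarrow> 'a::ring \<Rightarrow> 'a) \<Rightarrow> int \<Rightarrow> 'a cochain set" where
  "cochains scale p =
    {f. (\<forall>xs. int (length xs) \<noteq> p \<longrightarrow> f xs = 0) \<and>
        (\<forall>xs. \<forall>i < length xs. Vector_Spaces.linear scale scale (\<lambda>a. f (xs[i := a])))}"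

definition cochain_space ::
  "('k::field \<Rightarrow> 'a::ring \<Rightarrow> 'a) \<Rightarrow> int \<Rightarrow> ('k, 'a cochain) module" where
  "cochain_space scale p =
    \<lparr>carrier = cochains scale p, monoid.mult = (\<lambda>_ _. 0), one = 0,
     ring.zero = 0, add = (+), module.smult = (\<lambda>c f xs. scale c (f xs))\<rparr>"

definition hochschild :: "'a::ring cochain \<Rightarrow> 'a cochain" where
  "hochschild f xs =
    (if xs = [] then 0
     else let n = length xs - 1 in
       hd xs * f (tl xs)
       + (\<Sum>i = 1..n. psign (int i)
            (f (take (i - 1) xs @ [xs ! (i - 1) * xs ! i] @ drop (i + 1) xs)))
       + psign (int n + 1) (f (butlast xs) * last xs))"

definition cocycle_space ::
  "('k::field \<Rightarrow> 'a::ring \<Rightarrow> 'a) \<Rightarrow> int \<Rightarrow> ('k, 'a cochain) module" where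
  "cocycle_space scale p =
    (cochain_space scale p)\<lparr>carrier := {f \<in> cochains scale p. hochschild f = 0}\<rparr>"

definition coboundaries :: "('k::field \<Rightarrow> 'a::ring \<Rightarrow> 'a) \<Rightarrow> int \<Rightarrow> 'a cochain set" where
  "coboundaries scale p = hochschild ` cochains scale (p - 1)"

text \<open>The union in the scalar multiplication is over representatives, all of which give the same
  coset; the image of the coset under scaling by \<open>c\<close> would be too small for \<open>c = 0\<close>.\<close>

definition quotient_module :: "('k, 'v) module \<Rightarrow> 'v set \<Rightarrow> ('k, 'v set) module" where
  "quotient_module M W =
    \<lparr>carrier = a_rcosets\<^bsub>M\<^esub> W, monoid.mult = (\<lambda>_ _. W), one = W,
     ring.zero = W, add = set_add M, module.smult = (\<lambda>c \<xi>. \<Union>x\<in>\<xi>. W +>\<^bsub>M\<^esub> (c \<odot>\<^bsub>M\<^esub> x))\<rparr>"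

definition HH :: "('k::field \<Rightarrow> 'a::ring \<Rightarrow> 'a) \<Rightarrow> int \<Rightarrow> ('k, 'a cochain set) module" where
  "HH scale p = quotient_module (cocycle_space scale p) (coboundaries scale p)"

definition HH_class ::
  "('k::field \<Rightarrow> 'a::ring \<Rightarrow> 'a) \<Rightarrow> int \<Rightarrow> 'a cochain \<Rightarrow> 'a cochain set" where
  "HH_class scale p f = coboundaries scale p +>\<^bsub>cocycle_space scale p\<^esub> f"


section \<open>The operator \<open>\<Delta>\<close> and the Gerstenhaber bracket\<close>

text \<open>With \<open>L = (a\<^sub>1, \<dots>, a\<^sub>n)\<close>, the list \<open>drop (i - 1) L @ take (i - 1) L\<close> is
  \<open>(a\<^sub>i, \<dots>, a\<^sub>n, a\<^sub>1, \<dots>, a\<^sub>i\<^sub>-\<^sub>1)\<close>. The value described exists and is unique for a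
  non-degenerate inner product in finite dimension. A cochain of degree \<open>0\<close> is sent
  to \<open>0\<close>, since only values on nonempty lists enter.\<close>

definition Delta :: "'a \<Rightarrow> ('a \<Rightarrow> 'a \<Rightarrow> 'k::field) \<Rightarrow> 'a::ring cochain \<Rightarrow> 'a cochain" where
  "Delta unit ip f as =
    (THE y. \<forall>a. ip y a =
      (let L = as @ [a]; n = length L in
        \<Sum>i = 1..n. (-1) ^ (i * (n - 1)) * ip (f (drop (i - 1) L @ take (i - 1) L)) unit))"

definition gerstenhaber_circ ::
  "nat \<Rightarrow> nat \<Rightarrow> 'a::ring cochain \<Rightarrow> 'a cochain \<Rightarrow> 'a cochain" where
  "gerstenhaber_circ p q f g xs =
    (if length xs + 1 = p + q
     then \<Sum>i = 1..p. psign ((int i - 1) * (int q - 1))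
            (f (take (i - 1) xs @ [g (take q (drop (i - 1) xs))] @ drop (i - 1 + q) xs))
     else 0)"

definition gerstenhaber_bracket ::
  "nat \<Rightarrow> nat \<Rightarrow> 'a::ring cochain \<Rightarrow> 'a cochain \<Rightarrow> 'a cochain" where
  "gerstenhaber_bracket p q f g =
    gerstenhaber_circ p q f g
    - psign ((int p - 1) * (int q - 1)) (gerstenhaber_circ q p g f)"

text \<open>The induced operations on cohomology, as unions over representatives.\<close>

definition HH_Delta ::
  "('k::field \<Rightarrow> 'a::ring \<Rightarrow> 'a) \<Rightarrow> 'a \<Rightarrow> ('a \<Rightarrow> 'a \<Rightarrow> 'k) \<Rightarrow> int \<Rightarrow> 'a cochain set \<Rightarrow> 'a cochain set"
where
  "HH_Delta scale unit ip p \<xi> = (\<Union>f\<in>\<xi>. HH_class scale (p - 1) (Delta unit ip f))"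

definition HH_bracket ::
  "('k::field \<Rightarrow> 'a::ring \<Rightarrow> 'a) \<Rightarrow> nat \<Rightarrow> nat \<Rightarrow> 'a cochain set \<Rightarrow> 'a cochain set \<Rightarrow> 'a cochain set"
where
  "HH_bracket scale p q \<xi> \<eta> =
    (\<Union>f\<in>\<xi>. \<Union>g\<in>\<eta>. HH_class scale (int p + int q - 1) (gerstenhaber_bracket p q f g))"


section \<open>Passage from cochains to cohomology\<close>

text \<open>
  Compatibility of operations of degree \<open>-1\<close> with the differential \<open>\<delta>\<close> of degree \<open>1\<close>: the graded
  commutator vanishes, i.e. \<open>\<delta> m\<^sub>n + m\<^sub>n (\<Sum> id\<^sup>i \<otimes> \<delta> \<otimes> id\<^sup>n\<^sup>-\<^sup>1\<^sup>-\<^sup>i) = 0\<close>, with the Koszul sign rule.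
\<close>

definition compatible_with_hochschild ::
  "('k::field \<Rightarrow> 'a::ring \<Rightarrow> 'a) \<Rightarrow> 'a cochain graded_ops \<Rightarrow> bool" where
  "compatible_with_hochschild scale m \<longleftrightarrow>
    (\<forall>ps fs. ps \<noteq> [] \<and> homogeneous (cochain_space scale) ps fs \<longrightarrow>
      hochschild (m ps fs)
      + (\<Sum>i < length ps. psign (sum_list (take i ps))
           (m (ps[i := ps ! i + 1]) (fs[i := hochschild (fs ! i)]))) = 0)"

definition induces_on_HH ::
  "('k::field \<Rightarrow> 'a::ring \<Rightarrow> 'a) \<Rightarrow> 'a cochain graded_ops \<Rightarrow> 'a cochain set graded_ops \<Rightarrow> bool" where
  "induces_on_HH scale \<mu> m \<longleftrightarrow>
    (\<forall>ps fs. ps \<noteq> [] \<and> homogeneous (cocycle_space scale) ps fs \<longrightarrow>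
      m ps (map2 (HH_class scale) ps fs) = HH_class scale (sum_list ps - 1) (\<mu> ps fs))"

end

theory Submission
  imports Defs
begin

text \<open>
  The cup product makes the cochains an associative algebra, and the operations come from measuring
  how far an operator is from being a derivation of it. For an operator \<open>D\<close> of odd degree on a
  graded associative algebra put
  \<open>b\<^sub>1 = D\<close>, \<open>b\<^sub>2(a, b) = D(ab) - D(a)b - (-1)\<^sup>|\<^sup>a\<^sup>| a D(b)\<close> and, for \<open>n \<ge> 3\<close>,
  \<open>b\<^sub>n(a\<^sub>1, \<dots>, a\<^sub>n) = D(a\<^sub>1\<dots>a\<^sub>n) - D(a\<^sub>1\<dots>a\<^sub>n\<^sub>-\<^sub>1)a\<^sub>n - \<epsilon> a\<^sub>1D(a\<^sub>2\<dots>a\<^sub>n) + \<epsilon> a\<^sub>1D(a\<^sub>2\<dots>a\<^sub>n\<^sub>-\<^sub>1)a\<^sub>n\<close>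
  with \<open>\<epsilon> = (-1)\<^sup>|\<^sup>a\<^sub>1\<^sup>|\<close> (Boerjeson's products). They are what is left of \<open>D\<close> after conjugation with the automorphism of the
  tensor coalgebra whose components are the iterated products; concretely, they are determined by
  \<open>D(a\<^sub>1\<dots>a\<^sub>n) = \<Sum> \<plusminus> a\<^sub>1\<dots>a\<^sub>i b(a\<^sub>i\<^sub>+\<^sub>1, \<dots>) a\<^sub>j\<dots>a\<^sub>n\<close> (\<open>op_word_expansion\<close>). Expanding \<open>D(D(a\<^sub>1\<dots>a\<^sub>n)) = 0\<close>
  twice with this formula, the terms in which the two operations do not interact cancel, and induction on
  the length leaves exactly the \<open>A\<^sub>\<infinity>\<close>-relations (\<open>boerjeson_relation\<close>). If the differential \<open>\<delta>\<close> is a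
  derivation of square zero that anticommutes with \<open>D\<close>, then \<open>D + \<delta>\<close> has square zero too, and its higher
  products differ from those of \<open>D\<close> only in arity one. Subtracting the relations for \<open>D\<close> from those for
  \<open>D + \<delta>\<close> therefore gives the compatibility with \<open>\<delta>\<close> (\<open>boerjeson_compatible\<close>).

  The operator \<open>\<Delta>\<close> cannot be used for \<open>D\<close> directly. Through the inner product, a cochain is a
  multilinear form \<open>\<Psi>(a\<^sub>1, \<dots>, a\<^sub>n\<^sub>+\<^sub>1) = \<langle>f(a\<^sub>1, \<dots>, a\<^sub>n), a\<^sub>n\<^sub>+\<^sub>1\<rangle>\<close>, and \<open>\<Delta>\<close> inserts the unit and sums over
  the cyclic rotations. On the normalised complex this has square zero, but here cochains need not
  vanish when an argument is the unit. The full Connes operator also subtracts the terms that have the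
  unit at the other end. It has square zero, because its insertion kills cyclically invariant forms
  (\<open>connes_connes\<close>), it anticommutes with \<open>\<delta>\<close> (\<open>connes_hochschild\<close>), and on cocycles it differs from
  \<open>\<Delta>\<close> by the coboundary of a sum of terms that contain the unit twice (\<open>Delta_connes\<close>). Hence its
  products are an \<open>A\<^sub>\<infinity>\<close>-structure on the cochains which induces one on the cohomology
  (\<open>A_infinity_descended\<close>), with \<open>\<Delta>\<close> as unary operation.

  The binary operation on cohomology is then \<open>\<Delta>(fg) - \<Delta>(f)g - (-1)\<^sup>p f\<Delta>(g)\<close>, and it remains to see that
  this is \<open>\<plusminus>[f, g]\<close> up to a coboundary (\<open>batalin_vilkovisky\<close>). The rotations in \<open>\<Delta>(f g)\<close> split according to
  whether the last argument is fed to \<open>f\<close> or to \<open>g\<close>. One half is shown to be cohomologous to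
  \<open>\<Delta>(f)g \<plusminus> f \<circ> g\<close> (\<open>half_rotation_cohomologous\<close>): the cocycle identity of \<open>f\<close> is summed over all cyclic
  words in which a block of letters is replaced by its value under \<open>g\<close>, and the sum telescopes. The other
  half is the same statement with \<open>f\<close> and \<open>g\<close> exchanged, and the graded commutativity of the cup product on
  cohomology (\<open>cup_graded_commutative\<close>) moves \<open>f\<close> back to the left.

  All sums are indexed by the ways to cut a word into factors instead of by positions. The signs then
  depend only on the lengths of the factors, and a change of summation index is the motion of a letter
  across a cut.
\<close>

section \<open>Signs\<close>

lemma psign_0 [simp]: "psign 0 x = x"
  by (simp add: psign_def)

lemma psign_zero [simp]: "psign s (0 :: 'b::group_add) = 0"
  by (simp add: psign_def)

lemma psign_psign [simp]: "psign s (psign t x) = psign (s + t) x"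
  by (simp add: psign_def)

lemma psign_cong: "even s = even t \<Longrightarrow> psign s x = psign t x"
  by (simp add: psign_def)

lemma minus_psign: "- psign s x = psign (s + 1) x"
  by (simp add: psign_def)

lemma psign_minus: "psign s (- x) = psign (s + 1) x"
  by (simp add: psign_def)

lemma psign_double [simp]: "psign (2 * s) x = x"
  by (simp add: psign_def)

lemma psign_2 [simp]: "psign (2 + s) x = psign s x"
  by (simp add: psign_def)

lemma psign_move: "psign s x = y \<Longrightarrow> x = psign s y"
  by (auto simp: psign_def)

lemma psign_add: "psign s (x + y) = psign s x + psign s (y :: 'b::ab_group_add)"
  by (simp add: psign_def)

lemma psign_diff: "psign s (x - y) = psign s x - psign s (y :: 'b::ab_group_add)"
  by (simp add: psign_def)

lemma psign_sum: "psign s (sum f A) = (\<Sum>i\<in>A. psign s (f i :: 'b::ab_group_add))"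
  by (simp add: psign_def sum_negf)

lemma psign_apply: "psign s f x = psign s (f x)"
  by (simp add: psign_def)

lemma psign_mult_left: "psign s (x :: 'b::ring) * y = psign s (x * y)"
  by (simp add: psign_def)

lemma psign_mult_right: "x * psign s (y :: 'b::ring) = psign s (x * y)"
  by (simp add: psign_def)

lemma psign_add_opposite: "odd (s + t) \<Longrightarrow> psign s x + psign t x = 0"
  by (auto simp: psign_def)

lemma psign_eq_0_iff [simp]: "psign s x = 0 \<longleftrightarrow> x = 0"
  by (simp add: psign_def)

lemma neg_one_power_mult: "(- 1) ^ n * (x :: 'b::ring_1) = psign (int n) x"
  by (simp add: psign_def)

section \<open>Sums over deconcatenations of a word\<close>

definition cut_sum :: "('x list \<Rightarrow> 'x list \<Rightarrow> 'b::comm_monoid_add) \<Rightarrow> 'x list \<Rightarrow> 'b" where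
  "cut_sum \<psi> w = (\<Sum>(u, v) \<in> {(u, v). u @ v = w}. \<psi> u v)"

lemma cuts_Cons: "{(u, v). u @ v = x # w} = insert ([], x # w) ((\<lambda>p. (x # fst p, snd p)) ` {(u, v). u @ v = w})"
  by (auto simp: append_eq_Cons_conv image_iff)

lemma finite_cuts [simp]: "finite {(u, v). u @ v = w}"
proof (induction w)
  case (Cons x w)
  then show ?case unfolding cuts_Cons by simp
qed simp

lemma cut_sum_Nil [simp]: "cut_sum \<psi> [] = \<psi> [] []"
proof -
  have "{(u, v). u @ v = []} = {([], [])}" by auto
  then show ?thesis by (simp add: cut_sum_def)
qed

lemma cut_sum_Cons: "cut_sum \<psi> (x # w) = \<psi> [] (x # w) + cut_sum (\<lambda>u. \<psi> (x # u)) w"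
proof -
  have *: "inj_on (\<lambda>p. (x # fst p, snd p)) {(u, v). u @ v = w}"
    by (auto simp: inj_on_def)
  show ?thesis unfolding cut_sum_def cuts_Cons
    by (subst sum.insert) (auto simp: sum.reindex[OF *] o_def case_prod_beta intro!: sum.cong)
qed

lemma cut_sum_cong: "(\<And>u v. u @ v = w \<Longrightarrow> \<psi> u v = \<psi>' u v) \<Longrightarrow> cut_sum \<psi> w = cut_sum \<psi>' w"
  unfolding cut_sum_def by (auto intro!: sum.cong)

lemma cut_sum_0: "(\<And>u v. u @ v = w \<Longrightarrow> \<psi> u v = 0) \<Longrightarrow> cut_sum \<psi> w = 0"
  unfolding cut_sum_def by (auto intro!: sum.neutral)

lemma cut_sum_add: "cut_sum (\<lambda>u v. \<psi> u v + \<psi>' u v) w = cut_sum \<psi> w + cut_sum \<psi>' w"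
  by (simp add: cut_sum_def sum.distrib case_prod_unfold)

lemma cut_sum_minus: "cut_sum (\<lambda>u v. - \<psi> u v) w = - cut_sum \<psi> w" for \<psi> :: "_ \<Rightarrow> _ \<Rightarrow> 'b::ab_group_add"
  by (simp add: cut_sum_def sum_negf case_prod_unfold)

lemma cut_sum_diff: "cut_sum (\<lambda>u v. \<psi> u v - \<psi>' u v) w = cut_sum \<psi> w - cut_sum \<psi>' w"
  for \<psi> :: "_ \<Rightarrow> _ \<Rightarrow> 'b::ab_group_add"
  by (simp add: cut_sum_def sum_subtractf case_prod_unfold)

lemma cut_sum_psign: "psign s (cut_sum \<psi> w) = cut_sum (\<lambda>u v. psign s (\<psi> u v)) w"
  for \<psi> :: "_ \<Rightarrow> _ \<Rightarrow> 'b::ab_group_add"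
  by (simp add: cut_sum_def psign_sum case_prod_unfold)

text \<open>For maps that are additive only on a subset \<open>K\<close>: the operators of interest are additive on
  multilinear functions, not on arbitrary functions on words.\<close>

lemma cut_sum_hom:
  assumes "h 0 = 0" "\<And>x y. x \<in> K \<Longrightarrow> y \<in> K \<Longrightarrow> h (x + y) = h x + h y"
    and "0 \<in> K" "\<And>x y. x \<in> K \<Longrightarrow> y \<in> K \<Longrightarrow> x + y \<in> K"
    and "\<And>u v. u @ v = w \<Longrightarrow> \<psi> u v \<in> K"
  shows "cut_sum \<psi> w \<in> K \<and> h (cut_sum \<psi> w) = cut_sum (\<lambda>u v. h (\<psi> u v)) w"
  using assms(5)
proof (induction w arbitrary: \<psi>)
  case Nil
  then show ?case by simp
next
  case (Cons x w)
  have "cut_sum (\<lambda>u. \<psi> (x # u)) w \<in> K \<and>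
      h (cut_sum (\<lambda>u. \<psi> (x # u)) w) = cut_sum (\<lambda>u v. h (\<psi> (x # u) v)) w"
    by (rule Cons.IH) (auto intro: Cons.prems)
  moreover have "\<psi> [] (x # w) \<in> K" by (auto intro: Cons.prems)
  ultimately show ?case by (simp add: cut_sum_Cons assms)
qed

lemma cut_sum_map: "h 0 = 0 \<Longrightarrow> (\<And>x y. h (x + y) = h x + h y) \<Longrightarrow>
    h (cut_sum \<psi> w) = cut_sum (\<lambda>u v. h (\<psi> u v)) w"
  using cut_sum_hom[of h UNIV] by simp

lemma cut_sum_mult_left: "cut_sum \<psi> w * c = cut_sum (\<lambda>u v. \<psi> u v * c) w"
  and cut_sum_mult_right: "c * cut_sum \<psi> w = cut_sum (\<lambda>u v. c * \<psi> u v) w"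
  for \<psi> :: "_ \<Rightarrow> _ \<Rightarrow> 'b::ring"
  by (simp_all add: cut_sum_def sum_distrib_left sum_distrib_right case_prod_unfold)

lemma cut_sum_swap:
  "cut_sum (\<lambda>a b. cut_sum (\<lambda>c d. \<psi> a b c d) y) x = cut_sum (\<lambda>c d. cut_sum (\<lambda>a b. \<psi> a b c d) x) y"
  unfolding cut_sum_def case_prod_unfold by (rule sum.swap)

text \<open>Both sides sum over the ways to cut \<open>w\<close> into three factors.\<close>

lemma cut_sum_assoc:
  "cut_sum (\<lambda>u v. cut_sum (\<lambda>a b. \<psi> a b v) u) w = cut_sum (\<lambda>a u. cut_sum (\<lambda>b v. \<psi> a b v) u) w"
proof (induction w arbitrary: \<psi>)
  case (Cons x w)
  show ?case
    by (simp add: cut_sum_Cons cut_sum_add Cons.IH ac_simps)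
qed simp

lemma cut_sum_append_Cons:
  "cut_sum \<psi> (x @ b # z) = cut_sum (\<lambda>u v. \<psi> u (v @ b # z)) x + cut_sum (\<lambda>u v. \<psi> (x @ b # u) v) z"
  by (induction x arbitrary: \<psi>) (simp_all add: cut_sum_Cons ac_simps)

lemma cut_sum_append:
  "cut_sum \<psi> (x @ z) = cut_sum (\<lambda>u v. if v = [] then 0 else \<psi> u (v @ z)) x + cut_sum (\<lambda>u v. \<psi> (x @ u) v) z"
  by (induction x arbitrary: \<psi>) (simp_all add: cut_sum_Cons ac_simps)

lemma cut_sum_Nil_left: "cut_sum (\<lambda>u v. if u = [] then \<psi> v else 0) w = \<psi> w"
  by (cases w) (simp_all add: cut_sum_Cons cut_sum_0)

lemma cut_sum_Nil_right: "cut_sum (\<lambda>u v. if v = [] then \<psi> u else 0) w = \<psi> w"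
  by (induction w arbitrary: \<psi>) (simp_all add: cut_sum_Cons)

text \<open>Moving one letter across the cut: the terms in which it ends the left factor are the terms in
  which it starts the right factor.\<close>

lemma cut_sum_shift:
  "cut_sum (\<lambda>u v. if u = [] then 0 else h (butlast u) (last u) v) w
    = cut_sum (\<lambda>u v. if v = [] then 0 else h u (hd v) (tl v)) w"
proof (induction w arbitrary: h)
  case (Cons x w)
  have "cut_sum (\<lambda>u v. if x # u = [] then 0 else h (butlast (x # u)) (last (x # u)) v) w
    = cut_sum (\<lambda>u v. (if u = [] then h [] x v else 0)
        + (if u = [] then 0 else h (x # butlast u) (last u) v)) w"
    by (rule cut_sum_cong) simp
  also have "\<dots> = h [] x w + cut_sum (\<lambda>u v. if v = [] then 0 else h (x # u) (hd v) (tl v)) w"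
    by (simp add: cut_sum_add cut_sum_Nil_left Cons.IH[of "\<lambda>u. h (x # u)"])
  finally show ?case by (simp add: cut_sum_Cons)
qed simp

lemma cut_sum_index: "cut_sum \<psi> w = (\<Sum>i\<le>length w. \<psi> (take i w) (drop i w))"
proof (induction w arbitrary: \<psi>)
  case (Cons x w)
  then show ?case
    by (simp add: cut_sum_Cons sum.atMost_Suc_shift del: sum.atMost_Suc)
qed simp

section \<open>Multiplying adjacent letters\<close>

text \<open>This is the part of the bar differential that involves no outer letters: the sum of
  \<open>(-1)\<^sup>i \<phi>(\<dots>, a\<^sub>ia\<^sub>i\<^sub>+\<^sub>1, \<dots>)\<close> over all pairs of neighbours, the first pair having sign \<open>-1\<close>.\<close>

fun merge_sum :: "('a::times list \<Rightarrow> 'b::ab_group_add) \<Rightarrow> 'a list \<Rightarrow> 'b" where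
  "merge_sum \<phi> (x # y # w) = - \<phi> (x * y # w) - merge_sum (\<lambda>z. \<phi> (x # z)) (y # w)"
| "merge_sum \<phi> _ = 0"

lemma merge_sum_cong:
  "(\<And>z. Suc (length z) = length w \<Longrightarrow> \<phi> z = \<phi>' z) \<Longrightarrow> merge_sum \<phi> w = merge_sum \<phi>' w"
proof (induction \<phi> w arbitrary: \<phi>' rule: merge_sum.induct)
  case (1 \<phi> x y w)
  have "merge_sum (\<lambda>z. \<phi> (x # z)) (y # w) = merge_sum (\<lambda>z. \<phi>' (x # z)) (y # w)"
    by (rule 1) (simp add: 1)
  then show ?case by (simp add: 1)
qed simp_all

lemma merge_sum_map:
  assumes "h 0 = 0" "\<And>x y. h (x + y) = h x + h y"
  shows "merge_sum (\<lambda>z. h (\<phi> z)) w = h (merge_sum \<phi> w)"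
proof -
  have "h (- x) = - h x" for x
    using assms by (metis add.right_inverse add_eq_0_iff)
  moreover have "h (x - y) = h x - h y" for x y
    using assms(2) calculation by (metis diff_conv_add_uminus)
  ultimately show ?thesis
    by (induction \<phi> w rule: merge_sum.induct) (simp_all add: assms)
qed

lemma merge_sum_add: "merge_sum (\<lambda>z. \<phi> z + \<phi>' z) w = merge_sum \<phi> w + merge_sum \<phi>' w"
proof (induction \<phi> w arbitrary: \<phi>' rule: merge_sum.induct)
  case (1 \<phi> x y w)
  show ?case unfolding merge_sum.simps 1 by simp
qed simp_all

lemma merge_sum_psign: "merge_sum (\<lambda>z. psign s (\<phi> z)) w = psign s (merge_sum \<phi> w)"
  by (rule merge_sum_map) (simp_all add: psign_add)

lemma merge_sum_minus: "merge_sum (\<lambda>z. - \<phi> z) w = - merge_sum \<phi> w"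
  by (rule merge_sum_map) simp_all

lemma merge_sum_zero [simp]: "merge_sum (\<lambda>z. 0) w = 0"
  using merge_sum_map[of "\<lambda>_. 0" "\<lambda>_. 0" w] by simp

lemma merge_sum_0: "(\<And>z. Suc (length z) = length w \<Longrightarrow> \<phi> z = 0) \<Longrightarrow> merge_sum \<phi> w = 0"
  using merge_sum_cong[of w \<phi> "\<lambda>z. 0"] by simp

lemma merge_sum_psign_length:
  "merge_sum (\<lambda>z. psign (s (length z)) (\<phi> z)) w = psign (s (length w - 1)) (merge_sum \<phi> w)"
  for \<phi> :: "'a::times list \<Rightarrow> 'b::ab_group_add"
  unfolding merge_sum_psign[symmetric]
proof (rule merge_sum_cong)
  fix z :: "'a list" assume "Suc (length z) = length w"
  then have "length w - 1 = length z" by simp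
  then show "psign (s (length z)) (\<phi> z) = psign (s (length w - 1)) (\<phi> z)" by simp
qed

text \<open>The term of \<open>merge_sum \<phi> (u @ v)\<close> that multiplies a letter of \<open>u\<close> with a letter of \<open>v\<close>.\<close>

definition junction :: "('a::times list \<Rightarrow> 'b::zero) \<Rightarrow> 'a list \<Rightarrow> 'a list \<Rightarrow> 'b" where
  "junction \<phi> u v = (if u = [] \<or> v = [] then 0 else \<phi> (butlast u @ (last u * hd v) # tl v))"

lemma merge_sum_append:
  "merge_sum \<phi> (u @ v) = merge_sum (\<lambda>z. \<phi> (z @ v)) u
    + psign (int (length u)) (merge_sum (\<lambda>z. \<phi> (u @ z)) v)
    + psign (int (length u)) (junction \<phi> u v)"
proof (induction u arbitrary: \<phi>)
  case Nil
  then show ?case by (simp add: junction_def)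
next
  case (Cons x u)
  show ?case
  proof (cases u)
    case Nil
    show ?thesis
      by (cases v) (simp_all add: Nil junction_def psign_def)
  next
    case u: (Cons y u')
    have "junction \<phi> (x # u) v = junction (\<lambda>z. \<phi> (x # z)) u v"
      by (simp add: junction_def u)
    then show ?thesis
      using Cons.IH[of "\<lambda>z. \<phi> (x # z)"] by (simp add: u minus_psign psign_def)
  qed
qed

text \<open>Multiplying two neighbours and then cutting never separates them, so only the merges inside one of
  the two factors occur and there is no junction term.\<close>

lemma merge_sum_cut:
  "merge_sum (cut_sum \<psi>) w = cut_sum (\<lambda>u v. merge_sum (\<lambda>a. \<psi> a v) u
    + psign (int (length u)) (merge_sum (\<psi> u) v)) w"
proof (induction w arbitrary: \<psi>)
  case Nil
  then show ?case by simp
next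
  case (Cons x w)
  show ?case
  proof (cases w)
    case Nil
    then show ?thesis by (simp add: cut_sum_Cons)
  next
    case w: (Cons y w')
    have "merge_sum (cut_sum \<psi>) (x # w)
       = - cut_sum \<psi> (x * y # w') - merge_sum (\<lambda>z. \<psi> [] (x # z) + cut_sum (\<lambda>u. \<psi> (x # u)) z) w"
      by (simp add: w cut_sum_Cons)
    also have "merge_sum (\<lambda>z. \<psi> [] (x # z) + cut_sum (\<lambda>u. \<psi> (x # u)) z) w =
       merge_sum (\<lambda>z. \<psi> [] (x # z)) w
       + cut_sum (\<lambda>u v. merge_sum (\<lambda>a. \<psi> (x # a) v) u + psign (int (length u)) (merge_sum (\<psi> (x # u)) v)) w"
      unfolding merge_sum_add using Cons.IH[of "\<lambda>u. \<psi> (x # u)"] by simp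
    finally have 1: "merge_sum (cut_sum \<psi>) (x # w) = - cut_sum \<psi> (x * y # w')
       - (merge_sum (\<lambda>z. \<psi> [] (x # z)) w + cut_sum (\<lambda>u v. merge_sum (\<lambda>a. \<psi> (x # a) v) u
           + psign (int (length u)) (merge_sum (\<psi> (x # u)) v)) w)" .
    have "merge_sum (\<lambda>a. \<psi> a v) (x # y # u) = - \<psi> (x * y # u) v - merge_sum (\<lambda>a. \<psi> (x # a) v) (y # u)" for u v
      by simp
    then have 2: "cut_sum (\<lambda>u v. merge_sum (\<lambda>a. \<psi> a v) (x # u)) w
       = - cut_sum (\<lambda>u. \<psi> (x * y # u)) w' - cut_sum (\<lambda>u v. merge_sum (\<lambda>a. \<psi> (x # a) v) u) w"
      unfolding w cut_sum_Cons by (simp add: cut_sum_diff cut_sum_minus del: merge_sum.simps(1))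
    have 3: "cut_sum (\<lambda>u v. psign (int (length (x # u))) (merge_sum (\<psi> (x # u)) v)) w
       = - cut_sum (\<lambda>u v. psign (int (length u)) (merge_sum (\<psi> (x # u)) v)) w"
      unfolding cut_sum_minus[symmetric] by (rule cut_sum_cong) (simp add: psign_def)
    have 4: "merge_sum (\<psi> []) (x # w) = - \<psi> [] (x * y # w') - merge_sum (\<lambda>z. \<psi> [] (x # z)) w"
      by (simp add: w)
    show ?thesis
      unfolding 1 cut_sum_Cons[of _ x w] cut_sum_add 2 3 using 4 by (simp add: cut_sum_Cons)
  qed
qed

text \<open>Disjoint merges cancel in pairs by sign, and the two ways to merge three consecutive letters cancel
  by associativity.\<close>

lemma merge_sum_merge_sum: "merge_sum (merge_sum \<phi>) w = 0" for \<phi> :: "'a::semigroup_mult list \<Rightarrow> 'b::ab_group_add"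
proof (induction w arbitrary: \<phi> rule: length_induct)
  case (1 w)
  show ?case
  proof (cases w rule: remdups_adj.cases)
    case (3 x y w')
    show ?thesis
    proof (cases w')
      case Nil
      then show ?thesis by (simp add: 3)
    next
      case w': (Cons z v)
      have "merge_sum (\<lambda>t. merge_sum \<phi> (x # t)) (y # w')
          = merge_sum (\<lambda>t. - \<phi> (x * hd t # tl t) + - merge_sum (\<lambda>s. \<phi> (x # s)) t) (y # w')"
      proof (rule merge_sum_cong)
        fix t :: "'a list" assume "Suc (length t) = length (y # w')"
        then obtain c t' where "t = c # t'" by (cases t) (auto simp: w')
        then show "merge_sum \<phi> (x # t) = - \<phi> (x * hd t # tl t) + - merge_sum (\<lambda>s. \<phi> (x # s)) t"
          by simp
      qed
      also have "\<dots> = - merge_sum (\<lambda>t. \<phi> (x * hd t # tl t)) (y # w')"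
        unfolding merge_sum_add merge_sum_minus using 1 by (simp add: 3 del: merge_sum.simps(1))
      finally show ?thesis by (simp add: 3 w' mult.assoc)
    qed
  qed simp_all
qed

lemma hochschild_merge:
  "hochschild f w = (if w = [] then 0 else hd w * f (tl w) + merge_sum f w
     + psign (int (length w)) (f (butlast w) * last w))"
  for f :: "'a::ring cochain"
proof (cases w)
  case (Cons x w')
  have "(\<Sum>i = 1..length w'. psign (int i) (f (take (i - 1) (x # w') @ [(x # w') ! (i - 1) * (x # w') ! i] @ drop (i + 1) (x # w'))))
      = merge_sum f (x # w')" for f :: "'a list \<Rightarrow> 'a"
  proof (induction w' arbitrary: f x)
    case (Cons y v f x)
    let ?g = "\<lambda>f x w i. psign (int i) (f (take (i - 1) (x # w) @ [(x # w) ! (i - 1) * (x # w) ! i] @ drop (i + 1) (x # w)))"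
    have "sum (?g f x (y # v)) {1..length (y # v)}
      = ?g f x (y # v) 1 + (\<Sum>i = Suc 1..Suc (length v). ?g f x (y # v) i)"
    proof -
      have "{1..length (y # v)} = insert 1 {Suc 1..Suc (length v)}" by auto
      then show ?thesis by (simp only:) (rule sum.insert, simp_all)
    qed
    also have "(\<Sum>i = Suc 1..Suc (length v). ?g f x (y # v) i) = (\<Sum>i = 1..length v. ?g f x (y # v) (Suc i))"
      by (rule sum.shift_bounds_cl_Suc_ivl)
    also have "\<dots> = (\<Sum>i = 1..length v. - ?g (\<lambda>z. f (x # z)) y v i)"
    proof (rule sum.cong)
      fix i assume "i \<in> {1..length v}"
      then obtain j where "i = Suc j" by (cases i) auto
      then show "?g f x (y # v) (Suc i) = - ?g (\<lambda>z. f (x # z)) y v i"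
        by (simp add: psign_def)
    qed simp
    also have "\<dots> = - merge_sum (\<lambda>z. f (x # z)) (y # v)"
      using Cons.IH[of "\<lambda>z. f (x # z)" y] by (simp add: sum_negf)
    also have "?g f x (y # v) 1 = - f (x * y # v)"
      by (simp add: psign_def)
    finally show ?case by simp
  qed simp
  then show ?thesis
    by (simp add: Cons hochschild_def Let_def add.commute)
qed (simp add: hochschild_def)

section \<open>Higher products of a square-zero operator on an associative algebra\<close>

text \<open>The products are studied on words of letters \<open>(p, x)\<close>, where \<open>p\<close> only determines signs. The set
  \<open>K\<close> contains all homogeneous parts \<open>V p\<close> and is closed under the operations; working in \<open>K\<close> allows an
  inhomogeneous operator such as the sum of two operators of different odd degrees.\<close>

locale graded_product =
  fixes V :: "int \<Rightarrow> 'v::ab_group_add set" and K :: "'v set"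
    and cup :: "'v \<Rightarrow> 'v \<Rightarrow> 'v" (infixl "\<star>" 70) and e :: 'v
  assumes V_K: "x \<in> V p \<Longrightarrow> x \<in> K"
    and V_0: "0 \<in> V p" and V_add: "x \<in> V p \<Longrightarrow> y \<in> V p \<Longrightarrow> x + y \<in> V p"
    and V_minus: "x \<in> V p \<Longrightarrow> - x \<in> V p"
    and K_add: "x \<in> K \<Longrightarrow> y \<in> K \<Longrightarrow> x + y \<in> K"
    and K_minus: "x \<in> K \<Longrightarrow> - x \<in> K"
    and V_cup: "x \<in> V p \<Longrightarrow> y \<in> V q \<Longrightarrow> x \<star> y \<in> V (p + q)"
    and K_cup: "x \<in> K \<Longrightarrow> y \<in> K \<Longrightarrow> x \<star> y \<in> K"
    and V_unit: "e \<in> V 0"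
    and cup_assoc: "(x \<star> y) \<star> z = x \<star> (y \<star> z)"
    and cup_add_left: "(x + y) \<star> z = x \<star> z + y \<star> z"
    and cup_add_right: "z \<star> (x + y) = z \<star> x + z \<star> y"
    and unit_cup [simp]: "e \<star> x = x"
    and cup_unit [simp]: "x \<star> e = x"
begin

lemma K_0: "0 \<in> K"
  using V_0 V_K by blast

lemma K_diff: "x \<in> K \<Longrightarrow> y \<in> K \<Longrightarrow> x - y \<in> K"
  using K_add[OF _ K_minus, of x y] by simp

lemma V_diff: "x \<in> V p \<Longrightarrow> y \<in> V p \<Longrightarrow> x - y \<in> V p"
  using V_add[OF _ V_minus, of x p y] by simp

lemma K_psign: "x \<in> K \<Longrightarrow> psign s x \<in> K"
  by (simp add: psign_def K_minus)

lemma V_psign: "x \<in> V p \<Longrightarrow> psign s x \<in> V p"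
  by (simp add: psign_def V_minus)

lemma cup_0_left [simp]: "0 \<star> x = 0"
  using cup_add_left[of 0 0 x] by simp

lemma cup_0_right [simp]: "x \<star> 0 = 0"
  using cup_add_right[of x 0 0] by simp

lemma cup_minus_left: "(- x) \<star> y = - (x \<star> y)"
  using cup_add_left[of "- x" x y] by (simp add: eq_neg_iff_add_eq_0)

lemma cup_minus_right: "x \<star> (- y) = - (x \<star> y)"
  using cup_add_right[of x "- y" y] by (simp add: eq_neg_iff_add_eq_0)

lemma cup_diff_left: "(x - y) \<star> z = x \<star> z - y \<star> z"
  using cup_add_left[of x "- y" z] by (simp add: cup_minus_left)

lemma cup_diff_right: "z \<star> (x - y) = z \<star> x - z \<star> y"
  using cup_add_right[of z x "- y"] by (simp add: cup_minus_right)

lemma cup_psign_left: "psign s x \<star> y = psign s (x \<star> y)"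
  by (simp add: psign_def cup_minus_left)

lemma cup_psign_right: "x \<star> psign s y = psign s (x \<star> y)"
  by (simp add: psign_def cup_minus_right)

lemma cut_sum_cup_left: "cut_sum \<psi> w \<star> x = cut_sum (\<lambda>u v. \<psi> u v \<star> x) w"
  by (rule cut_sum_map) (simp_all add: cup_add_left)

lemma cut_sum_cup_right: "x \<star> cut_sum \<psi> w = cut_sum (\<lambda>u v. x \<star> \<psi> u v) w"
  by (rule cut_sum_map) (simp_all add: cup_add_right)

definition word_prod :: "(int \<times> 'v) list \<Rightarrow> 'v" where
  "word_prod w = foldr (\<lambda>a. (\<star>) (snd a)) w e"

definition deg :: "(int \<times> 'v) list \<Rightarrow> int" where
  "deg w = sum_list (map fst w)"

definition letters :: "(int \<times> 'v) list \<Rightarrow> bool" where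
  "letters w \<longleftrightarrow> (\<forall>a \<in> set w. snd a \<in> K)"

definition graded_word :: "(int \<times> 'v) list \<Rightarrow> bool" where
  "graded_word w \<longleftrightarrow> (\<forall>a \<in> set w. snd a \<in> V (fst a))"

definition op_word :: "('v \<Rightarrow> 'v) \<Rightarrow> (int \<times> 'v) list \<Rightarrow> 'v" where
  "op_word D w = (if w = [] then 0 else D (word_prod w))"

text \<open>The failure of \<open>D\<close> to be linear over multiplication with the last letter. The higher products
  measure the same failure at both ends of the word.\<close>

definition right_defect :: "('v \<Rightarrow> 'v) \<Rightarrow> (int \<times> 'v) list \<Rightarrow> 'v" where
  "right_defect D w =
    (if w = [] then 0 else op_word D w - op_word D (butlast w) \<star> snd (last w))"

definition boerjeson :: "('v \<Rightarrow> 'v) \<Rightarrow> (int \<times> 'v) list \<Rightarrow> 'v" where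
  "boerjeson D w =
    (if w = [] then 0
     else right_defect D w - psign (fst (hd w)) (snd (hd w) \<star> right_defect D (tl w)))"

text \<open>One term of the \<open>A\<^sub>\<infinity>\<close>-relation on the word \<open>x @ y @ z\<close>, with its Koszul sign. The result of the
  inner operation gets degree \<open>deg y - 1\<close>; for an operator of degree \<open>1\<close> this has the right parity.\<close>

definition boerjeson_insert where
  "boerjeson_insert D E x y z = psign (deg x) (boerjeson D (x @ (deg y - 1, boerjeson E y) # z))"

lemma word_prod_simps [simp]: "word_prod [] = e" "word_prod (a # w) = snd a \<star> word_prod w"
  by (simp_all add: word_prod_def)

lemma word_prod_append [simp]: "word_prod (u @ v) = word_prod u \<star> word_prod v"
  by (induction u) (simp_all add: cup_assoc)

lemma deg_simps [simp]: "deg [] = 0" "deg (a # w) = fst a + deg w" "deg (u @ v) = deg u + deg v"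
  by (simp_all add: deg_def)

lemma letters_simps [simp]: "letters []" "letters (a # w) \<longleftrightarrow> snd a \<in> K \<and> letters w"
    "letters (u @ v) \<longleftrightarrow> letters u \<and> letters v"
  by (auto simp: letters_def)

lemma graded_word_simps [simp]: "graded_word []"
    "graded_word (a # w) \<longleftrightarrow> snd a \<in> V (fst a) \<and> graded_word w"
    "graded_word (u @ v) \<longleftrightarrow> graded_word u \<and> graded_word v"
  by (auto simp: graded_word_def)

lemma graded_word_letters: "graded_word w \<Longrightarrow> letters w"
  by (auto simp: letters_def graded_word_def V_K)

lemma word_prod_K: "letters w \<Longrightarrow> word_prod w \<in> K"
  by (induction w) (auto intro: K_cup V_K[OF V_unit])

lemma word_prod_V: "graded_word w \<Longrightarrow> word_prod w \<in> V (deg w)"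
  by (induction w) (auto intro: V_cup V_unit)

lemma op_word_Nil [simp]: "op_word D [] = 0"
  by (simp add: op_word_def)

lemma right_defect_Nil [simp]: "right_defect D [] = 0"
  by (simp add: right_defect_def)

lemma boerjeson_Nil [simp]: "boerjeson D [] = 0"
  by (simp add: boerjeson_def)

lemma right_defect_snoc: "right_defect D (u @ [a]) = op_word D (u @ [a]) - op_word D u \<star> snd a"
  by (simp add: right_defect_def)

lemma boerjeson_Cons: "boerjeson D (a # w) =
    right_defect D (a # w) - psign (fst a) (snd a \<star> right_defect D w)"
  by (simp add: boerjeson_def)

lemma boerjeson_single: "boerjeson D [a] = D (snd a)"
  by (simp add: boerjeson_Cons right_defect_def op_word_def)

lemma boerjeson_pair: "boerjeson D [a, b] =
    D (snd a \<star> snd b) - D (snd a) \<star> snd b - psign (fst a) (snd a \<star> D (snd b))"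
  by (simp add: boerjeson_Cons right_defect_def op_word_def)

text \<open>The sum telescopes: the second part of \<open>right_defect\<close> for a longer left factor cancels the first
  part for a shorter one. The next lemma is the same argument at the left end.\<close>

lemma cut_sum_right_defect: "cut_sum (\<lambda>y z. right_defect D y \<star> word_prod z) w = op_word D w"
proof -
  define h where "h u a v = op_word D u \<star> (snd a \<star> word_prod v)" for u and a :: "int \<times> 'v" and v
  have "cut_sum (\<lambda>y z. right_defect D y \<star> word_prod z) w
      = cut_sum (\<lambda>y z. op_word D y \<star> word_prod z - (if y = [] then 0 else h (butlast y) (last y) z)) w"
    by (rule cut_sum_cong) (simp add: right_defect_def h_def cup_diff_left cup_assoc)
  also have "\<dots> = cut_sum (\<lambda>y z. op_word D y \<star> word_prod z) w
      - cut_sum (\<lambda>u v. if v = [] then 0 else h u (hd v) (tl v)) w"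
    by (simp add: cut_sum_diff cut_sum_shift)
  also have "\<dots> = cut_sum (\<lambda>u v. if v = [] then op_word D u else 0) w"
    unfolding cut_sum_diff[symmetric]
  proof (rule cut_sum_cong)
    fix u v
    show "op_word D u \<star> word_prod v - (if v = [] then 0 else h u (hd v) (tl v))
        = (if v = [] then op_word D u else 0)"
      by (cases v) (simp_all add: h_def)
  qed
  finally show ?thesis by (simp add: cut_sum_Nil_right)
qed

lemma cut_sum_boerjeson:
  "cut_sum (\<lambda>x y. psign (deg x) (word_prod x \<star> boerjeson D y)) w = right_defect D w"
proof -
  define h where "h u a v = psign (deg u + fst a) (word_prod u \<star> snd a \<star> right_defect D v)" for u a v
  have "cut_sum (\<lambda>x y. psign (deg x) (word_prod x \<star> boerjeson D y)) w
      = cut_sum (\<lambda>x y. psign (deg x) (word_prod x \<star> right_defect D y)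
          - (if y = [] then 0 else h x (hd y) (tl y))) w"
    by (rule cut_sum_cong)
      (simp add: boerjeson_def h_def cup_diff_right cup_assoc cup_psign_right psign_diff)
  also have "\<dots> = cut_sum (\<lambda>x y. psign (deg x) (word_prod x \<star> right_defect D y)
          - (if x = [] then 0 else h (butlast x) (last x) y)) w"
    by (simp add: cut_sum_diff cut_sum_shift)
  also have "\<dots> = cut_sum (\<lambda>x y. if x = [] then right_defect D y else 0) w"
  proof (rule cut_sum_cong)
    fix x y
    show "psign (deg x) (word_prod x \<star> right_defect D y)
          - (if x = [] then 0 else h (butlast x) (last x) y)
        = (if x = [] then right_defect D y else 0)"
      by (cases x rule: rev_cases) (simp_all add: h_def)
  qed
  finally show ?thesis by (simp add: cut_sum_Nil_left)
qed

text \<open>In the language of coalgebras: \<open>D\<close> composed with the automorphism given by the iterated products is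
  this automorphism composed with the coderivation given by the higher products.\<close>

lemma op_word_expansion:
  "op_word D w = cut_sum (\<lambda>x r. cut_sum (\<lambda>y z.
     psign (deg x) (word_prod x \<star> (boerjeson D y \<star> word_prod z))) r) w"
proof -
  have "op_word D w = cut_sum (\<lambda>u z. cut_sum (\<lambda>x y.
      psign (deg x) (word_prod x \<star> (boerjeson D y \<star> word_prod z))) u) w"
    unfolding cut_sum_right_defect[symmetric, of D w] cut_sum_boerjeson[symmetric] cut_sum_cup_left
    by (simp add: cup_psign_left cup_assoc)
  then show ?thesis by (simp only: cut_sum_assoc)
qed

text \<open>The expansion of a word with a distinguished letter \<open>b\<close>, sorted by whether \<open>b\<close> lies to the right of the
  inner operation, among its arguments, or to its left.\<close>

lemma op_word_letter_expansion:
  "op_word D (x @ b # z) =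
      cut_sum (\<lambda>u v. cut_sum (\<lambda>y t.
        psign (deg u) (word_prod u \<star> (boerjeson D y \<star> (word_prod t \<star> (snd b \<star> word_prod z))))) v) x
    + cut_sum (\<lambda>u v. cut_sum (\<lambda>t s.
        psign (deg u) (word_prod u \<star> (boerjeson D (v @ b # t) \<star> word_prod s))) z) x
    + cut_sum (\<lambda>u v. cut_sum (\<lambda>y s.
        psign (deg x + fst b + deg u)
          (word_prod x \<star> (snd b \<star> (word_prod u \<star> (boerjeson D y \<star> word_prod s))))) v) z"
  unfolding op_word_expansion[of D "x @ b # z"]
  by (simp add: cut_sum_append_Cons cut_sum_add cup_assoc add.assoc)

end

text \<open>No degree is prescribed for \<open>D\<close>, so that the results apply to the sum of two operators of degrees
  \<open>-1\<close> and \<open>1\<close>.\<close>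

locale square_zero_operator = graded_product +
  fixes D :: "'a \<Rightarrow> 'a"
  assumes D_K: "x \<in> K \<Longrightarrow> D x \<in> K"
    and D_add: "x \<in> K \<Longrightarrow> y \<in> K \<Longrightarrow> D (x + y) = D x + D y"
    and D_D: "x \<in> K \<Longrightarrow> D (D x) = 0"
begin

lemma D_0 [simp]: "D 0 = 0"
  using D_add[OF K_0 K_0] by simp

lemma D_minus: "x \<in> K \<Longrightarrow> D (- x) = - D x"
  using D_add[of x "- x"] by (simp add: K_minus eq_neg_iff_add_eq_0 add.commute)

lemma D_psign: "x \<in> K \<Longrightarrow> D (psign s x) = psign s (D x)"
  by (simp add: psign_def D_minus)

lemma D_cut_sum:
  assumes "\<And>u v. u @ v = w \<Longrightarrow> \<psi> u v \<in> K"
  shows "cut_sum \<psi> w \<in> K" "D (cut_sum \<psi> w) = cut_sum (\<lambda>u v. D (\<psi> u v)) w"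
  using cut_sum_hom[of D K w \<psi>] assms by (auto simp: D_add K_0 K_add)

lemma op_word_K: "letters w \<Longrightarrow> op_word D w \<in> K"
  by (simp add: op_word_def D_K word_prod_K K_0)

lemma right_defect_K: "letters w \<Longrightarrow> right_defect D w \<in> K"
  by (cases w rule: rev_cases)
    (simp_all add: right_defect_snoc op_word_K K_diff K_cup K_0)

lemma boerjeson_K: "letters w \<Longrightarrow> boerjeson D w \<in> K"
  by (cases w) (simp_all add: boerjeson_Cons right_defect_K K_diff K_cup K_0 K_psign)

lemma D_op_word: "letters w \<Longrightarrow> D (op_word D w) = 0"
  by (simp add: op_word_def D_D word_prod_K)

text \<open>This is \<open>D (D (word_prod w)) = 0\<close> with the inner \<open>D\<close> expanded.\<close>

lemma sum_op_word_insert: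
  assumes "letters w"
  shows "cut_sum (\<lambda>x r. cut_sum (\<lambda>y z. psign (deg x) (op_word D (x @ (deg y - 1, boerjeson D y) # z))) r) w = 0"
proof -
  let ?t = "\<lambda>x y z. psign (deg x) (word_prod x \<star> (boerjeson D y \<star> word_prod z))"
  have K: "?t x y z \<in> K" if "x @ y @ z = w" for x y z
    using assms that by (auto intro!: K_psign K_cup word_prod_K boerjeson_K)
  have "0 = D (op_word D w)"
    by (simp add: assms D_op_word)
  also have "\<dots> = D (cut_sum (\<lambda>x r. cut_sum (?t x) r) w)"
    by (simp add: op_word_expansion)
  also have "\<dots> = cut_sum (\<lambda>x r. D (cut_sum (?t x) r)) w"
    by (rule D_cut_sum) (auto intro!: D_cut_sum K)
  also have "\<dots> = cut_sum (\<lambda>x r. cut_sum (\<lambda>y z. D (?t x y z)) r) w"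
    by (intro cut_sum_cong D_cut_sum K) auto
  also have "\<dots> = cut_sum (\<lambda>x r. cut_sum (\<lambda>y z. psign (deg x) (op_word D (x @ (deg y - 1, boerjeson D y) # z))) r) w"
    using assms
    by (intro cut_sum_cong) (auto simp: op_word_def intro!: D_psign K_cup word_prod_K boerjeson_K)
  finally show ?thesis by simp
qed

text \<open>Expanding also the outer \<open>D\<close> gives three kinds of terms. Those in which the two operations have
  disjoint sets of arguments occur twice, with opposite signs because both operations are odd (the terms
  \<open>F\<close>). What remains (the terms \<open>G\<close>) is the sum of the relations for all subwords, multiplied with the letters around
  them.\<close>

lemma sum_word_prod_insert:
  assumes "letters w"
  shows "cut_sum (\<lambda>u r. cut_sum (\<lambda>s v. word_prod u \<star>
      (cut_sum (\<lambda>x q. cut_sum (\<lambda>y z. boerjeson_insert D D x y z) q) s \<star> word_prod v)) r) w = 0"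
proof -
  let ?B = "boerjeson D" and ?P = word_prod
  define F where "F u y t y' z = psign (deg y + deg t)
      (?P u \<star> (?B y \<star> (?P t \<star> (?B y' \<star> ?P z))))" for u y t y' z
  define G where "G u v y t s = psign (deg v) (?P u \<star> (?B (v @ (deg y - 1, ?B y) # t) \<star> ?P s))" for u v y t s
  have "0 = cut_sum (\<lambda>x r. cut_sum (\<lambda>y z. psign (deg x) (op_word D (x @ (deg y - 1, ?B y) # z))) r) w"
    using sum_op_word_insert[OF assms] by simp
  also have "\<dots> = cut_sum (\<lambda>x r. cut_sum (\<lambda>y z.
        cut_sum (\<lambda>u v. cut_sum (\<lambda>y' t. F u y' t y z) v) x
      + cut_sum (\<lambda>u v. cut_sum (\<lambda>t s. G u v y t s) z) x
      + cut_sum (\<lambda>u v. cut_sum (\<lambda>y' s. - F x y u y' s) v) z) r) w"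
    unfolding op_word_letter_expansion psign_add cut_sum_psign F_def G_def
    by (intro cut_sum_cong arg_cong2[where f = "(+)"]) (auto simp: minus_psign intro!: psign_cong)
  also have "\<dots> =
      cut_sum (\<lambda>x r. cut_sum (\<lambda>y z. cut_sum (\<lambda>u v. cut_sum (\<lambda>y' t. F u y' t y z) v) x) r) w
    + cut_sum (\<lambda>x r. cut_sum (\<lambda>y z. cut_sum (\<lambda>u v. cut_sum (\<lambda>t s. G u v y t s) z) x) r) w
    - cut_sum (\<lambda>x r. cut_sum (\<lambda>y z. cut_sum (\<lambda>u v. cut_sum (\<lambda>y' s. F x y u y' s) v) z) r) w"
    unfolding cut_sum_add cut_sum_minus by simp
  also have "cut_sum (\<lambda>x r. cut_sum (\<lambda>y z. cut_sum (\<lambda>u v. cut_sum (\<lambda>y' t. F u y' t y z) v) x) r) w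
    = cut_sum (\<lambda>x r. cut_sum (\<lambda>u v. cut_sum (\<lambda>y' t. cut_sum (\<lambda>y z. F u y' t y z) r) v) x) w"
    by (subst cut_sum_swap, subst (2) cut_sum_swap) simp
  also have "\<dots> = cut_sum (\<lambda>u r. cut_sum (\<lambda>y' q. cut_sum (\<lambda>t s. cut_sum (\<lambda>y z. F u y' t y z) s) q) r) w"
    by (simp only: cut_sum_assoc)
  also have "cut_sum (\<lambda>x r. cut_sum (\<lambda>y z. cut_sum (\<lambda>u v. cut_sum (\<lambda>t s. G u v y t s) z) x) r) w
    = cut_sum (\<lambda>x r. cut_sum (\<lambda>u v. cut_sum (\<lambda>y z. cut_sum (\<lambda>t s. G u v y t s) z) r) x) w"
    by (subst cut_sum_swap) simp
  also have "\<dots> = cut_sum (\<lambda>u q. cut_sum (\<lambda>v r. cut_sum (\<lambda>y z. cut_sum (\<lambda>t s. G u v y t s) z) r) q) w"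
    by (simp only: cut_sum_assoc)
  also have "\<dots> = cut_sum (\<lambda>u r. cut_sum (\<lambda>q s. cut_sum (\<lambda>v p. cut_sum (\<lambda>y t. G u v y t s) p) q) r) w"
    by (simp only: cut_sum_assoc)
  also have "\<dots> = cut_sum (\<lambda>u r. cut_sum (\<lambda>s v. ?P u \<star>
      (cut_sum (\<lambda>x q. cut_sum (\<lambda>y z. boerjeson_insert D D x y z) q) s \<star> ?P v)) r) w"
    by (simp add: G_def boerjeson_insert_def cut_sum_cup_left cut_sum_cup_right cup_psign_left cup_psign_right)
  finally show ?thesis by simp
qed

text \<open>The relations for proper subwords vanish by induction, so that the previous sum reduces to the relation for
  the word itself.\<close>

theorem boerjeson_relation:
  assumes "letters w"
  shows "cut_sum (\<lambda>x r. cut_sum (\<lambda>y z. boerjeson_insert D D x y z) r) w = 0"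
  using assms
proof (induction w rule: length_induct)
  case (1 w)
  let ?S = "\<lambda>s. cut_sum (\<lambda>x r. cut_sum (\<lambda>y z. boerjeson_insert D D x y z) r) s"
  have *: "?S s = (if u = [] \<and> v = [] then ?S w else 0)" if "u @ s @ v = w" for u s v
  proof (cases "u = [] \<and> v = []")
    case False
    then have "length s < length w" "letters s" using that 1 by auto
    then show ?thesis using 1 False by auto
  qed (use that in auto)
  have "0 = cut_sum (\<lambda>u r. cut_sum (\<lambda>s v. word_prod u \<star> (?S s \<star> word_prod v)) r) w"
    using sum_word_prod_insert 1 by simp
  also have "\<dots> = cut_sum (\<lambda>u r. cut_sum (\<lambda>s v. if v = [] then if u = [] then ?S w else 0 else 0) r) w"
    by (intro cut_sum_cong, subst *) auto
  also have "\<dots> = ?S w"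
    by (simp add: cut_sum_Nil_right cut_sum_Nil_left[of "\<lambda>_. ?S w"])
  finally show ?case by simp
qed

end

context graded_product
begin

lemma op_word_letter: "op_word D (u @ (p, x) # v) = D (word_prod u \<star> (x \<star> word_prod v))"
  by (simp add: op_word_def)

lemma right_defect_letter: "right_defect D (u @ (p, x) # v) =
    D (word_prod u \<star> (x \<star> word_prod v))
    - (if v = [] then op_word D u \<star> x
       else D (word_prod u \<star> (x \<star> word_prod (butlast v))) \<star> snd (last v))"
  by (simp add: right_defect_def op_word_letter butlast_append)

lemma boerjeson_letter: "boerjeson D (u @ (p, x) # v) =
    (if u = [] then right_defect D ((p, x) # v) - psign p (x \<star> right_defect D v)
     else right_defect D (u @ (p, x) # v)
       - psign (fst (hd u)) (snd (hd u) \<star> right_defect D (tl u @ (p, x) # v)))"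
  by (cases u) (simp_all add: boerjeson_Cons)

lemma letters_butlast: "letters v \<Longrightarrow> letters (butlast v)"
  by (auto simp: letters_def dest: in_set_butlastD)

lemma letters_tl: "letters v \<Longrightarrow> letters (tl v)"
  by (cases v) auto

text \<open>Degrees enter only through signs.\<close>

lemma boerjeson_parity:
  assumes "even p = even q"
  shows "boerjeson D (u @ (p, x) # v) = boerjeson D (u @ (q, x) # v)"
  using right_defect_letter[of D "[]"]
  by (simp add: boerjeson_letter right_defect_letter psign_cong[OF assms])

lemma op_word_plus: "op_word (\<lambda>x. D x + E x) w = op_word D w + op_word E w"
  by (simp add: op_word_def)

lemma right_defect_plus: "right_defect (\<lambda>x. D x + E x) w = right_defect D w + right_defect E w"
  by (simp add: right_defect_def op_word_plus cup_add_left)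

lemma boerjeson_plus: "boerjeson (\<lambda>x. D x + E x) w = boerjeson D w + boerjeson E w"
  by (simp add: boerjeson_def right_defect_plus cup_add_right psign_add)

lemma boerjeson_degree:
  assumes "\<And>x p. x \<in> V p \<Longrightarrow> D x \<in> V (p + d)" and "graded_word w"
  shows "boerjeson D w \<in> V (deg w + d)"
proof -
  have op: "op_word D w \<in> V (deg w + d)" if "graded_word w" for w
    using that by (simp add: op_word_def assms word_prod_V V_0)
  have right: "right_defect D w \<in> V (deg w + d)" if "graded_word w" for w
  proof (cases w rule: rev_cases)
    case (snoc u a)
    then have "op_word D u \<star> snd a \<in> V (deg u + d + fst a)"
      using that op[of u] by (auto intro: V_cup)
    then show ?thesis using op[OF that] snoc
      by (auto simp: right_defect_snoc algebra_simps intro: V_diff)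
  qed (simp add: V_0)
  show ?thesis
  proof (cases w)
    case (Cons a u)
    then have "snd a \<star> right_defect D u \<in> V (fst a + (deg u + d))"
      using assms right[of u] by (auto intro: V_cup)
    then show ?thesis using right[OF assms(2)] Cons
      by (auto simp: boerjeson_Cons algebra_simps intro: V_diff V_psign)
  qed (simp add: V_0)
qed

end

context square_zero_operator
begin

lemma boerjeson_letter_add:
  assumes "letters u" "letters v" "x \<in> K" "y \<in> K"
  shows "boerjeson D (u @ (p, x + y) # v) = boerjeson D (u @ (p, x) # v) + boerjeson D (u @ (p, y) # v)"
proof -
  have right: "right_defect D (u @ (p, x + y) # v) = right_defect D (u @ (p, x) # v) + right_defect D (u @ (p, y) # v)"
    if "letters u" for u
    using assms that
    by (simp add: right_defect_letter D_add K_cup word_prod_K letters_butlast cup_add_left cup_add_right)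
  show ?thesis
    using right[OF assms(1)] right[of "[]"] right[OF letters_tl[OF assms(1)]]
    by (simp add: boerjeson_letter cup_add_left cup_add_right psign_add)
qed

lemma boerjeson_letter_0:
  assumes "letters u" "letters v"
  shows "boerjeson D (u @ (p, 0) # v) = 0"
  using boerjeson_letter_add[OF assms K_0 K_0, of p] by simp

text \<open>With \<open>h\<close> the multiplication by a scalar, this is the homogeneity of the higher products in every argument.\<close>

lemma boerjeson_letter_hom:
  assumes "letters u" "letters v" "x \<in> K"
    and h_diff: "\<And>x y. h (x - y) = h x - h y"
    and h_left: "\<And>x y. h x \<star> y = h (x \<star> y)" and h_right: "\<And>x y. x \<star> h y = h (x \<star> y)"
    and h_D: "\<And>x. x \<in> K \<Longrightarrow> D (h x) = h (D x)"
  shows "boerjeson D (u @ (p, h x) # v) = h (boerjeson D (u @ (p, x) # v))"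
proof -
  have h_psign: "psign s (h z) = h (psign s z)" for s z
    using h_diff[of 0 z] h_diff[of 0 0] by (simp add: psign_def)
  have right: "right_defect D (u @ (p, h x) # v) = h (right_defect D (u @ (p, x) # v))"
    if "letters u" for u
    using assms(1-3) that
    by (simp add: right_defect_letter letters_butlast h_left h_right h_D h_diff K_cup word_prod_K)
  show ?thesis
    using right[OF assms(1)] right[of "[]"] right[OF letters_tl[OF assms(1)]]
    by (simp add: boerjeson_letter h_left h_right h_diff h_psign)
qed

text \<open>The relation in terms of positions, which is the form in which \<open>A\<^sub>\<infinity>\<close>-structures are defined. The empty
  inner words contribute nothing, since they insert a zero letter.\<close>

lemma boerjeson_relation_indexed:
  assumes "length ps = length xs" "letters (zip ps xs)"
  shows "(\<Sum>(i, k) \<in> {(i, k). 1 \<le> k \<and> i + k \<le> length ps}. psign (- sum_list (take i ps))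
      (insert_op (\<lambda>ps xs. boerjeson D (zip ps xs)) i k ps xs)) = 0"
proof -
  let ?w = "zip ps xs" and ?n = "length ps"
  let ?g = "\<lambda>i k. boerjeson_insert D D (take i ?w) (take k (drop i ?w)) (drop k (drop i ?w))"
  have zero: "?g i 0 = 0" for i
  proof -
    have "letters (take i ?w)" "letters (drop i ?w)"
      using assms(2) by (auto simp: letters_def dest: in_set_takeD in_set_dropD)
    then show ?thesis by (simp add: boerjeson_insert_def boerjeson_letter_0)
  qed
  have deg_zip: "deg (zip a b) = sum_list a" if "length a = length b" for a b
    using that by (simp add: deg_def)
  have term_eq: "psign (- sum_list (take i ps)) (insert_op (\<lambda>ps xs. boerjeson D (zip ps xs)) i k ps xs) = ?g i k"
    if "i + k \<le> ?n" for i k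
  proof -
    have "zip (take i ps @ [sum_list (take k (drop i ps)) - 1] @ drop (i + k) ps)
        (take i xs @ [boerjeson D (zip (take k (drop i ps)) (take k (drop i xs)))] @ drop (i + k) xs)
      = take i ?w @ (deg (take k (drop i ?w)) - 1, boerjeson D (take k (drop i ?w))) # drop k (drop i ?w)"
      using assms(1) that
      by (simp add: take_zip drop_zip deg_zip add.commute)
    then show ?thesis
      using assms(1) unfolding insert_op_def boerjeson_insert_def
      by (auto simp: take_zip deg_zip intro!: psign_cong)
  qed
  have "(\<Sum>(i, k) \<in> {(i, k). 1 \<le> k \<and> i + k \<le> ?n}. psign (- sum_list (take i ps))
      (insert_op (\<lambda>ps xs. boerjeson D (zip ps xs)) i k ps xs))
      = (\<Sum>(i, k) \<in> {(i, k). 1 \<le> k \<and> i + k \<le> ?n}. ?g i k)"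
    by (rule sum.cong) (auto simp: term_eq)
  also have "\<dots> = (\<Sum>(i, k) \<in> Sigma {..?n} (\<lambda>i. {..?n - i}). ?g i k)"
  proof (rule sum.mono_neutral_left)
    show "\<forall>a \<in> Sigma {..?n} (\<lambda>i. {..?n - i}) - {(i, k). 1 \<le> k \<and> i + k \<le> ?n}.
        (case a of (i, k) \<Rightarrow> ?g i k) = 0"
    proof
      fix a assume "a \<in> Sigma {..?n} (\<lambda>i. {..?n - i}) - {(i, k). 1 \<le> k \<and> i + k \<le> ?n}"
      then obtain i where "a = (i, 0)" by (cases a) auto
      then show "(case a of (i, k) \<Rightarrow> ?g i k) = 0"
        using zero[of i] by (simp only: case_prod_conv)
    qed
  qed auto
  also have "\<dots> = (\<Sum>i\<le>?n. \<Sum>k\<le>?n - i. ?g i k)"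
    by (simp add: sum.Sigma)
  also have "\<dots> = cut_sum (\<lambda>x r. cut_sum (\<lambda>y z. boerjeson_insert D D x y z) r) ?w"
    using assms(1) by (simp add: cut_sum_index)
  finally show ?thesis
    using boerjeson_relation[OF assms(2)] by simp
qed

end

text \<open>In the application \<open>D\<close> is the Connes operator and \<open>E\<close> is the Hochschild differential.\<close>

locale square_zero_derivation_pair = square_zero_operator +
  fixes E :: "'a \<Rightarrow> 'a"
  assumes D_V: "x \<in> V p \<Longrightarrow> D x \<in> V (p - 1)"
    and E_K: "x \<in> K \<Longrightarrow> E x \<in> K"
    and E_V: "x \<in> V p \<Longrightarrow> E x \<in> V (p + 1)"
    and E_add: "E (x + y) = E x + E y"
    and E_E: "x \<in> K \<Longrightarrow> E (E x) = 0"
    and D_E: "x \<in> K \<Longrightarrow> D (E x) + E (D x) = 0"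
    and E_cup: "x \<in> V p \<Longrightarrow> y \<in> K \<Longrightarrow> E (x \<star> y) = E x \<star> y + psign p (x \<star> E y)"
begin

sublocale total: square_zero_operator V K cup e "\<lambda>x. D x + E x"
proof
  fix x assume "x \<in> K"
  then have "D (D x + E x) + E (D x + E x) = D (D x) + (D (E x) + E (D x)) + E (E x)"
    by (simp add: D_add D_K E_K E_add)
  then show "D (D x + E x) + E (D x + E x) = 0"
    using \<open>x \<in> K\<close> by (simp add: D_D D_E E_E)
qed (simp_all add: D_K E_K K_add D_add E_add)

text \<open>Letters across which \<open>E\<close> moves with the sign given by their label. This only depends on the parity of the label
  and is closed under sums, so it also holds for sums of elements of degrees \<open>p - 1\<close> and \<open>p + 1\<close>.\<close>

definition sign_letter :: "int \<times> 'a \<Rightarrow> bool" where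
  "sign_letter a \<longleftrightarrow> snd a \<in> K \<and>
    (\<forall>y \<in> K. E (snd a \<star> y) = E (snd a) \<star> y + psign (fst a) (snd a \<star> E y))"

lemma sign_letter_V: "x \<in> V p \<Longrightarrow> even p = even q \<Longrightarrow> sign_letter (q, x)"
  using psign_cong[of p q] by (auto simp: sign_letter_def V_K E_cup)

lemma sign_letter_add: "sign_letter (p, x) \<Longrightarrow> sign_letter (p, y) \<Longrightarrow> sign_letter (p, x + y)"
  by (simp add: sign_letter_def K_add cup_add_left E_add psign_add ac_simps)

lemma E_0 [simp]: "E 0 = 0"
  using E_add[of 0 0] by simp

lemma E_unit: "E e = 0"
  using E_cup[OF V_unit V_K[OF V_unit]] by simp

lemma E_word_prod:
  "\<forall>a \<in> set u. sign_letter a \<Longrightarrow> y \<in> K \<Longrightarrow>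
    E (word_prod u \<star> y) = E (word_prod u) \<star> y + psign (deg u) (word_prod u \<star> E y)"
proof (induction u)
  case (Cons a u)
  have K: "word_prod u \<in> K" "word_prod u \<star> y \<in> K"
    using Cons.prems by (auto intro!: word_prod_K K_cup simp: letters_def sign_letter_def)
  then show ?case
    using Cons by (simp add: sign_letter_def cup_assoc psign_add cup_add_left cup_add_right cup_psign_left cup_psign_right)
qed (simp add: E_unit)

lemma right_defect_derivation:
  assumes "\<forall>b \<in> set u. sign_letter b" "snd a \<in> K"
  shows "right_defect E (u @ [a]) = psign (deg u) (word_prod u \<star> E (snd a))"
  using E_word_prod[OF assms] by (simp add: right_defect_snoc op_word_def E_unit)

text \<open>A derivation has no defect, so all of its higher products vanish except the unary one.\<close>

lemma boerjeson_derivation: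
  assumes "\<forall>a \<in> set w. sign_letter a"
  shows "boerjeson E w = (if length w = 1 then E (snd (hd w)) else 0)"
proof (cases w rule: rev_cases)
  case (snoc u a)
  show ?thesis
  proof (cases u)
    case Nil
    then show ?thesis by (simp add: snoc boerjeson_single)
  next
    case (Cons b u')
    have *: "snd a \<in> K"
      using assms snoc by (auto simp: sign_letter_def)
    show ?thesis
      using right_defect_derivation[of "b # u'" a, OF _ *] right_defect_derivation[of "u'" a, OF _ *] assms snoc Cons
      by (simp add: boerjeson_Cons cup_psign_right cup_assoc)
  qed
qed simp

lemma boerjeson_V: "graded_word w \<Longrightarrow> boerjeson D w \<in> V (deg w - 1)"
  using boerjeson_degree[of D "- 1" w] D_V by simp

lemma graded_word_sign_letter: "graded_word w \<Longrightarrow> a \<in> set w \<Longrightarrow> sign_letter a"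
  using sign_letter_V[of "snd a" "fst a" "fst a"] by (simp add: graded_word_def)

text \<open>The higher products of \<open>D + E\<close> are those of \<open>D\<close> plus those of \<open>E\<close>, and the latter are concentrated in arity one.
  The relation for \<open>D + E\<close> minus the relation for \<open>D\<close> thus only contains the terms in which \<open>E\<close> is applied to the result
  of a higher product of \<open>D\<close> or to one of its arguments; the term with two \<open>E\<close> vanishes as \<open>E\<close> has square zero.\<close>

theorem boerjeson_compatible:
  assumes w: "graded_word w"
  shows "E (boerjeson D w) + cut_sum (\<lambda>u v. if v = [] then 0
      else psign (deg u) (boerjeson D (u @ (fst (hd v) + 1, E (snd (hd v))) # tl v))) w = 0"
proof -
  let ?T = "\<lambda>x. D x + E x"
  have E_word: "boerjeson E y = (if length y = 1 then E (snd (hd y)) else 0)" if "graded_word y" for y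
    using that by (intro boerjeson_derivation) (auto intro: graded_word_sign_letter)
  have K: "boerjeson D y \<in> K" "boerjeson E y \<in> K" if "graded_word y" for y
  proof -
    show "boerjeson D y \<in> K"
      using that by (intro boerjeson_K graded_word_letters)
    show "boerjeson E y \<in> K"
    proof (rule V_K)
      show "boerjeson E y \<in> V (deg y + 1)"
        by (rule boerjeson_degree[OF _ that]) (rule E_V)
    qed
  qed
  have insert: "boerjeson_insert ?T ?T x y z = boerjeson_insert D D x y z + boerjeson_insert D E x y z
      + (if z = [] then if x = [] then E (boerjeson D w) else 0 else 0)"
    if xyz: "x @ y @ z = w" for x y z
  proof -
    have g: "graded_word x" "graded_word y" "graded_word z"
      using w that by auto
    have "sign_letter (deg y - 1, boerjeson D y)"
      using boerjeson_V[OF g(2)] by (rule sign_letter_V) simp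
    moreover have "sign_letter (deg y - 1, boerjeson E y)"
    proof (rule sign_letter_V)
      show "boerjeson E y \<in> V (deg y + 1)"
        by (rule boerjeson_degree[OF _ g(2)]) (rule E_V)
    qed simp
    ultimately have "sign_letter (deg y - 1, boerjeson ?T y)"
      by (simp add: boerjeson_plus sign_letter_add)
    then have "boerjeson E (x @ (deg y - 1, boerjeson ?T y) # z)
        = (if x = [] \<and> z = [] then E (boerjeson ?T y) else 0)"
      using g graded_word_sign_letter by (subst boerjeson_derivation) auto
    moreover have "E (boerjeson E y) = 0"
      using g(2) by (cases y) (auto simp: E_word E_E V_K)
    moreover have "boerjeson D (x @ (deg y - 1, boerjeson ?T y) # z)
       = boerjeson D (x @ (deg y - 1, boerjeson D y) # z) + boerjeson D (x @ (deg y - 1, boerjeson E y) # z)"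
      unfolding boerjeson_plus using g by (intro boerjeson_letter_add K graded_word_letters)
    ultimately show ?thesis
      using xyz by (auto simp: boerjeson_insert_def boerjeson_plus[of _ _ "x @ _ # z"] psign_add
          boerjeson_plus[of D E y] E_add)
  qed
  have E_insert: "cut_sum (\<lambda>y z. boerjeson_insert D E x y z) r = (if r = [] then 0
      else psign (deg x) (boerjeson D (x @ (fst (hd r) + 1, E (snd (hd r))) # tl r)))"
    if xr: "x @ r = w" for x r
  proof (cases r)
    case Nil
    then show ?thesis
      using w that graded_word_letters[of x] by (simp add: boerjeson_insert_def boerjeson_letter_0)
  next
    case r: (Cons a r')
    have g: "graded_word x" "graded_word r"
      using w that by auto
    have *: "boerjeson_insert D E x (a # u) v = (if u = [] then
          psign (deg x) (boerjeson D (x @ (fst a + 1, E (snd a)) # v)) else 0)" if "u @ v = r'" for u v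
    proof -
      have "letters x" "letters v" "graded_word (a # u)"
        using g that r graded_word_letters by auto
      then show ?thesis
        using boerjeson_parity[of "fst a - 1" "fst a + 1" D x "E (snd a)" v]
        by (simp add: boerjeson_insert_def E_word boerjeson_letter_0)
    qed
    have "boerjeson_insert D E x [] r = 0"
      using g graded_word_letters by (simp add: boerjeson_insert_def boerjeson_letter_0)
    then have "cut_sum (\<lambda>y z. boerjeson_insert D E x y z) r = cut_sum (\<lambda>u v. boerjeson_insert D E x (a # u) v) r'"
      by (simp add: r cut_sum_Cons)
    also have "\<dots> = cut_sum (\<lambda>u v. if u = [] then
          psign (deg x) (boerjeson D (x @ (fst a + 1, E (snd a)) # v)) else 0) r'"
      by (rule cut_sum_cong) (rule *)
    finally show ?thesis by (simp add: cut_sum_Nil_left r)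
  qed
  have "0 = cut_sum (\<lambda>x r. cut_sum (\<lambda>y z. boerjeson_insert ?T ?T x y z) r) w"
    using total.boerjeson_relation[OF graded_word_letters[OF w]] by simp
  also have "\<dots> = cut_sum (\<lambda>x r. cut_sum (\<lambda>y z. boerjeson_insert D D x y z) r
      + cut_sum (\<lambda>y z. boerjeson_insert D E x y z) r + (if x = [] then E (boerjeson D w) else 0)) w"
  proof (rule cut_sum_cong)
    fix x r assume xr: "x @ r = w"
    have "cut_sum (\<lambda>y z. boerjeson_insert ?T ?T x y z) r = cut_sum (\<lambda>y z. boerjeson_insert D D x y z
       + boerjeson_insert D E x y z + (if z = [] then if x = [] then E (boerjeson D w) else 0 else 0)) r"
      by (rule cut_sum_cong) (auto simp: insert xr)
    then show "cut_sum (\<lambda>y z. boerjeson_insert ?T ?T x y z) r = cut_sum (\<lambda>y z. boerjeson_insert D D x y z) r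
      + cut_sum (\<lambda>y z. boerjeson_insert D E x y z) r + (if x = [] then E (boerjeson D w) else 0)"
      by (simp add: cut_sum_add cut_sum_Nil_right[of "\<lambda>_. if x = [] then E (boerjeson D w) else 0"])
  qed
  also have "\<dots> = cut_sum (\<lambda>x r. cut_sum (\<lambda>y z. boerjeson_insert D E x y z) r) w + E (boerjeson D w)"
    using boerjeson_relation[OF graded_word_letters[OF w]]
    by (simp add: cut_sum_add cut_sum_Nil_left[of "\<lambda>_. E (boerjeson D w)"])
  also have "cut_sum (\<lambda>x r. cut_sum (\<lambda>y z. boerjeson_insert D E x y z) r) w
    = cut_sum (\<lambda>u v. if v = [] then 0
      else psign (deg u) (boerjeson D (u @ (fst (hd v) + 1, E (snd (hd v))) # tl v))) w"
    by (rule cut_sum_cong) (rule E_insert)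
  finally show ?thesis by (simp add: add.commute)
qed

end

section \<open>Modules of functions and their quotients\<close>

text \<open>Module records whose elements form a subset of a type with addition, such as functions, and whose
  addition is that of the type. Negation and finite sums in the record are then those of the type.\<close>

locale concrete_module =
  fixes M :: "('k::field, 'v::ab_group_add) module"
  assumes add_eq: "add M = (+)" and zero_eq: "zero M = 0"
    and zero_closed: "0 \<in> carrier M"
    and add_closed: "x \<in> carrier M \<Longrightarrow> y \<in> carrier M \<Longrightarrow> x + y \<in> carrier M"
    and minus_closed: "x \<in> carrier M \<Longrightarrow> - x \<in> carrier M"
    and smult_closed: "x \<in> carrier M \<Longrightarrow> c \<odot>\<^bsub>M\<^esub> x \<in> carrier M"
    and smult_add_left: "x \<in> carrier M \<Longrightarrow> (a + b) \<odot>\<^bsub>M\<^esub> x = a \<odot>\<^bsub>M\<^esub> x + b \<odot>\<^bsub>M\<^esub> x"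
    and smult_add_right: "x \<in> carrier M \<Longrightarrow> y \<in> carrier M \<Longrightarrow> a \<odot>\<^bsub>M\<^esub> (x + y) = a \<odot>\<^bsub>M\<^esub> x + a \<odot>\<^bsub>M\<^esub> y"
    and smult_mult: "x \<in> carrier M \<Longrightarrow> (a * b) \<odot>\<^bsub>M\<^esub> x = a \<odot>\<^bsub>M\<^esub> (b \<odot>\<^bsub>M\<^esub> x)"
    and smult_1: "x \<in> carrier M \<Longrightarrow> 1 \<odot>\<^bsub>M\<^esub> x = x"
begin

lemma diff_closed: "x \<in> carrier M \<Longrightarrow> y \<in> carrier M \<Longrightarrow> x - y \<in> carrier M"
  using add_closed[OF _ minus_closed, of x y] by simp

lemma abelian_group: "abelian_group M"
proof (rule abelian_groupI)
  fix x assume "x \<in> carrier M"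
  then show "\<exists>y \<in> carrier M. y \<oplus>\<^bsub>M\<^esub> x = \<zero>\<^bsub>M\<^esub>"
    by (intro bexI[of _ "- x"]) (simp_all add: add_eq zero_eq minus_closed)
qed (simp_all add: add_eq zero_eq zero_closed add_closed ac_simps)

lemma module: "module (ring_of_type_algebra :: 'k ring) M"
  by (rule moduleI[OF cring_from_type_algebra abelian_group])
    (simp_all add: ring_of_type_algebra_def add_eq smult_closed smult_add_left smult_add_right
      smult_mult smult_1)

lemma a_inv_eq: "x \<in> carrier M \<Longrightarrow> \<ominus>\<^bsub>M\<^esub> x = - x"
  by (rule abelian_group.minus_equality[OF abelian_group])
    (simp_all add: add_eq zero_eq minus_closed zero_closed)

lemma signed_eq: "x \<in> carrier M \<Longrightarrow> signed M s x = psign s x"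
  by (simp add: signed_def psign_def a_inv_eq)

lemma finsum_eq:
  assumes "finite A" "\<And>i. i \<in> A \<Longrightarrow> f i \<in> carrier M"
  shows "finsum M f A = sum f A" "sum f A \<in> carrier M"
proof -
  note closed = zero_closed add_closed
  interpret abelian_group M by (rule abelian_group)
  have "finsum M f A = sum f A \<and> sum f A \<in> carrier M"
    using assms
  proof (induction A rule: finite_induct)
    case empty
    then show ?case by (simp add: zero_eq closed)
  next
    case (insert x A)
    then show ?case by (subst finsum_insert) (auto simp: add_eq closed)
  qed
  then show "finsum M f A = sum f A" "sum f A \<in> carrier M" by auto
qed

lemma psign_closed: "x \<in> carrier M \<Longrightarrow> psign s x \<in> carrier M"
  by (simp add: psign_def minus_closed)

end

locale concrete_quotient = concrete_module M
  for M :: "('k::field, 'v::ab_group_add) module" +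
  fixes W :: "'v set"
  assumes W_carrier: "W \<subseteq> carrier M"
    and W_zero: "0 \<in> W"
    and W_add: "x \<in> W \<Longrightarrow> y \<in> W \<Longrightarrow> x + y \<in> W"
    and W_minus: "x \<in> W \<Longrightarrow> - x \<in> W"
    and W_smult: "x \<in> W \<Longrightarrow> c \<odot>\<^bsub>M\<^esub> x \<in> W"
begin

abbreviation "cls x \<equiv> W +>\<^bsub>M\<^esub> x"
abbreviation "Q \<equiv> quotient_module M W"

lemma cls_eq: "cls x = {y. y - x \<in> W}"
proof -
  have "y \<in> cls x \<longleftrightarrow> y - x \<in> W" for y
    by (auto simp: a_r_coset_def' add_eq intro!: bexI[of _ "y - x"])
  then show ?thesis by auto
qed

lemma W_diff: "x \<in> W \<Longrightarrow> y \<in> W \<Longrightarrow> x - y \<in> W"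
  using W_add[OF _ W_minus, of x y] by simp

lemma cls_eq_iff: "cls x = cls y \<longleftrightarrow> x - y \<in> W"
proof
  assume "cls x = cls y"
  moreover have "x \<in> cls x" by (simp add: cls_eq W_zero)
  ultimately show "x - y \<in> W" by (simp add: cls_eq)
next
  assume *: "x - y \<in> W"
  have "z - x \<in> W \<longleftrightarrow> z - y \<in> W" for z
    using W_add[OF _ *, of "z - x"] W_diff[OF _ *, of "z - y"] by auto
  then show "cls x = cls y" by (simp add: cls_eq)
qed

lemma carrier_Q: "carrier Q = cls ` carrier M"
  by (auto simp: quotient_module_def A_RCOSETS_def')

lemma zero_Q: "\<zero>\<^bsub>Q\<^esub> = cls 0"
  by (simp add: quotient_module_def cls_eq)

lemma add_Q: "cls x \<oplus>\<^bsub>Q\<^esub> cls y = cls (x + y)"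
proof -
  have "z \<in> cls x <+>\<^bsub>M\<^esub> cls y \<longleftrightarrow> z \<in> cls (x + y)" for z
  proof
    assume "z \<in> cls x <+>\<^bsub>M\<^esub> cls y"
    then obtain a b where "a - x \<in> W" "b - y \<in> W" "z = a + b"
      by (auto simp: set_add_def' add_eq cls_eq)
    then show "z \<in> cls (x + y)"
      using W_add[of "a - x" "b - y"] by (simp add: cls_eq algebra_simps)
  next
    assume "z \<in> cls (x + y)"
    then have "z - y - x \<in> W" "y - y \<in> W"
      by (simp_all add: cls_eq W_zero algebra_simps)
    moreover have "z = (z - y) + y" by simp
    ultimately show "z \<in> cls x <+>\<^bsub>M\<^esub> cls y"
      unfolding set_add_def' add_eq cls_eq by blast
  qed
  then show ?thesis by (auto simp: quotient_module_def)
qed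

lemma smult_diff: "x \<in> carrier M \<Longrightarrow> y \<in> carrier M \<Longrightarrow> c \<odot>\<^bsub>M\<^esub> (x - y) = c \<odot>\<^bsub>M\<^esub> x - c \<odot>\<^bsub>M\<^esub> y"
  using smult_add_right[of "x - y" y c] by (simp add: diff_closed)

lemma cls_carrier: "x \<in> carrier M \<Longrightarrow> z \<in> cls x \<Longrightarrow> z \<in> carrier M"
  using add_closed[of x "z - x"] W_carrier by (auto simp: cls_eq)

lemma smult_Q:
  assumes "x \<in> carrier M"
  shows "c \<odot>\<^bsub>Q\<^esub> cls x = cls (c \<odot>\<^bsub>M\<^esub> x)"
proof -
  have "cls (c \<odot>\<^bsub>M\<^esub> z) = cls (c \<odot>\<^bsub>M\<^esub> x)" if "z \<in> cls x" for z
  proof -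
    have "z \<in> carrier M" "z - x \<in> W"
      using cls_carrier[OF assms that] that by (simp_all add: cls_eq)
    then show ?thesis
      using assms by (simp add: cls_eq_iff smult_diff[symmetric] W_smult)
  qed
  moreover have "x \<in> cls x" by (simp add: cls_eq W_zero)
  ultimately have "(\<Union>z\<in>cls x. cls (c \<odot>\<^bsub>M\<^esub> z)) = cls (c \<odot>\<^bsub>M\<^esub> x)"
    by blast
  then show ?thesis by (simp add: quotient_module_def)
qed

lemma abelian_group_Q: "abelian_group Q"
proof (rule abelian_groupI)
  fix x assume "x \<in> carrier Q"
  then obtain a where a: "a \<in> carrier M" "x = cls a" by (auto simp: carrier_Q)
  show "\<exists>y \<in> carrier Q. y \<oplus>\<^bsub>Q\<^esub> x = \<zero>\<^bsub>Q\<^esub>"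
    by (rule bexI[of _ "cls (- a)"]) (auto simp: carrier_Q a add_Q zero_Q minus_closed)
qed (auto simp: carrier_Q add_Q zero_Q add_closed zero_closed ac_simps)

lemma module_Q: "module (ring_of_type_algebra :: 'k ring) Q"
  by (rule moduleI[OF cring_from_type_algebra abelian_group_Q])
    (auto simp: ring_of_type_algebra_def carrier_Q add_Q smult_Q smult_closed add_closed
      smult_add_left smult_add_right smult_mult smult_1)

lemma signed_Q: "x \<in> carrier M \<Longrightarrow> signed Q s (cls x) = cls (psign s x)"
  using abelian_group.minus_equality[OF abelian_group_Q, of "cls (- x)" "cls x"]
  by (simp add: signed_def psign_def add_Q zero_Q carrier_Q minus_closed)

lemma finsum_Q:
  assumes "finite A" "\<And>i. i \<in> A \<Longrightarrow> f i \<in> carrier M"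
  shows "finsum Q (\<lambda>i. cls (f i)) A = cls (sum f A)"
proof -
  interpret abelian_group Q by (rule abelian_group_Q)
  show ?thesis using assms
  proof (induction A rule: finite_induct)
    case empty
    then show ?case by (simp add: zero_Q)
  next
    case (insert x A)
    then show ?case by (subst finsum_insert) (auto simp: add_Q carrier_Q)
  qed
qed

end

section \<open>The Hochschild complex and its cup product\<close>

text \<open>Linearity in every letter of a word, for words of all lengths at once. Together with the support
  condition this describes the cochains, but it is also preserved by operators that change the length.\<close>

definition multilinear :: "('k::field \<Rightarrow> 'a::ring \<Rightarrow> 'a) \<Rightarrow> ('k \<Rightarrow> 'b::ab_group_add \<Rightarrow> 'b) \<Rightarrow> ('a list \<Rightarrow> 'b) \<Rightarrow> bool" where
  "multilinear s1 s2 F \<longleftrightarrow>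
    (\<forall>u v x y. F (u @ (x + y) # v) = F (u @ x # v) + F (u @ y # v)) \<and>
    (\<forall>u v x c. F (u @ s1 c x # v) = s2 c (F (u @ x # v)))"

lemma multilinear_add: "multilinear s1 s2 F \<Longrightarrow> F (u @ (x + y) # v) = F (u @ x # v) + F (u @ y # v)"
  and multilinear_scale: "multilinear s1 s2 F \<Longrightarrow> F (u @ s1 c x # v) = s2 c (F (u @ x # v))"
  by (auto simp: multilinear_def)

lemma multilinear_0: "multilinear s1 s2 F \<Longrightarrow> F (u @ 0 # v) = 0"
  using multilinear_add[of s1 s2 F u 0 0 v] by simp

lemma multilinear_minus: "multilinear s1 s2 F \<Longrightarrow> F (u @ (- x) # v) = - F (u @ x # v)"
  using multilinear_add[of s1 s2 F u x "- x" v] multilinear_0[of s1 s2 F u v]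
  by (simp add: eq_neg_iff_add_eq_0 add.commute)

lemma multilinear_psign: "multilinear s1 s2 F \<Longrightarrow> F (u @ psign s x # v) = psign s (F (u @ x # v))"
  by (simp add: psign_def multilinear_minus)

lemma multilinear_prefix: "multilinear s1 s2 F \<Longrightarrow> multilinear s1 s2 (\<lambda>w. F (u @ w))"
  unfolding multilinear_def append_assoc[symmetric] by blast

lemma multilinear_suffix: "multilinear s1 s2 F \<Longrightarrow> multilinear s1 s2 (\<lambda>w. F (w @ u))"
  unfolding multilinear_def by simp

text \<open>The usual formula \<open>f(a\<^sub>1, \<dots>, a\<^sub>p) g(a\<^sub>p\<^sub>+\<^sub>1, \<dots>)\<close>; for cochains of fixed degrees only one cut contributes.\<close>

definition cup_product :: "'a::ring cochain \<Rightarrow> 'a cochain \<Rightarrow> 'a cochain" where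
  "cup_product f g = cut_sum (\<lambda>u v. f u * g v)"

definition cochain_scale :: "('k \<Rightarrow> 'a \<Rightarrow> 'a) \<Rightarrow> 'k \<Rightarrow> 'a cochain \<Rightarrow> 'a cochain" where
  "cochain_scale scale c f = (\<lambda>w. scale c (f w))"

locale scalar_algebra = vector_space scale
  for scale :: "'k::field \<Rightarrow> 'a::ring \<Rightarrow> 'a" +
  assumes scale_mult_l: "scale r a * b = scale r (a * b)"
    and scale_mult_r: "a * scale r b = scale r (a * b)"
begin

abbreviation "mlin \<equiv> multilinear scale scale"

lemma scale_psign: "psign s (scale c x) = scale c (psign s x)"
  by (simp add: psign_def)

lemma cochains_iff: "f \<in> cochains scale p \<longleftrightarrow> (\<forall>w. int (length w) \<noteq> p \<longrightarrow> f w = 0) \<and> mlin f"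
proof -
  have *: "(\<forall>w. \<forall>i < length w. Vector_Spaces.linear scale scale (\<lambda>a. f (w[i := a])))
    \<longleftrightarrow> (\<forall>u x v. Vector_Spaces.linear scale scale (\<lambda>a. f (u @ a # v)))" (is "?L \<longleftrightarrow> ?R")
  proof
    assume L: ?L
    show ?R
    proof (intro allI)
      fix u v x
      show "Vector_Spaces.linear scale scale (\<lambda>a. f (u @ a # v))"
        using L[rule_format, of "length u" "u @ 0 # v"] by simp
    qed
  next
    assume R: ?R
    show ?L
    proof (intro allI impI)
      fix w :: "'a list" and i assume "i < length w"
      then show "Vector_Spaces.linear scale scale (\<lambda>a. f (w[i := a]))"
        using R by (simp add: upd_conv_take_nth_drop)
    qed
  qed
  have **: "(\<forall>u x v. Vector_Spaces.linear scale scale (\<lambda>a. f (u @ a # v))) \<longleftrightarrow> mlin f"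
    by (auto simp: multilinear_def Vector_Spaces.linear_iff vector_space_axioms)
  show ?thesis using * ** by (simp add: cochains_def)
qed

lemma cochain_mlin: "f \<in> cochains scale p \<Longrightarrow> mlin f"
  and cochain_support: "f \<in> cochains scale p \<Longrightarrow> int (length w) \<noteq> p \<Longrightarrow> f w = 0"
  by (auto simp: cochains_iff)

lemma mlin_cut_sum:
  assumes "\<And>v. multilinear scale s (\<lambda>u. \<psi> u v)" "\<And>u. multilinear scale s (\<psi> u)" "vector_space s"
  shows "multilinear scale s (cut_sum \<psi>)"
proof -
  interpret s: vector_space s by fact
  have s: "s c (cut_sum \<phi> w) = cut_sum (\<lambda>u v. s c (\<phi> u v)) w" for c w \<phi>
    by (rule cut_sum_map) (simp_all add: s.scale_right_distrib)
  show ?thesis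
    unfolding multilinear_def
  proof (intro conjI allI)
    fix u v x y
    have "cut_sum (\<lambda>a b. \<psi> (u @ (x + y) # a) b) v = cut_sum (\<lambda>a b. \<psi> (u @ x # a) b + \<psi> (u @ y # a) b) v"
      by (rule cut_sum_cong) (rule multilinear_add[OF assms(1)])
    moreover have "cut_sum (\<lambda>a b. \<psi> a (b @ (x + y) # v)) u = cut_sum (\<lambda>a b. \<psi> a (b @ x # v) + \<psi> a (b @ y # v)) u"
      by (rule cut_sum_cong) (rule multilinear_add[OF assms(2)])
    ultimately show "cut_sum \<psi> (u @ (x + y) # v) = cut_sum \<psi> (u @ x # v) + cut_sum \<psi> (u @ y # v)"
      unfolding cut_sum_append_Cons cut_sum_add by simp
  next
    fix u v x c
    have "cut_sum (\<lambda>a b. \<psi> (u @ scale c x # a) b) v = cut_sum (\<lambda>a b. s c (\<psi> (u @ x # a) b)) v"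
      by (rule cut_sum_cong) (rule multilinear_scale[OF assms(1)])
    moreover have "cut_sum (\<lambda>a b. \<psi> a (b @ scale c x # v)) u = cut_sum (\<lambda>a b. s c (\<psi> a (b @ x # v))) u"
      by (rule cut_sum_cong) (rule multilinear_scale[OF assms(2)])
    ultimately show "cut_sum \<psi> (u @ scale c x # v) = s c (cut_sum \<psi> (u @ x # v))"
      unfolding cut_sum_append_Cons s.scale_right_distrib s by simp
  qed
qed

lemma mlin_merge_sum:
  assumes "multilinear scale s \<phi>" "vector_space s"
  shows "multilinear scale s (merge_sum \<phi>)"
proof -
  interpret s: vector_space s by fact
  have s: "merge_sum (\<lambda>z. s c (\<phi> z)) w = s c (merge_sum \<phi> w)" for c w \<phi>
    by (rule merge_sum_map) (simp_all add: s.scale_right_distrib)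
  have sp: "psign k (s c x) = s c (psign k x)" for k c x
    by (simp add: psign_def)
  note [simp] = multilinear_add[OF assms(1)] multilinear_scale[OF assms(1)]
    multilinear_add[OF assms(1), of "u # us" for u us, simplified]
    multilinear_scale[OF assms(1), of "u # us" for u us, simplified]
    multilinear_add[OF assms(1), of "[]", simplified]
    multilinear_scale[OF assms(1), of "[]", simplified]
  have tail: "merge_sum (\<lambda>z. \<phi> (u @ z)) (x # v) =
      (if v = [] then 0 else - \<phi> (u @ (x * hd v) # tl v) - merge_sum (\<lambda>z. \<phi> (u @ x # z)) v)" for u x v
    by (cases v) simp_all
  have J: "junction \<phi> u (x # v) = (if u = [] then 0 else \<phi> (butlast u @ (last u * x) # v))" for u x v
    by (simp add: junction_def)
  show ?thesis
    unfolding multilinear_def merge_sum_append tail J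
    by (simp add: merge_sum_add s s.scale_right_distrib s.scale_right_diff_distrib sp distrib_left distrib_right
        scale_mult_l scale_mult_r psign_add psign_diff psign_minus minus_psign add.commute)
qed

lemma mlin_left:
  assumes f: "mlin f"
  shows "mlin (\<lambda>w. if w = [] then 0 else hd w * f (tl w))"
  unfolding multilinear_def
proof (intro conjI allI)
  fix u v x y
  show "(if u @ (x + y) # v = [] then 0 else hd (u @ (x + y) # v) * f (tl (u @ (x + y) # v))) =
    (if u @ x # v = [] then 0 else hd (u @ x # v) * f (tl (u @ x # v)))
    + (if u @ y # v = [] then 0 else hd (u @ y # v) * f (tl (u @ y # v)))"
    by (cases u) (simp_all add: multilinear_add[OF f] algebra_simps)
next
  fix u v x c
  show "(if u @ scale c x # v = [] then 0 else hd (u @ scale c x # v) * f (tl (u @ scale c x # v))) =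
    scale c (if u @ x # v = [] then 0 else hd (u @ x # v) * f (tl (u @ x # v)))"
    by (cases u) (simp_all add: multilinear_scale[OF f] scale_mult_l scale_mult_r)
qed

lemma mlin_right:
  assumes f: "mlin f"
  shows "mlin (\<lambda>w. if w = [] then 0 else psign (int (length w)) (f (butlast w) * last w))"
  unfolding multilinear_def
proof (intro conjI allI)
  fix u v x y
  show "(if u @ (x + y) # v = [] then 0 else psign (int (length (u @ (x + y) # v))) (f (butlast (u @ (x + y) # v)) * last (u @ (x + y) # v))) =
    (if u @ x # v = [] then 0 else psign (int (length (u @ x # v))) (f (butlast (u @ x # v)) * last (u @ x # v)))
    + (if u @ y # v = [] then 0 else psign (int (length (u @ y # v))) (f (butlast (u @ y # v)) * last (u @ y # v)))"
    by (cases v rule: rev_cases) (simp_all add: butlast_append multilinear_add[OF f] algebra_simps psign_add)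
next
  fix u v x c
  show "(if u @ scale c x # v = [] then 0 else psign (int (length (u @ scale c x # v))) (f (butlast (u @ scale c x # v)) * last (u @ scale c x # v))) =
    scale c (if u @ x # v = [] then 0 else psign (int (length (u @ x # v))) (f (butlast (u @ x # v)) * last (u @ x # v)))"
    by (cases v rule: rev_cases) (simp_all add: butlast_append multilinear_scale[OF f] scale_psign scale_mult_l scale_mult_r)
qed

end

text \<open>The Hochschild differential is the sum of \<open>merge_sum\<close> and of the two terms that multiply the value with an
  outer letter.\<close>

definition left_part :: "'a::ring cochain \<Rightarrow> 'a cochain" where
  "left_part f w = (if w = [] then 0 else hd w * f (tl w))"

definition right_part :: "'a::ring cochain \<Rightarrow> 'a cochain" where
  "right_part f w = (if w = [] then 0 else psign (int (length w)) (f (butlast w) * last w))"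

lemma hochschild_parts: "hochschild f w = left_part f w + merge_sum f w + right_part f w"
  by (simp add: hochschild_merge left_part_def right_part_def)

lemma hochschild_add: "hochschild (f + g) = hochschild f + hochschild g"
  by (rule ext) (simp add: hochschild_merge merge_sum_add plus_fun_def algebra_simps psign_add)

text \<open>Splitting both differentials into their three parts, \<open>merge_sum\<close> applied twice vanishes, and the
  mixed terms cancel by associativity: those with the first letter (\<open>LM\<close>), those with the last letter (\<open>RM\<close>), and
  those with both (\<open>LR\<close>).\<close>

lemma hochschild_hochschild: "hochschild (hochschild f) = 0"
proof
  fix w
  have LM: "left_part (left_part f) w + merge_sum (left_part f) w + left_part (merge_sum f) w = 0"
  proof (cases w rule: remdups_adj.cases)
    case (3 x y v)
    have "merge_sum (\<lambda>z. left_part f (x # z)) (y # v) = x * merge_sum f (y # v)"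
      unfolding left_part_def by (simp, rule merge_sum_map) (simp_all add: distrib_left)
    then show ?thesis by (simp add: 3 left_part_def mult.assoc)
  qed (simp_all add: left_part_def)
  have RM: "right_part (right_part f) w + merge_sum (right_part f) w + right_part (merge_sum f) w = 0"
  proof (cases w rule: rev_cases)
    case (snoc v x)
    show ?thesis
    proof (cases v rule: rev_cases)
      case v: (snoc u y)
      have "merge_sum (right_part f) (u @ [y, x]) = merge_sum (\<lambda>z. psign (int (length (u @ [y, x]) - 1)) (f (butlast z) * last z)) (u @ [y, x])"
        by (rule merge_sum_cong) (auto simp: right_part_def)
      also have "\<dots> = psign (1 + int (length u)) (merge_sum (\<lambda>z. f (butlast z) * last z) ((u @ [y]) @ [x]))"
        by (simp add: merge_sum_psign)
      also have "merge_sum (\<lambda>z. f (butlast z) * last z) ((u @ [y]) @ [x])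
         = merge_sum f (u @ [y]) * x + psign (int (length u) + 1) (f u * (y * x))"
        unfolding merge_sum_append[of _ "u @ [y]"]
        by (simp add: butlast_append junction_def add.commute)
          (rule merge_sum_map, simp_all add: distrib_right)
      finally have "merge_sum (right_part f) w = psign (1 + int (length u)) (merge_sum f (u @ [y]) * x)
          + f u * (y * x)"
        by (simp add: snoc v psign_add) (simp add: psign_def)
      moreover have "right_part (right_part f) w = - (f u * (y * x))"
        by (simp add: right_part_def snoc v butlast_append mult.assoc psign_mult_left) (simp add: psign_def)
      moreover have "right_part (merge_sum f) w = - psign (1 + int (length u)) (merge_sum f (u @ [y]) * x)"
        by (simp add: right_part_def snoc v butlast_append) (simp add: psign_def)
      ultimately show ?thesis by simp
    qed (simp add: snoc right_part_def)
  qed (simp add: right_part_def)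
  have LR: "left_part (right_part f) w + right_part (left_part f) w = 0"
  proof (cases w rule: remdups_adj.cases)
    case (3 x y v)
    then show ?thesis
      by (simp add: left_part_def right_part_def psign_mult_right mult.assoc) (simp add: psign_def)
  qed (simp_all add: left_part_def right_part_def)
  have L: "left_part (hochschild f) w = left_part (left_part f) w + left_part (merge_sum f) w + left_part (right_part f) w"
    by (simp add: left_part_def hochschild_parts[of f] distrib_left)
  have R: "right_part (hochschild f) w = right_part (left_part f) w + right_part (merge_sum f) w + right_part (right_part f) w"
    by (simp add: right_part_def hochschild_parts[of f] distrib_right psign_add)
  have M: "merge_sum (hochschild f) w = merge_sum (left_part f) w + merge_sum (right_part f) w"
    unfolding hochschild_parts[of f, abs_def] merge_sum_add by (simp add: merge_sum_merge_sum)
  have "hochschild (hochschild f) w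
     = (left_part (left_part f) w + merge_sum (left_part f) w + left_part (merge_sum f) w)
     + (right_part (right_part f) w + merge_sum (right_part f) w + right_part (merge_sum f) w)
     + (left_part (right_part f) w + right_part (left_part f) w)"
    by (simp add: hochschild_parts[of "hochschild f"] L R M)
  then show "hochschild (hochschild f) w = 0 w"
    by (simp add: LM RM LR)
qed

text \<open>The term of \<open>\<delta> f\<close> that multiplies with the last letter cancels the term of \<open>\<delta> g\<close> that multiplies with the first letter, after moving
  this letter across the cut. The sign is written with the length of \<open>u\<close>, which is the degree of \<open>f\<close> wherever \<open>f u\<close> does
  not vanish.\<close>

lemma hochschild_cup:
  "hochschild (cup_product f g) = cup_product (hochschild f) g
     + cut_sum (\<lambda>u v. psign (int (length u)) (f u * hochschild g v))"
proof
  fix w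
  have L: "left_part (cup_product f g) w = cut_sum (\<lambda>u v. left_part f u * g v) w"
    by (cases w) (simp_all add: left_part_def cup_product_def cut_sum_Cons cut_sum_mult_right mult.assoc)
  have R: "right_part (cup_product f g) w = cut_sum (\<lambda>u v. psign (int (length u)) (f u * right_part g v)) w"
  proof (cases w rule: rev_cases)
    case (snoc w' x)
    have "cut_sum (\<lambda>u v. psign (int (length u)) (f u * right_part g v)) (w' @ [x])
      = cut_sum (\<lambda>u v. psign (int (length u)) (f u * right_part g (v @ [x]))) w'"
      unfolding cut_sum_append_Cons by (simp add: right_part_def)
    also have "\<dots> = cut_sum (\<lambda>u v. psign (int (length w) + 0) (f u * g v * x)) w'"
      by (rule cut_sum_cong)
        (auto simp: right_part_def snoc psign_mult_right mult.assoc intro!: psign_cong)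
    finally show ?thesis
      by (simp add: snoc right_part_def cup_product_def cut_sum_mult_left cut_sum_psign)
  qed (simp add: right_part_def)
  have shift: "cut_sum (\<lambda>u v. right_part f u * g v) w
      + cut_sum (\<lambda>u v. psign (int (length u)) (f u * left_part g v)) w = 0"
  proof -
    define h where "h u x v = psign (int (length u) + 1) (f u * (x * g v))" for u x v
    have "cut_sum (\<lambda>u v. right_part f u * g v) w
        = cut_sum (\<lambda>u v. if u = [] then 0 else h (butlast u) (last u) v) w"
    proof (rule cut_sum_cong)
      fix u v
      show "right_part f u * g v = (if u = [] then 0 else h (butlast u) (last u) v)"
        by (cases u rule: rev_cases)
          (simp_all add: right_part_def h_def psign_mult_left mult.assoc add.commute)
    qed
    also have "\<dots> = cut_sum (\<lambda>u v. - psign (int (length u)) (f u * left_part g v)) w"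
      unfolding cut_sum_shift by (rule cut_sum_cong) (simp add: left_part_def h_def minus_psign)
    finally show ?thesis by (simp add: cut_sum_minus)
  qed
  have M: "merge_sum (cup_product f g) w = cut_sum (\<lambda>u v. merge_sum f u * g v) w
      + cut_sum (\<lambda>u v. psign (int (length u)) (f u * merge_sum g v)) w"
  proof -
    have *: "merge_sum (\<lambda>a. f a * x) u = merge_sum f u * x" "merge_sum (\<lambda>a. x * g a) u = x * merge_sum g u" for x u
      by (rule merge_sum_map, simp_all add: distrib_left distrib_right)+
    show ?thesis
      unfolding cup_product_def merge_sum_cut cut_sum_add[symmetric] * ..
  qed
  show "hochschild (cup_product f g) w = (cup_product (hochschild f) g
     + cut_sum (\<lambda>u v. psign (int (length u)) (f u * hochschild g v))) w"
    using shift
    by (simp add: hochschild_parts L R M cup_product_def[of "hochschild f"] plus_fun_def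
        hochschild_parts[of f] hochschild_parts[of g] distrib_left distrib_right cut_sum_add psign_add)
qed

text \<open>The cochain of degree \<open>0\<close> that is the unit of the cup product.\<close>

definition unit_cochain :: "'a::zero \<Rightarrow> 'a cochain" where
  "unit_cochain unit w = (if w = [] then unit else 0)"

lemma homogeneous_iff: "homogeneous V ps xs \<longleftrightarrow>
    length ps = length xs \<and> (\<forall>i < length ps. xs ! i \<in> carrier (V (ps ! i)))"
  by (auto simp: homogeneous_def list_all2_conv_all_nth)

lemma homogeneous_update:
  "homogeneous V ps xs \<Longrightarrow> y \<in> carrier (V q) \<Longrightarrow> homogeneous V (ps[i := q]) (xs[i := y])"
  by (auto simp: homogeneous_iff) (metis nth_list_update_eq nth_list_update_neq)

lemma homogeneous_update_same:
  "homogeneous V ps xs \<Longrightarrow> y \<in> carrier (V (ps ! i)) \<Longrightarrow> homogeneous V ps (xs[i := y])"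
  by (auto simp: homogeneous_iff) (metis nth_list_update_eq nth_list_update_neq)

lemma homogeneous_take: "homogeneous V ps xs \<Longrightarrow> homogeneous V (take k ps) (take k xs)"
  and homogeneous_drop: "homogeneous V ps xs \<Longrightarrow> homogeneous V (drop k ps) (drop k xs)"
  by (auto simp: homogeneous_def)

lemma homogeneous_append:
  "homogeneous V ps xs \<Longrightarrow> homogeneous V qs ys \<Longrightarrow> homogeneous V (ps @ qs) (xs @ ys)"
  by (auto simp: homogeneous_def list_all2_appendI)

lemma homogeneous_Cons [simp]:
  "homogeneous V (p # ps) (x # xs) \<longleftrightarrow> x \<in> carrier (V p) \<and> homogeneous V ps xs"
  by (auto simp: homogeneous_def)

lemma sum_list_insert:
  "sum_list (take i ps @ [sum_list (take k (drop i ps)) - 1] @ drop (i + k) ps) = sum_list ps - (1::int)"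
proof -
  have "sum_list ps = sum_list (take i ps) + (sum_list (take k (drop i ps)) + sum_list (drop k (drop i ps)))"
    by (metis append_take_drop_id sum_list_append)
  then show ?thesis by (simp add: add.commute)
qed

lemma finite_insertions: "finite {(i, k). 1 \<le> k \<and> i + k \<le> (n :: nat)}"
  by (rule finite_subset[of _ "{..n} \<times> {..n}"]) auto

context scalar_algebra
begin

lemma carrier_cochain_space [simp]: "carrier (cochain_space scale p) = cochains scale p"
  and add_cochain_space [simp]: "add (cochain_space scale p) = (+)"
  and zero_cochain_space [simp]: "zero (cochain_space scale p) = 0"
  and smult_cochain_space [simp]: "module.smult (cochain_space scale p) = cochain_scale scale"
  by (auto simp: cochain_space_def cochain_scale_def fun_eq_iff)

lemma carrier_cocycle_space [simp]:
    "carrier (cocycle_space scale p) = {f \<in> cochains scale p. hochschild f = 0}"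
  and add_cocycle_space [simp]: "add (cocycle_space scale p) = (+)"
  and zero_cocycle_space [simp]: "zero (cocycle_space scale p) = 0"
  and smult_cocycle_space [simp]: "module.smult (cocycle_space scale p) = cochain_scale scale"
  by (auto simp: cocycle_space_def cochain_scale_def cochain_space_def fun_eq_iff)

lemma mlin_zero: "mlin 0"
  by (simp add: multilinear_def)

lemma mlin_plus: "mlin f \<Longrightarrow> mlin g \<Longrightarrow> mlin (f + g)"
  by (simp add: multilinear_def algebra_simps)

lemma mlin_uminus: "mlin f \<Longrightarrow> mlin (- f)"
  by (simp add: multilinear_def)

lemma mlin_cochain_scale: "mlin f \<Longrightarrow> mlin (cochain_scale scale c f)"
  by (simp add: multilinear_def cochain_scale_def scale_right_distrib scale_left_commute)

lemma hochschild_scale: "hochschild (cochain_scale scale c f) = cochain_scale scale c (hochschild f)"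
proof -
  have "merge_sum (\<lambda>z. scale c (f z)) w = scale c (merge_sum f w)" for w
    by (rule merge_sum_map) (simp_all add: scale_right_distrib)
  then show ?thesis
    by (auto simp: cochain_scale_def hochschild_merge scale_right_distrib scale_mult_l scale_mult_r scale_psign)
qed

lemma hochschild_mlin:
  assumes "mlin f"
  shows "mlin (hochschild f)"
proof -
  have "hochschild f = (\<lambda>w. if w = [] then 0 else hd w * f (tl w)) + merge_sum f
      + (\<lambda>w. if w = [] then 0 else psign (int (length w)) (f (butlast w) * last w))"
    by (auto simp: hochschild_merge)
  then show ?thesis
    using assms by (simp add: mlin_plus mlin_left mlin_right mlin_merge_sum vector_space_axioms)
qed

lemma hochschild_cochains:
  assumes f: "f \<in> cochains scale p"
  shows "hochschild f \<in> cochains scale (p + 1)"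
proof -
  have "hochschild f w = 0" if "int (length w) \<noteq> p + 1" for w
  proof (cases "w = []")
    case False
    then have "int (length w - 1) \<noteq> p" using that by (cases w) auto
    then have *: "f z = 0" if "length z = length w - 1" for z
      using that cochain_support[OF f] by auto
    then have "merge_sum f w = 0"
      by (intro merge_sum_0) auto
    then show ?thesis using * by (simp add: hochschild_merge)
  qed (simp add: hochschild_merge)
  then show ?thesis
    using f by (simp add: cochains_iff hochschild_mlin)
qed

lemma hochschild_0 [simp]: "hochschild 0 = 0"
  using hochschild_add[of 0 0] by simp

lemma hochschild_minus: "hochschild (- f) = - hochschild f"
  using hochschild_add[of "- f" f] by (simp add: eq_neg_iff_add_eq_0)

lemma hochschild_psign: "hochschild (psign s f) = psign s (hochschild f)"
  by (simp add: psign_def hochschild_minus)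

sublocale cochain: concrete_module "cochain_space scale p" for p
  by unfold_locales
    (auto simp: cochains_iff mlin_zero mlin_plus mlin_uminus mlin_cochain_scale,
     auto simp: cochain_scale_def scale_left_distrib scale_right_distrib)

sublocale cocycle: concrete_module "cocycle_space scale p" for p
  by unfold_locales
    (use cochain.zero_closed[of p] cochain.add_closed[of _ p] cochain.minus_closed[of _ p]
      cochain.smult_closed[of _ p] in
      \<open>auto simp: hochschild_add hochschild_minus hochschild_scale\<close>,
     auto simp: cochain_scale_def scale_left_distrib scale_right_distrib)

sublocale HH: concrete_quotient "cocycle_space scale p" "coboundaries scale p" for p
proof unfold_locales
  show "coboundaries scale p \<subseteq> carrier (cocycle_space scale p)"
    using hochschild_cochains[of _ "p - 1"] by (auto simp: coboundaries_def hochschild_hochschild)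
  show "0 \<in> coboundaries scale p"
    unfolding coboundaries_def using cochain.zero_closed[of "p - 1"] by (auto intro!: image_eqI[of _ _ 0])
  fix x assume x: "x \<in> coboundaries scale p"
  then obtain f where f: "f \<in> cochains scale (p - 1)" "x = hochschild f"
    by (auto simp: coboundaries_def)
  show "- x \<in> coboundaries scale p"
    using f cochain.minus_closed[of f "p - 1"] by (auto simp: coboundaries_def hochschild_minus[symmetric])
  show "c \<odot>\<^bsub>cocycle_space scale p\<^esub> x \<in> coboundaries scale p" for c
    using f cochain.smult_closed[of f "p - 1" c] by (auto simp: coboundaries_def hochschild_scale[symmetric])
  fix y assume "y \<in> coboundaries scale p"
  then show "x + y \<in> coboundaries scale p"
    using f cochain.add_closed[of f "p - 1"] by (auto simp: coboundaries_def hochschild_add[symmetric])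
qed

lemma insertions_finsum:
  assumes "\<And>i k. 1 \<le> k \<Longrightarrow> i + k \<le> length ps \<Longrightarrow> insert_op \<mu> i k ps fs \<in> cochains scale d"
  shows "finsum (cochain_space scale d) (\<lambda>(i, k). signed (cochain_space scale d) (- sum_list (take i ps))
        (insert_op \<mu> i k ps fs)) {(i, k). 1 \<le> k \<and> i + k \<le> length ps}
    = (\<Sum>(i, k) \<in> {(i, k). 1 \<le> k \<and> i + k \<le> length ps}.
        psign (- sum_list (take i ps)) (insert_op \<mu> i k ps fs))" (is "finsum _ ?f ?I = ?r")
proof -
  have *: "signed (cochain_space scale d) r (insert_op \<mu> i k ps fs) = psign r (insert_op \<mu> i k ps fs)"
    "psign r (insert_op \<mu> i k ps fs) \<in> carrier (cochain_space scale d)"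
    if "1 \<le> k" "i + k \<le> length ps" for i k r
    using assms[OF that] cochain.signed_eq[of "insert_op \<mu> i k ps fs" d r]
      cochain.psign_closed[of "insert_op \<mu> i k ps fs" d r] by simp_all
  have "finsum (cochain_space scale d) ?f ?I = sum ?f ?I"
    by (rule cochain.finsum_eq[OF finite_insertions]) (auto simp: * simp del: carrier_cochain_space)
  also have "\<dots> = ?r"
    by (rule sum.cong) (auto simp: *)
  finally show ?thesis .
qed

lemma cup_mlin: "mlin f \<Longrightarrow> mlin g \<Longrightarrow> mlin (cup_product f g)"
  unfolding cup_product_def
  by (rule mlin_cut_sum)
    (simp_all add: multilinear_def distrib_left distrib_right scale_mult_l scale_mult_r vector_space_axioms)

lemma cup_cochains:
  assumes f: "f \<in> cochains scale p" and g: "g \<in> cochains scale q"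
  shows "cup_product f g \<in> cochains scale (p + q)"
proof -
  have "cup_product f g w = 0" if "int (length w) \<noteq> p + q" for w
    unfolding cup_product_def
  proof (rule cut_sum_0)
    fix u v assume "u @ v = w"
    then have "int (length u) \<noteq> p \<or> int (length v) \<noteq> q" using that by auto
    then show "f u * g v = 0"
      using cochain_support[OF f] cochain_support[OF g] by auto
  qed
  then show ?thesis
    using f g by (simp add: cochains_iff cup_mlin)
qed

lemma hochschild_cup_cochain:
  assumes "f \<in> cochains scale p"
  shows "hochschild (cup_product f g) = cup_product (hochschild f) g + psign p (cup_product f (hochschild g))"
proof -
  have *: "cut_sum (\<lambda>u v. psign (int (length u)) (f u * hochschild g v)) w
      = cut_sum (\<lambda>u v. psign p (f u * hochschild g v)) w" for w
  proof (rule cut_sum_cong)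
    fix u v
    show "psign (int (length u)) (f u * hochschild g v) = psign p (f u * hochschild g v)"
      using cochain_support[OF assms, of u] by (cases "int (length u) = p") auto
  qed
  show ?thesis
    unfolding hochschild_cup
    by (rule ext) (simp add: * psign_apply cup_product_def[of f "hochschild g"] cut_sum_psign)
qed

lemma graded_product:
  assumes unit: "\<And>a. unit * a = a" "\<And>a. a * unit = a"
  shows "graded_product (cochains scale) (Collect mlin) cup_product (unit_cochain unit)"
proof
  show "unit_cochain unit \<in> cochains scale 0"
    by (auto simp: cochains_iff unit_cochain_def multilinear_def)
  show "cup_product (cup_product f g) h = cup_product f (cup_product g h)" for f g h :: "'a cochain"
    by (rule ext) (simp add: cup_product_def cut_sum_mult_left cut_sum_mult_right cut_sum_assoc mult.assoc)
  have "cup_product (unit_cochain unit) f w = cut_sum (\<lambda>u v. if u = [] then f v else 0) w" for f w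
    unfolding cup_product_def by (rule cut_sum_cong) (simp add: unit_cochain_def unit)
  then show "cup_product (unit_cochain unit) f = f" for f
    by (auto simp: cut_sum_Nil_left)
  have "cup_product f (unit_cochain unit) w = cut_sum (\<lambda>u v. if v = [] then f u else 0) w" for f w
    unfolding cup_product_def by (rule cut_sum_cong) (simp add: unit_cochain_def unit)
  then show "cup_product f (unit_cochain unit) = f" for f
    by (auto simp: cut_sum_Nil_right)
  show "cup_product (f + g) h = cup_product f h + cup_product g h"
    and "cup_product h (f + g) = cup_product h f + cup_product h g" for f g h :: "'a cochain"
    by (rule ext, simp add: cup_product_def distrib_left distrib_right cut_sum_add)+
qed (use cochain.zero_closed cochain.add_closed cochain.minus_closed cochain_mlin in
    \<open>auto simp: mlin_plus mlin_uminus cup_mlin cup_cochains\<close>)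

section \<open>Operations compatible with the Hochschild differential descend to cohomology\<close>

abbreviation "cls \<equiv> HH_class scale"
abbreviation "cocycles p \<equiv> carrier (cocycle_space scale p)"

lemma HH_class_eq_iff: "cls p f = cls p g \<longleftrightarrow> f - g \<in> coboundaries scale p"
  unfolding HH_class_def by (rule HH.cls_eq_iff)

lemma carrier_HH: "carrier (HH scale p) = cls p ` cocycles p"
  unfolding HH_def HH_class_def by (rule HH.carrier_Q)

lemma mem_HH_class: "g \<in> cls p f \<longleftrightarrow> g - f \<in> coboundaries scale p"
  unfolding HH_class_def by (simp add: HH.cls_eq)

lemma signed_HH_class: "f \<in> cocycles p \<Longrightarrow> signed (HH scale p) s (cls p f) = cls p (psign s f)"
  unfolding HH_def HH_class_def by (rule HH.signed_Q)

lemma coboundaries_psign: "x \<in> coboundaries scale p \<Longrightarrow> psign s x \<in> coboundaries scale p"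
  by (simp add: psign_def HH.W_minus)

end

locale compatible_operations = scalar_algebra scale
  for scale :: "'k::field \<Rightarrow> 'a::ring \<Rightarrow> 'a" +
  fixes \<mu> :: "'a cochain graded_ops"
  assumes A_inf: "A_infinity_structure (cochain_space scale) \<mu>"
    and compat: "compatible_with_hochschild scale \<mu>"
begin

abbreviation "hom_chain \<equiv> homogeneous (cochain_space scale)"
abbreviation "hom_cycle \<equiv> homogeneous (cocycle_space scale)"

lemma hom_cycle_chain: "hom_cycle ps fs \<Longrightarrow> hom_chain ps fs"
  by (auto simp: homogeneous_iff)

lemma op_closed:
  "ps \<noteq> [] \<Longrightarrow> hom_chain ps fs \<Longrightarrow> \<mu> ps fs \<in> cochains scale (sum_list ps - 1)"
  using A_inf by (simp add: A_infinity_structure_def degree_minus_one_ops_def)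

lemma op_slot:
  assumes "hom_chain ps fs" "i < length ps" "g \<in> cochains scale (ps ! i)"
  shows "\<mu> ps (fs[i := fs ! i + g]) = \<mu> ps fs + \<mu> ps (fs[i := g]) \<and>
    \<mu> ps (fs[i := cochain_scale scale c (fs ! i)]) = cochain_scale scale c (\<mu> ps fs)"
proof -
  have "degree_minus_one_ops (cochain_space scale) \<mu>"
    using A_inf by (simp add: A_infinity_structure_def)
  moreover have "ps \<noteq> [] \<and> hom_chain ps fs"
    using assms by auto
  ultimately have "\<forall>i < length ps. \<forall>g \<in> carrier (cochain_space scale (ps ! i)). \<forall>c.
      \<mu> ps (fs[i := fs ! i \<oplus>\<^bsub>cochain_space scale (ps ! i)\<^esub> g])
        = \<mu> ps fs \<oplus>\<^bsub>cochain_space scale (sum_list ps - 1)\<^esub> \<mu> ps (fs[i := g]) \<and>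
      \<mu> ps (fs[i := c \<odot>\<^bsub>cochain_space scale (ps ! i)\<^esub> (fs ! i)])
        = c \<odot>\<^bsub>cochain_space scale (sum_list ps - 1)\<^esub> \<mu> ps fs"
    unfolding degree_minus_one_ops_def by blast
  then show ?thesis using assms(2,3) by simp
qed

lemmas op_add = op_slot[THEN conjunct1]

lemma op_scale:
  "hom_chain ps fs \<Longrightarrow> i < length ps \<Longrightarrow>
    \<mu> ps (fs[i := cochain_scale scale c (fs ! i)]) = cochain_scale scale c (\<mu> ps fs)"
  using op_slot[of ps fs i 0 c] cochain.zero_closed by simp

lemma op_zero:
  assumes "hom_chain ps fs" "i < length ps" "fs ! i = 0"
  shows "\<mu> ps fs = 0"
proof -
  have "cochain_scale scale 0 f = 0" for f
    by (auto simp: cochain_scale_def)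
  then show ?thesis
    using op_scale[OF assms(1,2), of 0] assms(3) list_update_id[of fs i] by simp
qed

lemma op_compat:
  "ps \<noteq> [] \<Longrightarrow> hom_chain ps fs \<Longrightarrow> hochschild (\<mu> ps fs)
    + (\<Sum>i < length ps. psign (sum_list (take i ps))
        (\<mu> (ps[i := ps ! i + 1]) (fs[i := hochschild (fs ! i)]))) = 0"
  using compat by (simp add: compatible_with_hochschild_def)

text \<open>Every term of the compatibility relation other than \<open>\<delta>(\<mu> ps fs)\<close> has a zero argument.\<close>

lemma op_cocycle:
  assumes ne: "ps \<noteq> []" and c: "hom_cycle ps fs"
  shows "\<mu> ps fs \<in> cocycles (sum_list ps - 1)"
proof -
  have "\<mu> (ps[i := ps ! i + 1]) (fs[i := hochschild (fs ! i)]) = 0" if "i < length ps" for i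
  proof (rule op_zero[where i = i])
    have "hochschild (fs ! i) = 0" "length fs = length ps" using c that by (auto simp: homogeneous_iff)
    then show "fs[i := hochschild (fs ! i)] ! i = 0"
      and "hom_chain (ps[i := ps ! i + 1]) (fs[i := hochschild (fs ! i)])"
      using that cochain.zero_closed by (auto intro!: homogeneous_update hom_cycle_chain c)
  qed (use that in simp)
  then show ?thesis
    using op_compat[OF ne hom_cycle_chain[OF c]] op_closed[OF ne hom_cycle_chain[OF c]] by simp
qed

text \<open>The compatibility relation for the arguments with \<open>h\<close> in position \<open>i\<close>: since the other arguments are cocycles,
  only two terms survive.\<close>

lemma op_coboundary:
  assumes c: "hom_cycle ps fs" and i: "i < length ps" and h: "h \<in> cochains scale (ps ! i - 1)"
  shows "\<mu> ps (fs[i := hochschild h]) \<in> coboundaries scale (sum_list ps - 1)"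
proof -
  let ?ps = "ps[i := ps ! i - 1]" and ?fs = "fs[i := h]"
  have len: "length fs = length ps" using c by (simp add: homogeneous_iff)
  have hc: "hom_chain ?ps ?fs"
    using h by (intro homogeneous_update hom_cycle_chain c) auto
  have ne: "?ps \<noteq> []" using i by auto
  have other: "psign (sum_list (take j ?ps)) (\<mu> (?ps[j := ?ps ! j + 1]) (?fs[j := hochschild (?fs ! j)])) = 0"
    if "j < length ps" "j \<noteq> i" for j
  proof -
    have "hochschild (?fs ! j) = 0"
      using that c by (auto simp: homogeneous_iff)
    then have "\<mu> (?ps[j := ?ps ! j + 1]) (?fs[j := hochschild (?fs ! j)]) = 0"
      using that len cochain.zero_closed by (intro op_zero[where i = j] homogeneous_update hc) auto
    then show ?thesis by simp
  qed
  have "(\<Sum>j < length ?ps. psign (sum_list (take j ?ps))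
        (\<mu> (?ps[j := ?ps ! j + 1]) (?fs[j := hochschild (?fs ! j)])))
      = psign (sum_list (take i ps)) (\<mu> ps (fs[i := hochschild h]))"
    using i len other by (subst sum.remove[of _ i]) (auto intro!: sum.neutral)
  then have "hochschild (\<mu> ?ps ?fs) + psign (sum_list (take i ps)) (\<mu> ps (fs[i := hochschild h])) = 0"
    using op_compat[OF ne hc] by simp
  then have "psign (sum_list (take i ps)) (\<mu> ps (fs[i := hochschild h])) = - hochschild (\<mu> ?ps ?fs)"
    by (simp add: eq_neg_iff_add_eq_0 add.commute)
  then have "\<mu> ps (fs[i := hochschild h]) = psign (sum_list (take i ps)) (- hochschild (\<mu> ?ps ?fs))"
    by (rule psign_move)
  moreover have "hochschild (\<mu> ?ps ?fs) \<in> coboundaries scale (sum_list ps - 1)"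
  proof -
    have "sum_list ?ps = sum_list ps - 1"
      by (subst (2) id_take_nth_drop[OF i]) (simp add: i upd_conv_take_nth_drop)
    then show ?thesis
      using op_closed[OF ne hc] by (auto simp: coboundaries_def)
  qed
  ultimately show ?thesis
    by (simp add: coboundaries_psign HH.W_minus)
qed

text \<open>The arguments are replaced one at a time.\<close>

lemma op_class_cong:
  assumes ne: "ps \<noteq> []" and f: "hom_cycle ps fs" and g: "hom_cycle ps gs"
    and eq: "\<And>i. i < length ps \<Longrightarrow> cls (ps ! i) (fs ! i) = cls (ps ! i) (gs ! i)"
  shows "cls (sum_list ps - 1) (\<mu> ps fs) = cls (sum_list ps - 1) (\<mu> ps gs)"
proof -
  have len: "length fs = length ps" "length gs = length ps"
    using f g by (simp_all add: homogeneous_iff)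
  \<comment> \<open>the intermediate lists: the first \<open>k\<close> arguments are already replaced\<close>
  let ?h = "\<lambda>k. take k gs @ drop k fs"
  have hom: "hom_cycle ps (?h k)" for k
    using f g by (auto simp: homogeneous_iff nth_append)
  have "cls (sum_list ps - 1) (\<mu> ps (?h k)) = cls (sum_list ps - 1) (\<mu> ps fs)" if "k \<le> length ps" for k
    using that
  proof (induction k)
    case (Suc k)
    then have k: "k < length ps" by simp
    have "gs ! k - fs ! k \<in> coboundaries scale (ps ! k)"
      using eq[OF k] by (metis HH_class_eq_iff)
    then obtain h where h: "h \<in> cochains scale (ps ! k - 1)" "gs ! k - fs ! k = hochschild h"
      by (auto simp: coboundaries_def)
    have hk: "?h k ! k = fs ! k" using k len by (simp add: nth_append)
    have "?h (Suc k) = (?h k)[k := ?h k ! k + hochschild h]"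
      unfolding hk h(2)[symmetric] using k len
      by (auto simp: take_Suc_conv_app_nth list_update_append Cons_nth_drop_Suc[symmetric])
    moreover have "hochschild h \<in> cochains scale (ps ! k)"
      using hochschild_cochains[OF h(1)] by simp
    ultimately have "\<mu> ps (?h (Suc k)) = \<mu> ps (?h k) + \<mu> ps ((?h k)[k := hochschild h])"
      using op_add[OF hom_cycle_chain[OF hom] k] by simp
    then have "cls (sum_list ps - 1) (\<mu> ps (?h (Suc k))) = cls (sum_list ps - 1) (\<mu> ps (?h k))"
      using op_coboundary[OF hom k h(1), of k] by (simp add: HH_class_eq_iff)
    then show ?case using Suc by simp
  qed simp
  from this[of "length ps"] show ?thesis using len by simp
qed

text \<open>A choice of representatives is used to define the induced operations; by \<open>op_class_cong\<close> they do not
  depend on it.\<close>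

definition rep :: "int \<Rightarrow> 'a cochain set \<Rightarrow> 'a cochain" where
  "rep p \<xi> = (SOME f. f \<in> cocycles p \<and> cls p f = \<xi>)"

definition descended :: "'a cochain set graded_ops" where
  "descended ps \<xi>s = cls (sum_list ps - 1) (\<mu> ps (map2 rep ps \<xi>s))"

lemma rep: "\<xi> \<in> carrier (HH scale p) \<Longrightarrow> rep p \<xi> \<in> cocycles p \<and> cls p (rep p \<xi>) = \<xi>"
  unfolding rep_def carrier_HH by (rule someI_ex[of "\<lambda>f. f \<in> cocycles p \<and> cls p f = \<xi>"]) blast

lemma lift_homogeneous:
  assumes "homogeneous (HH scale) ps \<xi>s"
  shows "\<exists>fs. hom_cycle ps fs \<and> \<xi>s = map2 cls ps fs"
proof (intro exI conjI)
  let ?fs = "map2 rep ps \<xi>s"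
  show "hom_cycle ps ?fs"
    using assms rep by (auto simp: homogeneous_iff)
  show "\<xi>s = map2 cls ps ?fs"
    using assms rep by (auto simp: homogeneous_iff intro!: nth_equalityI)
qed

lemma descended_class:
  assumes "ps \<noteq> []" "hom_cycle ps fs"
  shows "descended ps (map2 cls ps fs) = cls (sum_list ps - 1) (\<mu> ps fs)"
  unfolding descended_def
proof (rule op_class_cong[OF assms(1) _ assms(2)])
  have *: "i < length ps \<Longrightarrow> cls (ps ! i) (fs ! i) \<in> carrier (HH scale (ps ! i))" for i
    using assms by (auto simp: homogeneous_iff carrier_HH)
  show "hom_cycle ps (map2 rep ps (map2 cls ps fs))"
    using assms rep[OF *] by (auto simp: homogeneous_iff)
  show "i < length ps \<Longrightarrow> cls (ps ! i) (map2 rep ps (map2 cls ps fs) ! i) = cls (ps ! i) (fs ! i)" for i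
    using assms rep[OF *] by (auto simp: homogeneous_iff)
qed

lemma induces_descended: "induces_on_HH scale \<mu> descended"
  by (simp add: induces_on_HH_def descended_class)

lemma insert_op_cocycle:
  assumes c: "hom_cycle ps fs" and k: "1 \<le> k" "i + k \<le> length ps"
  shows "insert_op \<mu> i k ps fs \<in> cocycles (sum_list ps - 2)"
    and "insert_op descended i k ps (map2 cls ps fs) = cls (sum_list ps - 2) (insert_op \<mu> i k ps fs)"
proof -
  let ?qs = "take k (drop i ps)" and ?gs = "take k (drop i fs)"
  let ?d = "sum_list ?qs - 1"
  let ?ps = "take i ps @ [?d] @ drop (i + k) ps" and ?fs = "take i fs @ [\<mu> ?qs ?gs] @ drop (i + k) fs"
  have len: "length fs = length ps" using c by (simp add: homogeneous_iff)
  have inner: "hom_cycle ?qs ?gs" "?qs \<noteq> []"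
    using c k by (auto intro: homogeneous_take homogeneous_drop)
  have outer: "hom_cycle ?ps ?fs" "?ps \<noteq> []"
    using c inner op_cocycle[OF inner(2,1)]
    by (auto intro!: homogeneous_append homogeneous_take homogeneous_drop)
  have s: "sum_list ?ps - 1 = sum_list ps - 2"
    unfolding sum_list_insert by simp
  show "insert_op \<mu> i k ps fs \<in> cocycles (sum_list ps - 2)"
    using op_cocycle[OF outer(2,1)] unfolding s insert_op_def .
  have "map2 cls ?ps ?fs = take i (map2 cls ps fs) @ [cls ?d (\<mu> ?qs ?gs)] @ drop (i + k) (map2 cls ps fs)"
    using len by (simp add: take_zip drop_zip take_map drop_map)
  moreover have "descended ?qs (take k (drop i (map2 cls ps fs))) = cls ?d (\<mu> ?qs ?gs)"
    using descended_class[OF inner(2,1)] by (simp add: take_zip drop_zip take_map drop_map)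
  ultimately show "insert_op descended i k ps (map2 cls ps fs) = cls (sum_list ps - 2) (insert_op \<mu> i k ps fs)"
    using descended_class[OF outer(2,1)] unfolding s insert_op_def by simp
qed

lemma map2_cls_update:
  assumes "length fs = length ps" "i < length ps"
  shows "(map2 cls ps fs)[i := cls (ps ! i) g] = map2 cls ps (fs[i := g])"
  using assms by (intro nth_equalityI) (auto simp: nth_list_update)

text \<open>Multilinearity and the relations hold because they hold for representatives and the passage to
  classes is linear.\<close>

theorem A_infinity_descended: "A_infinity_structure (HH scale) descended"
  unfolding A_infinity_structure_def
proof (intro conjI allI impI)
  show "graded_vector_space (HH scale)"
    unfolding graded_vector_space_def HH_def using HH.module_Q by simp
  show "degree_minus_one_ops (HH scale) descended"
    unfolding degree_minus_one_ops_def
  proof (intro allI impI, elim conjE)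
    fix ps :: "int list" and \<xi>s
    assume ne: "ps \<noteq> []" and hom: "homogeneous (HH scale) ps \<xi>s"
    obtain fs where fs: "hom_cycle ps fs" "\<xi>s = map2 cls ps fs"
      using lift_homogeneous[OF hom] by blast
    let ?d = "sum_list ps - 1"
    have len: "length fs = length ps" using fs by (simp add: homogeneous_iff)
    have slots: "descended ps (\<xi>s[i := \<xi>s ! i \<oplus>\<^bsub>HH scale (ps ! i)\<^esub> \<eta>])
          = descended ps \<xi>s \<oplus>\<^bsub>HH scale ?d\<^esub> descended ps (\<xi>s[i := \<eta>])"
      "descended ps (\<xi>s[i := c \<odot>\<^bsub>HH scale (ps ! i)\<^esub> (\<xi>s ! i)]) = c \<odot>\<^bsub>HH scale ?d\<^esub> descended ps \<xi>s"
      if i: "i < length ps" and \<eta>: "\<eta> \<in> carrier (HH scale (ps ! i))" for i \<eta> c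
    proof -
      obtain g where g: "g \<in> cocycles (ps ! i)" "\<eta> = cls (ps ! i) g"
        using \<eta> by (auto simp: carrier_HH)
      have fi: "fs ! i \<in> cocycles (ps ! i)" "\<xi>s ! i = cls (ps ! i) (fs ! i)"
        using fs i len by (auto simp: homogeneous_iff)
      have upd: "hom_cycle ps (fs[i := h])" if "h \<in> cocycles (ps ! i)" for h
        using fs that by (intro homogeneous_update_same)
      have sum_cl: "fs ! i + g \<in> cocycles (ps ! i)" and smult_cl: "cochain_scale scale c (fs ! i) \<in> cocycles (ps ! i)"
        using cocycle.add_closed[OF fi(1) g(1)] cocycle.smult_closed[OF fi(1)] by simp_all
      have "\<xi>s[i := \<xi>s ! i \<oplus>\<^bsub>HH scale (ps ! i)\<^esub> \<eta>] = map2 cls ps (fs[i := fs ! i + g])"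
        using map2_cls_update[OF len i] fs(2) fi(2) g(2) HH.add_Q by (simp add: HH_def HH_class_def)
      then have "descended ps (\<xi>s[i := \<xi>s ! i \<oplus>\<^bsub>HH scale (ps ! i)\<^esub> \<eta>]) = cls ?d (\<mu> ps (fs[i := fs ! i + g]))"
        using descended_class[OF ne upd[OF sum_cl]] by simp
      also have "\<dots> = cls ?d (\<mu> ps fs) \<oplus>\<^bsub>HH scale ?d\<^esub> cls ?d (\<mu> ps (fs[i := g]))"
        using op_add[OF hom_cycle_chain[OF fs(1)] i, of g] g HH.add_Q by (simp add: HH_def HH_class_def)
      finally show "descended ps (\<xi>s[i := \<xi>s ! i \<oplus>\<^bsub>HH scale (ps ! i)\<^esub> \<eta>])
          = descended ps \<xi>s \<oplus>\<^bsub>HH scale ?d\<^esub> descended ps (\<xi>s[i := \<eta>])"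
        using descended_class[OF ne upd[OF g(1)]] descended_class[OF ne fs(1)] map2_cls_update[OF len i] fs(2) g(2)
        by simp
      have "\<xi>s[i := c \<odot>\<^bsub>HH scale (ps ! i)\<^esub> (\<xi>s ! i)] = map2 cls ps (fs[i := cochain_scale scale c (fs ! i)])"
        using map2_cls_update[OF len i] fs(2) fi(2) HH.smult_Q[OF fi(1)] by (simp add: HH_def HH_class_def)
      then show "descended ps (\<xi>s[i := c \<odot>\<^bsub>HH scale (ps ! i)\<^esub> (\<xi>s ! i)]) = c \<odot>\<^bsub>HH scale ?d\<^esub> descended ps \<xi>s"
        using descended_class[OF ne upd[OF smult_cl]] descended_class[OF ne fs(1)] fs(2)
          op_scale[OF hom_cycle_chain[OF fs(1)] i] HH.smult_Q[OF op_cocycle[OF ne fs(1)]]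
        by (simp add: HH_def HH_class_def)
    qed
    have "descended ps \<xi>s \<in> carrier (HH scale ?d)"
      unfolding fs(2) descended_class[OF ne fs(1)] carrier_HH
      using op_cocycle[OF ne fs(1)] by (rule imageI)
    then show "descended ps \<xi>s \<in> carrier (HH scale ?d) \<and>
      (\<forall>i < length ps. \<forall>\<eta> \<in> carrier (HH scale (ps ! i)). \<forall>c.
        descended ps (\<xi>s[i := \<xi>s ! i \<oplus>\<^bsub>HH scale (ps ! i)\<^esub> \<eta>])
          = descended ps \<xi>s \<oplus>\<^bsub>HH scale ?d\<^esub> descended ps (\<xi>s[i := \<eta>]) \<and>
        descended ps (\<xi>s[i := c \<odot>\<^bsub>HH scale (ps ! i)\<^esub> (\<xi>s ! i)]) = c \<odot>\<^bsub>HH scale ?d\<^esub> descended ps \<xi>s)"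
      using slots by blast
  qed
next
  fix ps :: "int list" and \<xi>s
  assume "ps \<noteq> [] \<and> homogeneous (HH scale) ps \<xi>s"
  then have ne: "ps \<noteq> []" and hom: "homogeneous (HH scale) ps \<xi>s" by auto
  obtain fs where fs: "hom_cycle ps fs" "\<xi>s = map2 cls ps fs"
    using lift_homogeneous[OF hom] by blast
  let ?d = "sum_list ps - 2" and ?I = "{(i, k). 1 \<le> k \<and> i + k \<le> length ps}"
  let ?t = "\<lambda>(i, k). psign (- sum_list (take i ps)) (insert_op \<mu> i k ps fs)"
  have t_cocycle: "?t a \<in> cocycles ?d" if "a \<in> ?I" for a
    using that insert_op_cocycle(1)[OF fs(1)] cocycle.psign_closed by (auto simp del: carrier_cocycle_space)
  have "finsum (HH scale ?d) (\<lambda>(i, k). signed (HH scale ?d) (- sum_list (take i ps)) (insert_op descended i k ps \<xi>s)) ?I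
      = finsum (HH scale ?d) (\<lambda>a. cls ?d (?t a)) ?I"
  proof (rule abelian_monoid.finsum_cong')
    show "abelian_monoid (HH scale ?d)"
      unfolding HH_def by (rule abelian_group.axioms(1)[OF HH.abelian_group_Q])
    show "(\<lambda>a. cls ?d (?t a)) \<in> ?I \<rightarrow> carrier (HH scale ?d)"
      unfolding carrier_HH using t_cocycle by blast
    fix a assume "a \<in> ?I"
    then obtain i k where a: "a = (i, k)" "1 \<le> k" "i + k \<le> length ps" by auto
    show "(case a of (i, k) \<Rightarrow> signed (HH scale ?d) (- sum_list (take i ps)) (insert_op descended i k ps \<xi>s))
        = cls ?d (?t a)"
      using signed_HH_class[OF insert_op_cocycle(1)[OF fs(1) a(2,3)]] insert_op_cocycle(2)[OF fs(1) a(2,3)]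
      by (simp add: a(1) fs(2))
  qed simp
  also have "\<dots> = cls ?d (sum ?t ?I)"
    unfolding HH_def HH_class_def by (rule HH.finsum_Q[OF finite_insertions t_cocycle])
  also have "sum ?t ?I = 0"
  proof -
    have "insert_op \<mu> i k ps fs \<in> cochains scale ?d" if "1 \<le> k" "i + k \<le> length ps" for i k
      using insert_op_cocycle(1)[OF fs(1) that] by simp
    from insertions_finsum[of ps \<mu> fs ?d, OF this]
    show ?thesis
      using A_inf ne hom_cycle_chain[OF fs(1)] by (simp add: A_infinity_structure_def)
  qed
  also have "cls ?d 0 = \<zero>\<^bsub>HH scale ?d\<^esub>"
    unfolding HH_def HH_class_def by (rule HH.zero_Q[symmetric])
  finally show "finsum (HH scale ?d) (\<lambda>(i, k). signed (HH scale ?d) (- sum_list (take i ps))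
      (insert_op descended i k ps \<xi>s)) ?I = \<zero>\<^bsub>HH scale ?d\<^esub>" .
qed

end

section \<open>Cyclic rotations\<close>

text \<open>The norm operator of cyclic homology. The sign differs from the \<open>i\<close>-th power of the signed rotation by the factor
  \<open>(-1)\<^sup>n\<^sup>-\<^sup>1\<close> for words of length \<open>n\<close>; with this factor the sum is the one in the definition of \<open>\<Delta>\<close>.\<close>

definition rotation_sum :: "('a list \<Rightarrow> 'b::ab_group_add) \<Rightarrow> 'a list \<Rightarrow> 'b" where
  "rotation_sum \<Theta> M = (\<Sum>i < length M. psign (int ((i + 1) * (length M - 1))) (\<Theta> (rotate i M)))"

text \<open>The product of the last and the first letter of a cyclic word. For words of length less than two there are no two
  letters to multiply.\<close>

definition wrap :: "('a::times list \<Rightarrow> 'b::zero) \<Rightarrow> 'a list \<Rightarrow> 'b" where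
  "wrap \<Psi> M = (if length M < 2 then 0 else \<Psi> (tl (butlast M) @ [last M * hd M]))"

text \<open>The Hochschild differential in terms of the form associated with a cochain, see \<open>form_hochschild\<close>.\<close>

definition cyclic_differential :: "('a::times list \<Rightarrow> 'b::ab_group_add) \<Rightarrow> 'a list \<Rightarrow> 'b" where
  "cyclic_differential \<Psi> M = merge_sum \<Psi> M + wrap \<Psi> M"

lemma cut_sum_snoc: "cut_sum \<psi> (w @ [z]) = cut_sum (\<lambda>u v. \<psi> u (v @ [z])) w + \<psi> (w @ [z]) []"
  by (simp add: cut_sum_append_Cons)

lemma cut_sum_if_Nil:
  "cut_sum (\<lambda>u v. if v = [] then 0 else \<psi> u v) w = (\<Sum>i < length w. \<psi> (take i w) (drop i w))"
proof -
  have "cut_sum (\<lambda>u v. if v = [] then 0 else \<psi> u v) w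
    = (\<Sum>i < length w. if drop i w = [] then 0 else \<psi> (take i w) (drop i w))"
    unfolding cut_sum_index by (simp flip: lessThan_Suc_atMost)
  also have "\<dots> = (\<Sum>i < length w. \<psi> (take i w) (drop i w))"
    by (rule sum.cong) auto
  finally show ?thesis .
qed

lemma rotation_sum_cut:
  "rotation_sum \<Theta> M = cut_sum (\<lambda>u v. if v = [] then 0
      else psign (int ((length u + 1) * (length u + length v - 1))) (\<Theta> (v @ u))) M"
  unfolding cut_sum_if_Nil rotation_sum_def
  by (rule sum.cong) (auto simp: rotate_drop_take min_def)

lemma rotation_sum_cong:
  "(\<And>w. length w = length M \<Longrightarrow> \<Theta> w = \<Theta>' w) \<Longrightarrow> rotation_sum \<Theta> M = rotation_sum \<Theta>' M"
  unfolding rotation_sum_def by (rule sum.cong) simp_all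

lemma rotation_sum_0: "(\<And>w. length w = length M \<Longrightarrow> \<Theta> w = 0) \<Longrightarrow> rotation_sum \<Theta> M = 0"
  unfolding rotation_sum_def by (rule sum.neutral) simp

lemma rotation_sum_add: "rotation_sum (\<lambda>w. \<Theta> w + \<Theta>' w) M = rotation_sum \<Theta> M + rotation_sum \<Theta>' M"
  by (simp add: rotation_sum_def psign_add sum.distrib)

lemma rotation_sum_minus: "rotation_sum (\<lambda>w. - \<Theta> w) M = - rotation_sum \<Theta> M"
  by (simp add: rotation_sum_def psign_def flip: sum_negf) (auto intro!: sum.cong)

lemma rotation_sum_psign: "rotation_sum (\<lambda>w. psign s (\<Theta> w)) M = psign s (rotation_sum \<Theta> M)"
  by (simp add: psign_def rotation_sum_minus)

lemma rotation_sum_rotate1_arg: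
  "rotation_sum (\<lambda>w. \<Theta> (rotate1 w)) M = psign (int (length M - 1)) (rotation_sum \<Theta> M)"
proof (cases "length M")
  case (Suc m)
  define g where "g j = psign (int (j * m)) (\<Theta> (rotate j M))" for j
  have "g (Suc m) = g 0"
    using Suc rotate_id[of "Suc m" M] by (simp add: g_def psign_def)
  then have "(\<Sum>i < Suc m. g (Suc i)) = (\<Sum>i < Suc m. g i)"
    by (subst sum.lessThan_Suc, subst sum.lessThan_Suc_shift) simp
  moreover have "rotation_sum (\<lambda>w. \<Theta> (rotate1 w)) M = (\<Sum>i < Suc m. g (Suc i))"
    by (simp add: rotation_sum_def Suc g_def)
  moreover have "psign (int (length M - 1)) (rotation_sum \<Theta> M) = (\<Sum>i < Suc m. g i)"
    unfolding rotation_sum_def psign_sum g_def Suc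
    by (rule sum.cong) (auto intro!: psign_cong)
  ultimately show ?thesis by simp
qed (simp add: rotation_sum_def)

lemma rotation_sum_rotate1:
  "rotation_sum \<Theta> (rotate1 M) = psign (int (length M - 1)) (rotation_sum \<Theta> M)"
proof -
  have "rotation_sum \<Theta> (rotate1 M) = rotation_sum (\<lambda>w. \<Theta> (rotate1 w)) M"
    by (simp add: rotation_sum_def rotate1_rotate_swap)
  then show ?thesis by (simp add: rotation_sum_rotate1_arg)
qed

text \<open>Dual, up to sign, to the relation \<open>b' N = N b\<close> of cyclic homology. In a rotated word, a merge takes place either inside one of the two factors, and these
  terms give the merges of the original word, or at the junction of the end of the word with its beginning, and these
  terms give \<open>wrap\<close>.\<close>

lemma rotation_sum_merge:
  "rotation_sum (merge_sum \<Theta>) M = - cyclic_differential (rotation_sum \<Theta>) M"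
proof -
  let ?m = "length M"
  let ?s = "\<lambda>u. int ((length u + 1) * (?m - 1))"
  let ?N = "\<lambda>\<phi>. cut_sum (\<lambda>u v. if v = [] then 0 else \<phi> u v) M"
  let ?A = "\<lambda>u v. psign (?s u) (merge_sum (\<lambda>z. \<Theta> (z @ u)) v)"
  let ?B = "\<lambda>u v. psign (?s u + int (length v)) (merge_sum (\<lambda>z. \<Theta> (v @ z)) u)"
  let ?C = "\<lambda>u v. psign (?s u + int (length v)) (junction \<Theta> v u)"
  define \<psi> where "\<psi> u v = (if v = [] then 0
      else psign (int ((length u + 1) * (length u + length v - 1))) (\<Theta> (v @ u)))" for u v
  have "rotation_sum (merge_sum \<Theta>) M = cut_sum (\<lambda>u v. (if v = [] then 0 else ?A u v)
      + (if v = [] then 0 else ?B u v) + (if v = [] then 0 else ?C u v)) M"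
    unfolding rotation_sum_cut
    by (rule cut_sum_cong) (auto simp: merge_sum_append psign_add add.commute)
  then have L: "rotation_sum (merge_sum \<Theta>) M = ?N ?A + ?N ?B + ?N ?C"
    by (simp only: cut_sum_add)
  have \<psi>1: "merge_sum (\<lambda>a. \<psi> a v) u = - (if v = [] then 0 else ?B u v)" if "u @ v = M" for u v
  proof (cases "v = [] \<or> u = []")
    case False
    have "merge_sum (\<lambda>a. \<psi> a v) u = merge_sum (\<lambda>a. psign (int ((length a + 1) * (length a + length v - 1))) (\<Theta> (v @ a))) u"
      using False by (simp add: \<psi>_def)
    also have "\<dots> = psign (int ((length u - 1 + 1) * (length u - 1 + length v - 1))) (merge_sum (\<lambda>a. \<Theta> (v @ a)) u)"
      by (rule merge_sum_psign_length[of "\<lambda>l. int ((l + 1) * (l + length v - 1))"])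
    also have "\<dots> = - ?B u v"
    proof -
      obtain a b where "length u = Suc a" "length v = Suc b"
        using False by (cases u; cases v) auto
      then show ?thesis
        using that unfolding minus_psign by (intro psign_cong) auto
    qed
    finally show ?thesis using False by simp
  qed (auto simp: \<psi>_def)
  have \<psi>2: "psign (int (length u)) (merge_sum (\<psi> u) v) = - (if v = [] then 0 else ?A u v)" if "u @ v = M" for u v
  proof (cases "length v < 2")
    case True
    then show ?thesis by (cases v; cases "tl v") auto
  next
    case False
    have "merge_sum (\<psi> u) v = merge_sum (\<lambda>a. psign (int ((length u + 1) * (length u + length a - 1))) (\<Theta> (a @ u))) v"
      using False by (intro merge_sum_cong) (auto simp: \<psi>_def)
    also have "\<dots> = psign (int ((length u + 1) * (length u + (length v - 1) - 1))) (merge_sum (\<lambda>a. \<Theta> (a @ u)) v)"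
      by (rule merge_sum_psign_length[of "\<lambda>l. int ((length u + 1) * (length u + l - 1))"])
    finally have "psign (int (length u)) (merge_sum (\<psi> u) v)
      = psign (int (length u) + int ((length u + 1) * (length u + (length v - 1) - 1))) (merge_sum (\<lambda>a. \<Theta> (a @ u)) v)"
      by simp
    also have "\<dots> = - ?A u v"
    proof -
      obtain b where "length v = Suc (Suc b)"
        using False by (cases v; cases "tl v") auto
      then show ?thesis
        using that unfolding minus_psign by (intro psign_cong) auto
    qed
    finally show ?thesis using False by auto
  qed
  have R: "merge_sum (rotation_sum \<Theta>) M = - ?N ?B - ?N ?A"
  proof -
    have "rotation_sum \<Theta> = cut_sum \<psi>"
      unfolding rotation_sum_cut \<psi>_def by (rule ext) simp
    then have "merge_sum (rotation_sum \<Theta>) M = cut_sum (\<lambda>u v. - (if v = [] then 0 else ?B u v)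
        + - (if v = [] then 0 else ?A u v)) M"
      unfolding merge_sum_cut[of \<psi> M, folded \<open>rotation_sum \<Theta> = cut_sum \<psi>\<close>]
      by (intro cut_sum_cong) (simp only: \<psi>1 \<psi>2)
    then show ?thesis unfolding cut_sum_add cut_sum_minus by simp
  qed
  have W: "wrap (rotation_sum \<Theta>) M = - ?N ?C"
  proof (cases "length M < 2")
    case True
    then have "M = [] \<or> (\<exists>x. M = [x])" by (cases M; cases "tl M") auto
    then show ?thesis by (auto simp: wrap_def junction_def cut_sum_Cons)
  next
    case False
    then obtain x N z where M: "M = x # N @ [z]"
      by (cases M; cases "tl M" rule: rev_cases) auto
    have "?N ?C = cut_sum (\<lambda>u v. ?C (x # u) (v @ [z])) N"
      by (simp add: M cut_sum_Cons cut_sum_snoc junction_def)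
    also have "\<dots> = - cut_sum (\<lambda>u v. \<psi> u (v @ [z * x])) N"
      unfolding cut_sum_minus[symmetric]
    proof (rule cut_sum_cong)
      fix u v assume uv: "u @ v = N"
      show "?C (x # u) (v @ [z]) = - \<psi> u (v @ [z * x])"
        unfolding \<psi>_def junction_def minus_psign uv[symmetric]
        by (auto simp: M uv[symmetric] minus_psign intro!: psign_cong)
    qed
    also have "cut_sum (\<lambda>u v. \<psi> u (v @ [z * x])) N = wrap (rotation_sum \<Theta>) M"
      by (simp add: wrap_def M rotation_sum_cut cut_sum_snoc \<psi>_def)
    finally show ?thesis by simp
  qed
  show ?thesis
    unfolding L cyclic_differential_def R W by simp
qed

lemma multilinear_rotation_sum:
  assumes "multilinear s1 s2 \<Theta>" "scalar_algebra s1" "vector_space s2"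
  shows "multilinear s1 s2 (rotation_sum \<Theta>)"
proof -
  interpret scalar_algebra s1 by fact
  interpret s2: vector_space s2 by fact
  have [simp]: "s2 c (psign k x) = psign k (s2 c x)" for c k x
    by (simp add: psign_def)
  note [simp] = multilinear_add[OF assms(1)] multilinear_scale[OF assms(1)]
    multilinear_add[OF assms(1), of "a @ b" for a b, simplified]
    multilinear_scale[OF assms(1), of "a @ b" for a b, simplified]
  show ?thesis
    unfolding rotation_sum_cut[abs_def]
    by (rule mlin_cut_sum[OF _ _ assms(3)]) (auto simp: multilinear_def psign_add)
qed

section \<open>Cochains as forms\<close>

context algebra_with_inner_product
begin

sublocale scalar_algebra scale
  by unfold_locales (rule scale_mult_left, rule scale_mult_right)

lemma ip_add_right: "ip a (x + y) = ip a x + ip a y"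
  and ip_scale_right: "ip a (scale c x) = c * ip a x"
  using ip_linear[of a] by (auto simp: Vector_Spaces.linear_iff)

lemma ip_add_left: "ip (x + y) a = ip x a + ip y a"
  and ip_scale_left: "ip (scale c x) a = c * ip x a"
  by (simp_all add: ip_symmetric[of _ a] ip_add_right ip_scale_right)

lemma ip_0_left [simp]: "ip 0 a = 0" and ip_0_right [simp]: "ip a 0 = 0"
  using ip_scale_left[of 0 0 a] ip_scale_right[of a 0 0] by simp_all

lemma ip_minus_left: "ip (- x) a = - ip x a"
  using ip_scale_left[of "- 1" x a] by simp

lemma ip_diff_left: "ip (x - y) a = ip x a - ip y a"
  using ip_add_left[of x "- y" a] by (simp add: ip_minus_left)

lemma ip_psign_left: "ip (psign s x) a = psign s (ip x a)"
  by (simp add: psign_def ip_minus_left)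

lemma ip_cyclic: "ip (a * b) c = ip b (c * a)"
  using ip_symmetric[of "a * b" c] ip_invariant[of c a b] ip_symmetric[of "c * a" b] by simp

lemma ip_ext: "(\<And>b. ip x b = ip y b) \<Longrightarrow> x = y"
  using ip_nondegenerate[of "x - y"] by (simp add: ip_diff_left)

text \<open>The map that sends \<open>y\<close> to the combination of basis vectors with the coefficients \<open>ip y b\<close> is
  injective as the inner product is non-degenerate, hence surjective as the dimension is finite.\<close>

lemma functional_representation:
  assumes add: "\<And>x y. L (x + y) = L x + L y" and scale: "\<And>c x. L (scale c x) = c * L x"
  shows "\<exists>y. \<forall>a. ip y a = L a"
proof -
  define T where "T y = (\<Sum>b\<in>Basis. scale (ip y b) b)" for y
  have T: "Vector_Spaces.linear scale scale T"
    unfolding Vector_Spaces.linear_iff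
    by (simp add: vector_space_axioms T_def ip_add_left ip_scale_left scale_left_distrib
        sum.distrib scale_sum_right)
  have agree: "ip y a = k a" if "\<forall>b \<in> Basis. ip y b = k b"
    and k: "\<And>x z. k (x + z) = k x + k z" "\<And>c x. k (scale c x) = c * k x" for y a k
  proof -
    have "a \<in> span Basis" by (simp add: span_Basis)
    then show ?thesis
    proof (induction rule: span_induct_alt)
      case base
      then show ?case using k(2)[of 0 0] by simp
    next
      case (step c x z)
      then show ?case using that by (simp add: ip_add_right ip_scale_right)
    qed
  qed
  have coeff: "\<forall>b \<in> Basis. \<alpha> b = \<beta> b" if "(\<Sum>b\<in>Basis. scale (\<alpha> b) b) = (\<Sum>b\<in>Basis. scale (\<beta> b) b)" for \<alpha> \<beta>
  proof -
    have "(\<Sum>b\<in>Basis. scale (\<alpha> b - \<beta> b) b) = 0"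
      using that by (simp add: scale_left_diff_distrib sum_subtractf)
    then show ?thesis
      using independentD[OF independent_Basis finite_Basis order_refl, of "\<lambda>b. \<alpha> b - \<beta> b"] by auto
  qed
  have "inj T"
  proof (rule injI)
    fix x y assume "T x = T y"
    then have "\<forall>b \<in> Basis. ip x b = ip y b" unfolding T_def by (rule coeff)
    then have "ip x b = ip y b" for b
      by (rule agree) (simp_all add: ip_add_right ip_scale_right)
    then show "x = y" by (rule ip_ext)
  qed
  then have "surj T"
    by (rule linear_inj_imp_surj[OF T])
  then obtain y where "T y = (\<Sum>b\<in>Basis. scale (L b) b)"
    by (metis surjD)
  then have "\<forall>b \<in> Basis. ip y b = L b" unfolding T_def by (rule coeff)
  then show ?thesis using agree[OF _ add scale] by blast
qed

abbreviation "mform \<equiv> multilinear scale (*)"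

text \<open>The value of the cochain is paired with the last letter. In \<open>cochain_of\<close>, the description is justified for multilinear
  forms by \<open>functional_representation\<close>.\<close>

definition form :: "'a cochain \<Rightarrow> 'a list \<Rightarrow> 'k" where
  "form f M = (if M = [] then 0 else ip (f (butlast M)) (last M))"

definition cochain_of :: "('a list \<Rightarrow> 'k) \<Rightarrow> 'a cochain" where
  "cochain_of \<Psi> w = (THE y. \<forall>a. ip y a = \<Psi> (w @ [a]))"

lemma vector_space_field: "vector_space ((*) :: 'k \<Rightarrow> 'k \<Rightarrow> 'k)"
  by unfold_locales (simp_all add: algebra_simps)

lemma form_Nil [simp]: "form f [] = 0"
  by (simp add: form_def)

lemma form_snoc: "form f (w @ [a]) = ip (f w) a"
  by (simp add: form_def)

lemma form_add: "form (f + g) M = form f M + form g M"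
  by (simp add: form_def ip_add_left)

lemma form_psign: "form (psign s f) M = psign s (form f M)"
  by (simp add: form_def ip_psign_left psign_apply)

lemma form_diff: "form (f - g) M = form f M - form g M"
  by (simp add: form_def ip_diff_left)

lemma form_ext:
  assumes "\<And>M. M \<noteq> [] \<Longrightarrow> form f M = form g M"
  shows "f = g"
proof
  fix w show "f w = g w"
    using assms[of "w @ [a]" for a] by (intro ip_ext) (simp add: form_snoc)
qed

lemma ip_cochain_of:
  assumes "mform \<Psi>"
  shows "ip (cochain_of \<Psi> w) a = \<Psi> (w @ [a])"
proof -
  obtain y where y: "\<forall>a. ip y a = \<Psi> (w @ [a])"
    using functional_representation[of "\<lambda>a. \<Psi> (w @ [a])"] assms
    by (auto simp: multilinear_def)
  then have "\<forall>a. ip (cochain_of \<Psi> w) a = \<Psi> (w @ [a])"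
    unfolding cochain_of_def by (rule theI[where a = y]) (use y in \<open>auto intro!: ip_ext\<close>)
  then show ?thesis by blast
qed

lemma form_cochain_of:
  assumes "mform \<Psi>" "M \<noteq> []"
  shows "form (cochain_of \<Psi>) M = \<Psi> M"
  using assms(2) ip_cochain_of[OF assms(1)] by (simp add: form_def)

lemma mform_form:
  assumes "mlin f"
  shows "mform (form f)"
  unfolding multilinear_def
proof (intro conjI allI)
  fix u v x y
  show "form f (u @ (x + y) # v) = form f (u @ x # v) + form f (u @ y # v)"
    by (cases v rule: rev_cases)
      (simp_all add: form_def butlast_append ip_add_right ip_add_left multilinear_add[OF assms])
next
  fix u v x c
  show "form f (u @ scale c x # v) = c * form f (u @ x # v)"
    by (cases v rule: rev_cases)
      (simp_all add: form_def butlast_append ip_scale_right ip_scale_left multilinear_scale[OF assms])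
qed

lemma mlin_cochain_of:
  assumes "mform \<Psi>"
  shows "mlin (cochain_of \<Psi>)"
  unfolding multilinear_def
  by (auto intro!: ip_ext simp: ip_cochain_of[OF assms] ip_add_left ip_scale_left
      multilinear_add[OF assms] multilinear_scale[OF assms])

lemma cochain_of_cochains:
  assumes "mform \<Psi>" "\<And>M. int (length M) \<noteq> p + 1 \<Longrightarrow> \<Psi> M = 0"
  shows "cochain_of \<Psi> \<in> cochains scale p"
proof -
  have "cochain_of \<Psi> w = 0" if "int (length w) \<noteq> p" for w
    by (rule ip_ext) (simp add: ip_cochain_of[OF assms(1)] assms(2) that)
  then show ?thesis by (simp add: cochains_iff mlin_cochain_of assms(1))
qed

lemma form_support: "f \<in> cochains scale p \<Longrightarrow> int (length M) \<noteq> p + 1 \<Longrightarrow> form f M = 0"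
  by (cases M rule: rev_cases) (auto simp: form_snoc cochain_support)

text \<open>By invariance, the outer multiplications of the Hochschild differential become multiplications with
  the letter in the last position: on the right they are one more merge of neighbours, on the left they are \<open>wrap\<close>.\<close>

lemma form_hochschild: "form (hochschild f) M = cyclic_differential (form f) M"
proof (cases M rule: rev_cases)
  case (snoc L a)
  have merge: "merge_sum (form f) (L @ [a]) = ip (merge_sum f L) a
      + psign (int (length L)) (junction (form f) L [a])"
  proof -
    have "merge_sum (\<lambda>z. form f (z @ [a])) L = ip (merge_sum f L) a"
      unfolding form_snoc by (rule merge_sum_map[of "\<lambda>x. ip x a"]) (simp_all add: ip_add_left)
    then show ?thesis by (simp add: merge_sum_append)
  qed
  show ?thesis
  proof (cases "L = []")
    case True
    then show ?thesis
      by (simp add: snoc form_snoc[of _ "[]", simplified] cyclic_differential_def wrap_def hochschild_def)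
  next
    case False
    have "junction (form f) L [a] = ip (f (butlast L) * last L) a"
      using False by (simp add: junction_def form_def ip_invariant)
    moreover have "wrap (form f) M = ip (hd L * f (tl L)) a"
      using False by (cases L) (simp_all add: wrap_def snoc form_snoc ip_cyclic)
    ultimately show ?thesis
      using False by (simp add: snoc form_snoc hochschild_merge cyclic_differential_def merge
          ip_add_left ip_psign_left)
  qed
qed (simp add: cyclic_differential_def wrap_def)

end

section \<open>The operator Delta and its square-zero correction\<close>

context algebra_with_inner_product
begin

text \<open>The dual of Connes' operator \<open>B = (1 - t) s N\<close> on the unnormalised complex: \<open>s\<close> inserts the unit, \<open>t\<close> is the signed
  rotation and \<open>N\<close> is the sum over all rotations. Leaving out \<open>t\<close> gives \<open>Delta\<close>.\<close>

definition connes_cochain :: "'a cochain \<Rightarrow> 'a cochain" where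
  "connes_cochain f = cochain_of (rotation_sum
     (\<lambda>w. form f (w @ [unit]) - psign (int (length w)) (form f (unit # w))))"

lemma mlin_form_unit_right: "mlin f \<Longrightarrow> mform (\<lambda>w. form f (w @ [unit]))"
  by (intro multilinear_suffix mform_form)

lemma mlin_form_unit_left: "mlin f \<Longrightarrow> mform (\<lambda>w. form f (unit # w))"
  using multilinear_prefix[OF mform_form, of f "[unit]"] by simp

lemma mform_minus_psign:
  assumes "mform F" "mform G"
  shows "mform (\<lambda>w. F w - psign (int (length w)) (G w))"
  using assms by (auto simp: multilinear_def psign_def algebra_simps)

lemma mform_rotation_sum: "mform F \<Longrightarrow> mform (rotation_sum F)"
  by (rule multilinear_rotation_sum) (auto simp: vector_space_field scalar_algebra_axioms)

lemma rotation_sum_Nil [simp]: "rotation_sum F [] = 0"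
  by (simp add: rotation_sum_def)

lemma form_cochain_of_rotation_sum:
  "mform F \<Longrightarrow> form (cochain_of (rotation_sum F)) = rotation_sum F"
  using form_cochain_of[OF mform_rotation_sum, of F] by (intro ext) (metis form_Nil rotation_sum_Nil)

lemma Delta_eq: "Delta unit ip f = cochain_of (rotation_sum (\<lambda>w. form f (w @ [unit])))"
proof
  fix as
  have *: "(\<Sum>i = 1..length M. (- 1) ^ (i * (length M - 1)) * ip (f (drop (i - 1) M @ take (i - 1) M)) unit)
      = rotation_sum (\<lambda>w. form f (w @ [unit])) M" for M
  proof -
    have "(\<Sum>i = 1..length M. (- 1) ^ (i * (length M - 1)) * ip (f (drop (i - 1) M @ take (i - 1) M)) unit)
      = (\<Sum>i < length M. (- 1) ^ (Suc i * (length M - 1)) * ip (f (drop i M @ take i M)) unit)"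
      by (rule sum.reindex_bij_witness[of _ Suc "\<lambda>i. i - 1"]) auto
    also have "\<dots> = rotation_sum (\<lambda>w. form f (w @ [unit])) M"
      unfolding rotation_sum_def
      by (rule sum.cong) (auto simp: rotate_drop_take form_snoc[of f "drop i M @ take i M" for i, simplified]
          neg_one_power_mult min_def simp del: power_Suc)
    finally show ?thesis .
  qed
  show "Delta unit ip f as = cochain_of (rotation_sum (\<lambda>w. form f (w @ [unit]))) as"
    unfolding Delta_def cochain_of_def Let_def * ..
qed

lemma form_Delta: "mlin f \<Longrightarrow> form (Delta unit ip f) = rotation_sum (\<lambda>w. form f (w @ [unit]))"
  unfolding Delta_eq by (intro form_cochain_of_rotation_sum mlin_form_unit_right)

lemma mform_connes: "mlin f \<Longrightarrow> mform (rotation_sum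
     (\<lambda>w. form f (w @ [unit]) - psign (int (length w)) (form f (unit # w))))"
  by (intro mform_rotation_sum mform_minus_psign mlin_form_unit_right mlin_form_unit_left)

lemma form_connes: "mlin f \<Longrightarrow> form (connes_cochain f)
    = rotation_sum (\<lambda>w. form f (w @ [unit]) - psign (int (length w)) (form f (unit # w)))"
  unfolding connes_cochain_def
  by (intro form_cochain_of_rotation_sum mform_minus_psign mlin_form_unit_right mlin_form_unit_left)

lemma connes_cochains:
  assumes f: "f \<in> cochains scale p"
  shows "connes_cochain f \<in> cochains scale (p - 1)"
  unfolding connes_cochain_def using cochain_mlin[OF f]
  by (intro cochain_of_cochains mform_connes rotation_sum_0) (auto simp: form_support[OF f])

lemma connes_mlin: "mlin f \<Longrightarrow> mlin (connes_cochain f)"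
  unfolding connes_cochain_def by (intro mlin_cochain_of mform_connes)

lemma connes_add:
  assumes "mlin f" "mlin g"
  shows "connes_cochain (f + g) = connes_cochain f + connes_cochain g"
  by (rule form_ext)
    (simp add: assms mlin_plus form_connes form_add rotation_sum_add[symmetric] psign_add algebra_simps)

lemma connes_scale:
  assumes "mlin f"
  shows "connes_cochain (cochain_scale scale c f) = cochain_scale scale c (connes_cochain f)"
proof (rule form_ext)
  fix M :: "'a list" assume M: "M \<noteq> []"
  have form_scale: "form (cochain_scale scale c g) w = c * form g w" for g w
    by (simp add: form_def cochain_scale_def ip_scale_left)
  have "rotation_sum (\<lambda>w. c * F w) M = c * rotation_sum F M" for F :: "'a list \<Rightarrow> 'k"
    by (simp add: rotation_sum_def sum_distrib_left psign_mult_right)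
  moreover have "(\<lambda>w. c * form f (w @ [unit]) - psign (int (length w)) (c * form f (unit # w)))
      = (\<lambda>w. c * (form f (w @ [unit]) - psign (int (length w)) (form f (unit # w))))"
    by (simp add: right_diff_distrib psign_mult_right)
  ultimately show "form (connes_cochain (cochain_scale scale c f)) M = form (cochain_scale scale c (connes_cochain f)) M"
    by (simp add: assms mlin_cochain_scale form_connes M form_scale)
qed

text \<open>The form of \<open>connes_cochain f\<close> is invariant under the signed rotation, so that its two insertions of the
  unit cancel.\<close>

lemma connes_connes:
  assumes "mlin f"
  shows "connes_cochain (connes_cochain f) = 0"
proof (rule form_ext)
  fix M :: "'a list" assume M: "M \<noteq> []"
  let ?F = "\<lambda>w. form f (w @ [unit]) - psign (int (length w)) (form f (unit # w))"
  have "form (connes_cochain f) (w @ [unit]) = psign (int (length w)) (form (connes_cochain f) (unit # w))" for w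
    using rotation_sum_rotate1[of ?F "unit # w"] by (simp add: assms form_connes)
  then show "form (connes_cochain (connes_cochain f)) M = form 0 M"
    by (simp add: assms connes_mlin form_connes M form_def[of 0] rotation_sum_0)
qed

text \<open>The merges with the unit give back the form, once unchanged and once rotated.\<close>

lemma cyclic_differential_unit_right:
  assumes "w \<noteq> []"
  shows "cyclic_differential (form f) (w @ [unit]) = form f (rotate1 w)
     + psign (int (length w)) (form f w) + merge_sum (\<lambda>z. form f (z @ [unit])) w"
proof -
  obtain x v where w: "w = x # v" using assms by (cases w) auto
  have "wrap (form f) (w @ [unit]) = form f (rotate1 w)"
    by (simp add: wrap_def w unit_left)
  moreover have "junction (form f) w [unit] = form f w"
    by (simp add: junction_def w unit_right del: butlast.simps last.simps)
  ultimately show ?thesis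
    by (simp add: cyclic_differential_def merge_sum_append)
qed

lemma cyclic_differential_unit_left:
  assumes "w \<noteq> []"
  shows "cyclic_differential (form f) (unit # w) = - merge_sum (\<lambda>z. form f (unit # z)) w"
proof -
  obtain x v where w: "w = x # v" using assms by (cases w) auto
  have "wrap (form f) (unit # w) = form f w"
    using append_butlast_last_id[OF assms] by (simp add: wrap_def w unit_right del: butlast.simps(2) last.simps)
      (simp add: w)
  then show ?thesis
    by (simp add: cyclic_differential_def w unit_left)
qed

text \<open>A word and its rotation enter the sum over all rotations with opposite signs.\<close>

lemma rotation_sum_rotate_cancel:
  "rotation_sum (\<lambda>w. \<Theta> (rotate1 w) + psign (int (length w)) (\<Theta> w)) M = 0"
proof -
  have "rotation_sum (\<lambda>w. \<Theta> (rotate1 w) + psign (int (length w)) (\<Theta> w)) M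
    = psign (int (length M - 1)) (rotation_sum \<Theta> M) + psign (int (length M)) (rotation_sum \<Theta> M)"
    unfolding rotation_sum_add rotation_sum_rotate1_arg rotation_sum_psign[symmetric]
    by (simp add: rotation_sum_cong[of M "\<lambda>w. psign (int (length w)) (\<Theta> w)" "\<lambda>w. psign (int (length M)) (\<Theta> w)"])
  also have "\<dots> = 0"
  proof (cases M)
    case (Cons x v)
    then show ?thesis by (intro psign_add_opposite) auto
  qed (simp add: rotation_sum_def)
  finally show ?thesis .
qed

text \<open>After inserting the unit, the differential becomes \<open>merge_sum\<close> of the inserted form, up to terms
  that cancel in the sum over all rotations; then \<open>rotation_sum_merge\<close> applies.\<close>

lemma connes_hochschild:
  assumes f: "mlin f"
  shows "connes_cochain (hochschild f) + hochschild (connes_cochain f) = 0"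
proof (rule form_ext)
  fix M :: "'a list" assume M: "M \<noteq> []"
  let ?\<Psi> = "form f"
  let ?F = "\<lambda>w. ?\<Psi> (w @ [unit]) - psign (int (length w)) (?\<Psi> (unit # w))"
  have F: "form (hochschild f) (w @ [unit]) - psign (int (length w)) (form (hochschild f) (unit # w))
      = (?\<Psi> (rotate1 w) + psign (int (length w)) (?\<Psi> w)) + merge_sum ?F w"
    if "length w = length M" for w
  proof -
    have w: "w \<noteq> []" using that M by auto
    have "merge_sum (\<lambda>z. - psign (int (length z)) (?\<Psi> (unit # z))) w
        = psign (int (length w)) (merge_sum (\<lambda>z. ?\<Psi> (unit # z)) w)"
      unfolding merge_sum_minus merge_sum_psign_length[of int]
      unfolding minus_psign
      using w by (intro psign_cong) (cases w; simp)
    then have "merge_sum ?F w = merge_sum (\<lambda>z. ?\<Psi> (z @ [unit])) w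
        + psign (int (length w)) (merge_sum (\<lambda>z. ?\<Psi> (unit # z)) w)"
      using merge_sum_add[of "\<lambda>z. ?\<Psi> (z @ [unit])" "\<lambda>z. - psign (int (length z)) (?\<Psi> (unit # z))" w] by simp
    then show ?thesis
      by (simp add: form_hochschild cyclic_differential_unit_right[OF w]
          cyclic_differential_unit_left[OF w] psign_minus minus_psign)
  qed
  have "form (connes_cochain (hochschild f)) M
      = rotation_sum (\<lambda>w. (?\<Psi> (rotate1 w) + psign (int (length w)) (?\<Psi> w)) + merge_sum ?F w) M"
    unfolding form_connes[OF hochschild_mlin[OF f]] by (rule rotation_sum_cong) (rule F)
  also have "\<dots> = - cyclic_differential (rotation_sum ?F) M"
    unfolding rotation_sum_add[of "\<lambda>w. ?\<Psi> (rotate1 w) + psign (int (length w)) (?\<Psi> w)"]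
      rotation_sum_rotate_cancel rotation_sum_merge by simp
  finally show "form (connes_cochain (hochschild f) + hochschild (connes_cochain f)) M = form 0 M"
    by (simp add: form_add form_hochschild form_def[of 0] form_connes[OF f])
qed

text \<open>The difference consists of the terms with the unit in the first position. With the unit in the first two
  positions, the cocycle identity expresses such a term by merges of the remaining letters, as the three products with a unit
  give the same form up to sign.\<close>

lemma Delta_connes:
  assumes f: "f \<in> cochains scale p" "hochschild f = 0"
  shows "Delta unit ip f - connes_cochain f \<in> coboundaries scale (p - 1)"
proof -
  let ?\<Psi> = "form f" and ?\<Theta> = "\<lambda>w. form f (unit # unit # w)"
  define h where "h = cochain_of (rotation_sum ?\<Theta>)"
  have lin: "mlin f" using f by (simp add: cochain_mlin)
  have lin\<Theta>: "mform ?\<Theta>"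
    using multilinear_prefix[OF mform_form[OF lin], of "[unit, unit]"] by simp
  have h: "h \<in> cochains scale (p - 2)"
    unfolding h_def using lin\<Theta>
    by (intro cochain_of_cochains rotation_sum_0 mform_rotation_sum) (auto simp: form_support[OF f(1)])
  have unit_form: "?\<Psi> (unit # w) = - merge_sum ?\<Theta> w" if w: "w \<noteq> []" for w
  proof -
    obtain x v where xv: "w = x # v" using w by (cases w) auto
    have "0 = form (hochschild f) (unit # unit # w)" by (simp add: f form_def)
    also have "\<dots> = - merge_sum (\<lambda>z. ?\<Psi> (unit # z)) (unit # w)"
      unfolding form_hochschild by (rule cyclic_differential_unit_left) simp
    also have "\<dots> = ?\<Psi> (unit # w) + merge_sum ?\<Theta> w"
      by (simp add: xv unit_left)
    finally show ?thesis by (simp add: eq_neg_iff_add_eq_0)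
  qed
  have "Delta unit ip f - connes_cochain f = hochschild (psign p h)"
  proof (rule form_ext)
    fix M :: "'a list" assume M: "M \<noteq> []"
    have "form (Delta unit ip f - connes_cochain f) M
        = rotation_sum (\<lambda>w. ?\<Psi> (w @ [unit])) M - rotation_sum (\<lambda>w. ?\<Psi> (w @ [unit]) - psign (int (length w)) (?\<Psi> (unit # w))) M"
      by (simp add: form_diff form_Delta form_connes lin M)
    also have "\<dots> = rotation_sum (\<lambda>w. psign (int (length w)) (?\<Psi> (unit # w))) M"
      using rotation_sum_add[of "\<lambda>w. ?\<Psi> (w @ [unit]) - psign (int (length w)) (?\<Psi> (unit # w))"
          "\<lambda>w. psign (int (length w)) (?\<Psi> (unit # w))" M] by simp
    also have "\<dots> = rotation_sum (\<lambda>w. psign p (- merge_sum ?\<Theta> w)) M"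
    proof (rule rotation_sum_cong)
      fix w :: "'a list" assume "length w = length M"
      then have w: "w \<noteq> []" using M by auto
      have "psign (int (length w)) (?\<Psi> (unit # w)) = psign p (?\<Psi> (unit # w))"
        using form_support[OF f(1), of "unit # w"] by (cases "int (length w) = p") auto
      then show "psign (int (length w)) (?\<Psi> (unit # w)) = psign p (- merge_sum ?\<Theta> w)"
        using unit_form[OF w] by simp
    qed
    also have "\<dots> = psign p (cyclic_differential (rotation_sum ?\<Theta>) M)"
      by (simp add: rotation_sum_psign rotation_sum_minus rotation_sum_merge)
    also have "\<dots> = psign p (cyclic_differential (form h) M)"
      unfolding h_def form_cochain_of_rotation_sum[OF lin\<Theta>] ..
    finally show "form (Delta unit ip f - connes_cochain f) M = form (hochschild (psign p h)) M"
      by (simp add: hochschild_psign form_psign form_hochschild)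
  qed
  then show ?thesis
    using cochain.psign_closed[of h "p - 2"] h by (auto simp: coboundaries_def)
qed

sublocale chain: square_zero_derivation_pair "cochains scale" "Collect mlin" cup_product
    "unit_cochain unit" connes_cochain hochschild
proof -
  interpret graded_product "cochains scale" "Collect mlin" cup_product "unit_cochain unit"
    by (rule graded_product) (rule unit_left, rule unit_right)
  show "square_zero_derivation_pair (cochains scale) (Collect mlin) cup_product
    (unit_cochain unit) connes_cochain hochschild"
    by unfold_locales
      (auto simp: connes_mlin connes_add connes_connes connes_cochains hochschild_mlin
        hochschild_cochains hochschild_add hochschild_hochschild connes_hochschild hochschild_cup_cochain)
qed

text \<open>The \<open>A\<^sub>\<infinity>\<close>-structure on the Hochschild cochains.\<close>

definition cochain_ops :: "'a cochain graded_ops" where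
  "cochain_ops ps fs = chain.boerjeson connes_cochain (zip ps fs)"

lemma homogeneous_graded_word:
  "homogeneous (cochain_space scale) ps fs \<Longrightarrow> chain.graded_word (zip ps fs)"
  by (auto simp: homogeneous_iff chain.graded_word_def set_zip)

lemma zip_update_split:
  assumes "length ps = length fs" "i < length ps"
  shows "zip (ps[i := q]) (fs[i := g]) = take i (zip ps fs) @ (q, g) # drop (Suc i) (zip ps fs)"
  using assms by (simp add: update_zip[symmetric] upd_conv_take_nth_drop take_zip drop_zip)

theorem A_infinity_cochain_ops: "A_infinity_structure (cochain_space scale) cochain_ops"
  unfolding A_infinity_structure_def
proof (intro conjI allI impI)
  show "graded_vector_space (cochain_space scale)"
    by (simp add: graded_vector_space_def cochain.module)
  have deg: "chain.deg (zip ps fs) = sum_list ps" if "length ps = length fs" for ps :: "int list" and fs :: "'a cochain list"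
    using that by (simp add: chain.deg_def)
  have closed: "cochain_ops ps fs \<in> cochains scale (sum_list ps - 1)"
    if "homogeneous (cochain_space scale) ps fs" for ps fs
    using chain.boerjeson_V[OF homogeneous_graded_word[OF that]] that
    by (simp add: cochain_ops_def deg homogeneous_iff)
  show "degree_minus_one_ops (cochain_space scale) cochain_ops"
    unfolding degree_minus_one_ops_def
  proof (intro allI impI conjI ballI)
    fix ps :: "int list" and fs :: "'a cochain list" and i g c
    assume *: "ps \<noteq> [] \<and> homogeneous (cochain_space scale) ps fs"
    then show "cochain_ops ps fs \<in> carrier (cochain_space scale (sum_list ps - 1))"
      using closed by simp
    assume i: "i < length ps" and g: "g \<in> carrier (cochain_space scale (ps ! i))"
    have len: "length ps = length fs" and hom: "homogeneous (cochain_space scale) ps fs"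
      and fi: "mlin (fs ! i)"
      using * i by (auto simp: homogeneous_iff cochain_mlin)
    let ?u = "take i (zip ps fs)" and ?v = "drop (Suc i) (zip ps fs)"
    have uv: "chain.letters ?u" "chain.letters ?v"
      using chain.graded_word_letters[OF homogeneous_graded_word[OF hom]]
      by (auto simp: chain.letters_def dest: in_set_takeD in_set_dropD)
    have upd: "cochain_ops ps (fs[i := h]) = chain.boerjeson connes_cochain (?u @ (ps ! i, h) # ?v)" for h
      using zip_update_split[OF len i, of "ps ! i" h] by (simp add: cochain_ops_def)
    have self: "cochain_ops ps fs = chain.boerjeson connes_cochain (?u @ (ps ! i, fs ! i) # ?v)"
      using upd[of "fs ! i"] by simp
    show "cochain_ops ps (fs[i := fs ! i \<oplus>\<^bsub>cochain_space scale (ps ! i)\<^esub> g])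
        = cochain_ops ps fs \<oplus>\<^bsub>cochain_space scale (sum_list ps - 1)\<^esub> cochain_ops ps (fs[i := g])"
      unfolding upd self using fi g
      by (simp add: chain.boerjeson_letter_add[OF uv] cochain_mlin)
    show "cochain_ops ps (fs[i := c \<odot>\<^bsub>cochain_space scale (ps ! i)\<^esub> (fs ! i)])
        = c \<odot>\<^bsub>cochain_space scale (sum_list ps - 1)\<^esub> cochain_ops ps fs"
    proof -
      have cut: "scale c (cut_sum \<phi> w) = cut_sum (\<lambda>u v. scale c (\<phi> u v)) w" for \<phi> and w :: "'a list"
        by (rule cut_sum_map) (simp_all add: scale_right_distrib)
      have "chain.boerjeson connes_cochain (?u @ (ps ! i, cochain_scale scale c (fs ! i)) # ?v)
        = cochain_scale scale c (chain.boerjeson connes_cochain (?u @ (ps ! i, fs ! i) # ?v))"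
        using fi
        by (intro chain.boerjeson_letter_hom[OF uv])
          (auto simp: cochain_scale_def cup_product_def cut scale_mult_left scale_mult_right
            scale_right_diff_distrib fun_eq_iff connes_scale[unfolded cochain_scale_def])
      then show ?thesis unfolding upd self by simp
    qed
  qed
  fix ps :: "int list" and fs :: "'a cochain list"
  assume *: "ps \<noteq> [] \<and> homogeneous (cochain_space scale) ps fs"
  then have hom: "homogeneous (cochain_space scale) ps fs" and len: "length ps = length fs"
    by (auto simp: homogeneous_iff)
  let ?d = "sum_list ps - 2" and ?I = "{(i, k). 1 \<le> k \<and> i + k \<le> length ps}"
  have ins: "insert_op cochain_ops i k ps fs \<in> cochains scale ?d"
    if "1 \<le> k" "i + k \<le> length ps" for i k
  proof -
    have "homogeneous (cochain_space scale) (take k (drop i ps)) (take k (drop i fs))"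
      by (intro homogeneous_take homogeneous_drop hom)
    then have "homogeneous (cochain_space scale)
      (take i ps @ [sum_list (take k (drop i ps)) - 1] @ drop (i + k) ps)
      (take i fs @ [cochain_ops (take k (drop i ps)) (take k (drop i fs))] @ drop (i + k) fs)"
      using closed by (auto intro!: homogeneous_append homogeneous_take homogeneous_drop hom)
    from closed[OF this] show ?thesis
      unfolding sum_list_insert insert_op_def by simp
  qed
  show "finsum (cochain_space scale ?d) (\<lambda>(i, k). signed (cochain_space scale ?d) (- sum_list (take i ps))
        (insert_op cochain_ops i k ps fs)) ?I = \<zero>\<^bsub>cochain_space scale ?d\<^esub>"
    using insertions_finsum[of ps cochain_ops fs ?d, OF ins] chain.boerjeson_relation_indexed[OF len chain.graded_word_letters[OF homogeneous_graded_word[OF hom]]]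
    by (simp add: cochain_ops_def[abs_def])
qed

theorem compatible_cochain_ops: "compatible_with_hochschild scale cochain_ops"
  unfolding compatible_with_hochschild_def
proof (intro allI impI)
  fix ps :: "int list" and fs :: "'a cochain list"
  assume *: "ps \<noteq> [] \<and> homogeneous (cochain_space scale) ps fs"
  then have hom: "homogeneous (cochain_space scale) ps fs" and len: "length ps = length fs"
    by (auto simp: homogeneous_iff)
  let ?w = "zip ps fs"
  have "(\<Sum>i < length ps. psign (sum_list (take i ps)) (cochain_ops (ps[i := ps ! i + 1]) (fs[i := hochschild (fs ! i)])))
    = cut_sum (\<lambda>u v. if v = [] then 0 else psign (chain.deg u)
        (chain.boerjeson connes_cochain (u @ (fst (hd v) + 1, hochschild (snd (hd v))) # tl v))) ?w"
    unfolding cut_sum_if_Nil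
  proof (rule sum.cong)
    fix i assume "i \<in> {..<length ?w}"
    then have i: "i < length ps" "i < length fs" using len by auto
    then show "psign (sum_list (take i ps)) (cochain_ops (ps[i := ps ! i + 1]) (fs[i := hochschild (fs ! i)]))
      = psign (chain.deg (take i ?w)) (chain.boerjeson connes_cochain
          (take i ?w @ (fst (hd (drop i ?w)) + 1, hochschild (snd (hd (drop i ?w)))) # tl (drop i ?w)))"
      by (simp add: cochain_ops_def zip_update_split[OF len i(1)] hd_drop_conv_nth len tl_drop[symmetric] drop_Suc
          chain.deg_def take_zip)
  qed (simp add: len)
  then show "hochschild (cochain_ops ps fs) + (\<Sum>i < length ps. psign (sum_list (take i ps))
      (cochain_ops (ps[i := ps ! i + 1]) (fs[i := hochschild (fs ! i)]))) = 0"
    using chain.boerjeson_compatible[OF homogeneous_graded_word[OF hom]]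
    by (simp add: cochain_ops_def[of ps fs])
qed

end

section \<open>Sums over deconcatenations into three and four factors\<close>

definition cut3_sum :: "('x list \<Rightarrow> 'x list \<Rightarrow> 'x list \<Rightarrow> 'b::comm_monoid_add) \<Rightarrow> 'x list \<Rightarrow> 'b" where
  "cut3_sum \<psi> = cut_sum (\<lambda>a r. cut_sum (\<psi> a) r)"

definition cut4_sum :: "('x list \<Rightarrow> 'x list \<Rightarrow> 'x list \<Rightarrow> 'x list \<Rightarrow> 'b::comm_monoid_add) \<Rightarrow> 'x list \<Rightarrow> 'b" where
  "cut4_sum \<psi> = cut_sum (\<lambda>a r. cut3_sum (\<psi> a) r)"

lemma cut3_sum_cong:
  "(\<And>a b c. a @ b @ c = w \<Longrightarrow> \<psi> a b c = \<psi>' a b c) \<Longrightarrow> cut3_sum \<psi> w = cut3_sum \<psi>' w"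
  unfolding cut3_sum_def by (intro cut_sum_cong) auto

lemma cut4_sum_cong:
  "(\<And>a b c d. a @ b @ c @ d = w \<Longrightarrow> \<psi> a b c d = \<psi>' a b c d) \<Longrightarrow> cut4_sum \<psi> w = cut4_sum \<psi>' w"
  unfolding cut4_sum_def by (intro cut_sum_cong cut3_sum_cong) auto

lemma cut3_sum_add: "cut3_sum (\<lambda>a b c. \<psi> a b c + \<psi>' a b c) w = cut3_sum \<psi> w + cut3_sum \<psi>' w"
  by (simp add: cut3_sum_def cut_sum_add)

lemma cut4_sum_add:
  "cut4_sum (\<lambda>a b c d. \<psi> a b c d + \<psi>' a b c d) w = cut4_sum \<psi> w + cut4_sum \<psi>' w"
  by (simp add: cut4_sum_def cut3_sum_add cut_sum_add)

lemma cut3_sum_map: "h 0 = 0 \<Longrightarrow> (\<And>x y. h (x + y) = h x + h y) \<Longrightarrow>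
    h (cut3_sum \<psi> w) = cut3_sum (\<lambda>a b c. h (\<psi> a b c)) w"
  unfolding cut3_sum_def by (simp add: cut_sum_map[of h])

lemma cut4_sum_map: "h 0 = 0 \<Longrightarrow> (\<And>x y. h (x + y) = h x + h y) \<Longrightarrow>
    h (cut4_sum \<psi> w) = cut4_sum (\<lambda>a b c d. h (\<psi> a b c d)) w"
  unfolding cut4_sum_def by (simp add: cut3_sum_map[of h] cut_sum_map[of h])

lemma cut3_sum_assoc: "cut3_sum \<psi> w = cut_sum (\<lambda>u c. cut_sum (\<lambda>a b. \<psi> a b c) u) w"
  unfolding cut3_sum_def by (rule cut_sum_assoc[symmetric])

lemma cut3_sum_shift12:
  "cut3_sum (\<lambda>a b c. if a = [] then 0 else h (butlast a) (last a) b c) w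
    = cut3_sum (\<lambda>a b c. if b = [] then 0 else h a (hd b) (tl b) c) w"
  unfolding cut3_sum_assoc by (rule cut_sum_cong) (rule cut_sum_shift)

lemma cut3_sum_shift23:
  "cut3_sum (\<lambda>a b c. if b = [] then 0 else h a (butlast b) (last b) c) w
    = cut3_sum (\<lambda>a b c. if c = [] then 0 else h a b (hd c) (tl c)) w"
  unfolding cut3_sum_def by (rule cut_sum_cong) (rule cut_sum_shift)

lemma cut4_sum_shift12:
  "cut4_sum (\<lambda>a b c d. if a = [] then 0 else h (butlast a) (last a) b c d) w
    = cut4_sum (\<lambda>a b c d. if b = [] then 0 else h a (hd b) (tl b) c d) w"
  for h :: "'a list \<Rightarrow> 'a \<Rightarrow> 'a list \<Rightarrow> 'a list \<Rightarrow> 'a list \<Rightarrow> 'b::comm_monoid_add"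
proof -
  have *: "cut4_sum \<psi> w = cut_sum (\<lambda>u r. cut_sum (\<lambda>a b. cut_sum (\<psi> a b) r) u) w" for \<psi> :: "'a list \<Rightarrow> 'a list \<Rightarrow> 'a list \<Rightarrow> 'a list \<Rightarrow> 'b"
    unfolding cut4_sum_def cut3_sum_def by (rule cut_sum_assoc[symmetric])
  have "cut_sum (\<lambda>a b. cut_sum (\<lambda>c d. if a = [] then 0 else h (butlast a) (last a) b c d) r) u
     = cut_sum (\<lambda>a b. if a = [] then 0 else cut_sum (\<lambda>c d. h (butlast a) (last a) b c d) r) u" for r u
    by (rule cut_sum_cong) (auto intro: cut_sum_0)
  moreover have "cut_sum (\<lambda>a b. cut_sum (\<lambda>c d. if b = [] then 0 else h a (hd b) (tl b) c d) r) u
     = cut_sum (\<lambda>a b. if b = [] then 0 else cut_sum (\<lambda>c d. h a (hd b) (tl b) c d) r) u" for r u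
    by (rule cut_sum_cong) (auto intro: cut_sum_0)
  ultimately show ?thesis
    unfolding * using cut_sum_shift[of "\<lambda>a x b. cut_sum (h a x b) r" for r] by simp
qed

lemma cut4_sum_shift23:
  "cut4_sum (\<lambda>a b c d. if b = [] then 0 else h a (butlast b) (last b) c d) w
    = cut4_sum (\<lambda>a b c d. if c = [] then 0 else h a b (hd c) (tl c) d) w"
  unfolding cut4_sum_def by (rule cut_sum_cong) (rule cut3_sum_shift12)

lemma cut4_sum_shift34:
  "cut4_sum (\<lambda>a b c d. if c = [] then 0 else h a b (butlast c) (last c) d) w
    = cut4_sum (\<lambda>a b c d. if d = [] then 0 else h a b c (hd d) (tl d)) w"
  unfolding cut4_sum_def by (rule cut_sum_cong) (rule cut3_sum_shift23)

lemma cut3_sum_Cons: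
  "(\<And>b c. \<psi> [] b c = 0) \<Longrightarrow> cut3_sum \<psi> (x # w) = cut3_sum (\<lambda>a. \<psi> (x # a)) w"
  by (simp add: cut3_sum_def cut_sum_Cons[of _ x w] cut_sum_0)

lemma cut4_sum_Cons:
  "(\<And>b c d. \<psi> [] b c d = 0) \<Longrightarrow> cut4_sum \<psi> (x # w) = cut4_sum (\<lambda>a. \<psi> (x # a)) w"
  by (simp add: cut4_sum_def cut3_sum_def cut_sum_Cons[of _ x w] cut_sum_0)

lemma cut3_sum_snoc:
  "(\<And>a b. \<psi> a b [] = 0) \<Longrightarrow> cut3_sum \<psi> (w @ [x]) = cut3_sum (\<lambda>a b c. \<psi> a b (c @ [x])) w"
  by (simp add: cut3_sum_def cut_sum_snoc)

lemma cut4_sum_snoc: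
  "(\<And>a b c. \<psi> a b c [] = 0) \<Longrightarrow> cut4_sum \<psi> (w @ [x]) = cut4_sum (\<lambda>a b c d. \<psi> a b c (d @ [x])) w"
  by (simp add: cut4_sum_def cut3_sum_snoc cut_sum_snoc) (simp add: cut3_sum_def)

lemma cut3_sum_Nil_1: "cut3_sum (\<lambda>a b c. if a = [] then \<psi> b c else 0) w = cut_sum \<psi> w"
proof -
  have "cut3_sum (\<lambda>a b c. if a = [] then \<psi> b c else 0) w = cut_sum (\<lambda>a r. if a = [] then cut_sum \<psi> r else 0) w"
    unfolding cut3_sum_def by (rule cut_sum_cong) (auto intro: cut_sum_0)
  then show ?thesis by (simp add: cut_sum_Nil_left)
qed

lemma cut3_sum_Nil_3: "cut3_sum (\<lambda>a b c. if c = [] then \<psi> a b else 0) w = cut_sum \<psi> w"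
  by (simp add: cut3_sum_def cut_sum_Nil_right)

lemma cut4_sum_Nil_1: "cut4_sum (\<lambda>a b c d. if a = [] then \<psi> b c d else 0) w = cut3_sum \<psi> w"
proof -
  have "cut4_sum (\<lambda>a b c d. if a = [] then \<psi> b c d else 0) w = cut_sum (\<lambda>a r. if a = [] then cut3_sum \<psi> r else 0) w"
    unfolding cut4_sum_def cut3_sum_def by (rule cut_sum_cong) (auto intro!: cut_sum_0)
  then show ?thesis by (simp add: cut_sum_Nil_left)
qed

lemma cut4_sum_Nil_2: "cut4_sum (\<lambda>a b c d. if b = [] then \<psi> a c d else 0) w = cut3_sum \<psi> w"
  unfolding cut4_sum_def cut3_sum_Nil_1 unfolding cut3_sum_def ..

lemma cut4_sum_Nil_4: "cut4_sum (\<lambda>a b c d. if d = [] then \<psi> a b c else 0) w = cut3_sum \<psi> w"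
  unfolding cut4_sum_def cut3_sum_Nil_3 unfolding cut3_sum_def ..

lemma merge_sum_cut3:
  "merge_sum (cut3_sum \<psi>) w = cut3_sum (\<lambda>a b c. merge_sum (\<lambda>a. \<psi> a b c) a
    + psign (int (length a)) (merge_sum (\<lambda>b. \<psi> a b c) b)
    + psign (int (length a) + int (length b)) (merge_sum (\<psi> a b) c)) w"
proof -
  have "merge_sum (\<lambda>a. cut_sum (\<psi> a) r) u = cut_sum (\<lambda>b c. merge_sum (\<lambda>a. \<psi> a b c) u) r" for r u
    by (induction r arbitrary: \<psi>) (simp_all add: cut_sum_Cons merge_sum_add)
  then have "merge_sum (cut3_sum \<psi>) w = cut_sum (\<lambda>a r. cut_sum (\<lambda>b c. merge_sum (\<lambda>a. \<psi> a b c) a) r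
      + psign (int (length a)) (cut_sum (\<lambda>b c. merge_sum (\<lambda>b. \<psi> a b c) b
         + psign (int (length b)) (merge_sum (\<psi> a b) c)) r)) w"
    unfolding cut3_sum_def merge_sum_cut by simp
  then show ?thesis
    unfolding cut3_sum_def cut_sum_psign cut_sum_add[symmetric]
    by (simp add: psign_add add.assoc)
qed

lemma merge_sum_cut4:
  "merge_sum (cut4_sum \<psi>) w = cut4_sum (\<lambda>a b c d. merge_sum (\<lambda>a. \<psi> a b c d) a
    + psign (int (length a)) (merge_sum (\<lambda>b. \<psi> a b c d) b)
    + psign (int (length a) + int (length b)) (merge_sum (\<lambda>c. \<psi> a b c d) c)
    + psign (int (length a) + int (length b) + int (length c)) (merge_sum (\<psi> a b c) d)) w"
  for \<psi> :: "'a::times list \<Rightarrow> 'a list \<Rightarrow> 'a list \<Rightarrow> 'a list \<Rightarrow> 'b::ab_group_add"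
proof -
  have 2: "merge_sum (\<lambda>a. cut_sum (\<psi> a) r) u = cut_sum (\<lambda>b c. merge_sum (\<lambda>a. \<psi> a b c) u) r" for r u and \<psi> :: "'a list \<Rightarrow> 'a list \<Rightarrow> 'a list \<Rightarrow> 'b"
    by (induction r arbitrary: \<psi>) (simp_all add: cut_sum_Cons merge_sum_add)
  have "merge_sum (cut4_sum \<psi>) w = cut_sum (\<lambda>a r. cut3_sum (\<lambda>b c d. merge_sum (\<lambda>a. \<psi> a b c d) a) r
      + psign (int (length a)) (cut3_sum (\<lambda>b c d. merge_sum (\<lambda>b. \<psi> a b c d) b
        + psign (int (length b)) (merge_sum (\<lambda>c. \<psi> a b c d) c)
        + psign (int (length b) + int (length c)) (merge_sum (\<psi> a b c) d)) r)) w"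
    unfolding cut4_sum_def merge_sum_cut merge_sum_cut3 by (simp add: cut3_sum_def 2)
  then show ?thesis
    unfolding cut4_sum_def cut3_sum_map[of "psign k" for k, OF psign_zero psign_add] cut3_sum_add[symmetric]
    by (simp add: psign_add add.assoc)
qed

section \<open>Composition and graded commutativity of the cup product\<close>

text \<open>The composition \<open>f \<circ> g\<close> of Gerstenhaber. The arity of \<open>g\<close> is \<open>length c\<close>, so that degrees do not have to be
  specified; see \<open>gerstenhaber_circ_composition\<close>.\<close>

definition composition :: "'a::ring cochain \<Rightarrow> 'a cochain \<Rightarrow> 'a cochain" where
  "composition f g = cut3_sum (\<lambda>a c b. psign (int (length a * (length c + 1))) (f (a @ g c # b)))"

context scalar_algebra
begin

lemma mlin_cut3_sum:
  assumes "\<And>b c. multilinear scale s (\<lambda>a. \<psi> a b c)" "\<And>a c. multilinear scale s (\<lambda>b. \<psi> a b c)"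
    "\<And>a b. multilinear scale s (\<psi> a b)" "vector_space s"
  shows "multilinear scale s (cut3_sum \<psi>)"
proof -
  interpret s: vector_space s by fact
  have "multilinear scale s (\<lambda>a. cut_sum (\<psi> a) r)" for r
  proof -
    have "cut_sum (\<psi> (u @ (x + y) # v)) r = cut_sum (\<lambda>b c. \<psi> (u @ x # v) b c + \<psi> (u @ y # v) b c) r"
      and "cut_sum (\<psi> (u @ scale k x # v)) r = cut_sum (\<lambda>b c. s k (\<psi> (u @ x # v) b c)) r" for u x y v k
      by (rule cut_sum_cong, simp add: multilinear_add[OF assms(1)] multilinear_scale[OF assms(1)])+
    then show ?thesis
      by (simp add: multilinear_def cut_sum_add cut_sum_map[of "s k" for k, OF s.scale_zero_right s.scale_right_distrib])
  qed
  then show ?thesis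
    unfolding cut3_sum_def using assms by (intro mlin_cut_sum)
qed

lemma mlin_cut4_sum:
  assumes "\<And>b c d. multilinear scale s (\<lambda>a. \<psi> a b c d)" "\<And>a c d. multilinear scale s (\<lambda>b. \<psi> a b c d)"
    "\<And>a b d. multilinear scale s (\<lambda>c. \<psi> a b c d)" "\<And>a b c. multilinear scale s (\<psi> a b c)" "vector_space s"
  shows "multilinear scale s (cut4_sum \<psi>)"
proof -
  interpret s: vector_space s by fact
  have "multilinear scale s (\<lambda>a. cut3_sum (\<psi> a) r)" for r
  proof -
    have "cut3_sum (\<psi> (u @ (x + y) # v)) r = cut3_sum (\<lambda>b c d. \<psi> (u @ x # v) b c d + \<psi> (u @ y # v) b c d) r"
      and "cut3_sum (\<psi> (u @ scale k x # v)) r = cut3_sum (\<lambda>b c d. s k (\<psi> (u @ x # v) b c d)) r" for u x y v k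
      by (rule cut3_sum_cong, simp add: multilinear_add[OF assms(1)] multilinear_scale[OF assms(1)])+
    then show ?thesis
      by (simp add: multilinear_def cut3_sum_add cut3_sum_map[of "s k" for k, OF s.scale_zero_right s.scale_right_distrib])
  qed
  then show ?thesis
    unfolding cut4_sum_def using assms by (intro mlin_cut_sum mlin_cut3_sum)
qed

lemma mlin_comp:
  assumes f: "mlin f" and g: "mlin g"
  shows "mlin (\<lambda>a. f (u @ g a # v))"
  unfolding multilinear_def
  by (simp add: multilinear_add[OF g] multilinear_scale[OF g] multilinear_add[OF f] multilinear_scale[OF f])

lemma mlin_psign_length: "multilinear scale s F \<Longrightarrow> vector_space s \<Longrightarrow>
    multilinear scale s (\<lambda>a. psign (int (n (length a))) (F a))"
proof -
  assume F: "multilinear scale s F" and "vector_space s"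
  then interpret s: vector_space s by simp
  have "psign k (s c x) = s c (psign k x)" for k c x
    by (simp add: psign_def)
  then show ?thesis
    by (simp add: multilinear_def multilinear_add[OF F] multilinear_scale[OF F] psign_add)
qed

lemma merge_in_slot:
  assumes "multilinear scale s F"
  shows "merge_sum (\<lambda>z. F (u @ g z # v)) c = F (u @ merge_sum g c # v)"
  using multilinear_add[OF assms] multilinear_0[OF assms]
  by (intro merge_sum_map[of "\<lambda>x. F (u @ x # v)"]) simp_all

lemma merge_cocycle:
  fixes g :: "'a cochain"
  assumes "hochschild g = 0"
  shows "merge_sum g c = (if c = [] then 0 else - (hd c * g (tl c)))
    + (if c = [] then 0 else - psign (int (length c)) (g (butlast c) * last c))"
proof -
  have "x + m + r = 0 \<Longrightarrow> m = - x + - r" for x m r :: 'a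
    by (simp only: minus_add_distrib[symmetric] eq_neg_iff_add_eq_0 ac_simps)
  from this[of "hd c * g (tl c)"] show ?thesis
    using fun_cong[OF assms, of c] by (auto simp: hochschild_merge)
qed

text \<open>The cocycle identity of \<open>f\<close> is summed over all words in which a factor \<open>c\<close> is replaced by \<open>g c\<close>. The merges
  that do not involve \<open>g c\<close> and the outer multiplications with other letters are terms of the differential of the composition. Those that
  multiply \<open>g c\<close> with a neighbour are supplied by the merges inside \<open>c\<close> and the cocycle identity of \<open>g\<close>. The two outer multiplications with
  \<open>g c\<close> are the two cup products.\<close>

lemma graded_commutativity_length:
  assumes f: "mlin f" "hochschild f = 0" and g: "hochschild g = 0"
  shows "cup_product g f w + cut_sum (\<lambda>a c. psign (int (length a * length c) + 1) (f a * g c)) w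
    + hochschild (cut3_sum (\<lambda>a c b. psign (int ((length a + 1) * (length c + 1))) (f (a @ g c # b)))) w = 0"
proof -
  \<comment> \<open>\<open>L\<close> and \<open>R\<close>: outer multiplications; \<open>M\<close>: merges inside a factor; \<open>J\<close>: merges with \<open>g c\<close>;
    \<open>S\<close>: what the merges inside \<open>c\<close> become by the cocycle identity of \<open>g\<close>\<close>
  let ?\<rho> = "\<lambda>a c. int (length a * (length c + 1))"
  define \<pi> where "\<pi> a c b = psign (int ((length a + 1) * (length c + 1))) (f (a @ g c # b))" for a c b :: "'a list"
  define L1 where "L1 a c b = (if a = [] then 0 else psign (?\<rho> a c) (hd a * f (tl a @ g c # b)))" for a c b :: "'a list"
  define L0 where "L0 a c b = (if a = [] then g c * f b else 0)" for a c b :: "'a list"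
  define R1 where "R1 a c b = (if b = [] then 0 else
      psign (?\<rho> a c + int (length a) + int (length b) + 1) (f (a @ g c # butlast b) * last b))" for a c b :: "'a list"
  define R0 where "R0 a c b = (if b = [] then psign (int (length a * length c) + 1) (f a * g c) else 0)" for a c b :: "'a list"
  define MA where "MA a c b = psign (?\<rho> a c) (merge_sum (\<lambda>z. f (z @ g c # b)) a)" for a c b :: "'a list"
  define MB where "MB a c b = psign (int (length a * length c) + 1) (merge_sum (\<lambda>z. f (a @ g c # z)) b)" for a c b :: "'a list"
  define J1 where "J1 a c b = (if a = [] then 0 else
      psign (?\<rho> a c + int (length a)) (f (butlast a @ (last a * g c) # b)))" for a c b :: "'a list"
  define J2 where "J2 a c b = (if b = [] then 0 else
      psign (int (length a * length c) + 1) (f (a @ (g c * hd b) # tl b)))" for a c b :: "'a list"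
  define S1 where "S1 a c b = (if c = [] then 0 else
      psign (int (length a) + int ((length a + 1) * length c) + 1) (f (a @ (hd c * g (tl c)) # b)))" for a c b :: "'a list"
  define S2 where "S2 a c b = (if c = [] then 0 else
      psign (int (length a) + int (length a * length c) + 1) (f (a @ (g (butlast c) * last c) # b)))" for a c b :: "'a list"
  have expand: "psign (?\<rho> a c) (hochschild f (a @ g c # b)) =
      L1 a c b + L0 a c b + R1 a c b + R0 a c b + MA a c b + MB a c b + J1 a c b + J2 a c b" for a c b :: "'a list"
  proof -
    have tail: "merge_sum (\<lambda>z. f (a @ z)) (g c # b) =
        (if b = [] then 0 else - f (a @ (g c * hd b) # tl b)) + - merge_sum (\<lambda>z. f (a @ g c # z)) b"
      by (cases b) simp_all
    have left: "psign (?\<rho> a c) (left_part f (a @ g c # b)) = L1 a c b + L0 a c b"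
      by (cases a) (simp_all add: left_part_def L1_def L0_def)
    have right: "psign (?\<rho> a c) (right_part f (a @ g c # b)) = R1 a c b + R0 a c b"
      by (cases b rule: rev_cases)
        (auto simp: right_part_def R1_def R0_def butlast_append intro!: psign_cong)
    have merge: "psign (?\<rho> a c) (merge_sum f (a @ g c # b)) = MA a c b + MB a c b + J1 a c b + J2 a c b"
      unfolding merge_sum_append tail junction_def psign_add
      unfolding MA_def MB_def J1_def J2_def
      by (auto simp: psign_minus psign_def)
    show ?thesis
      unfolding hochschild_parts psign_add left right merge by (simp add: ac_simps)
  qed
  have HL: "left_part (cut3_sum \<pi>) w = cut3_sum L1 w"
  proof (cases w)
    case (Cons x v)
    have "x * cut3_sum \<pi> v = cut3_sum (\<lambda>a c b. x * \<pi> a c b) v"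
      by (rule cut3_sum_map[of "\<lambda>y. x * y"]) (simp_all add: distrib_left)
    also have "\<dots> = cut3_sum (\<lambda>a c b. L1 (x # a) c b) v"
      by (rule cut3_sum_cong) (auto simp: L1_def \<pi>_def psign_mult_right intro!: psign_cong)
    also have "\<dots> = cut3_sum L1 (x # v)"
      by (rule cut3_sum_Cons[symmetric]) (simp add: L1_def)
    finally show ?thesis by (simp add: Cons left_part_def)
  qed (simp add: left_part_def L1_def cut3_sum_def)
  have HR: "right_part (cut3_sum \<pi>) w = cut3_sum R1 w"
  proof (cases w rule: rev_cases)
    case (snoc v x)
    have "psign (int (length v) + 1) (cut3_sum \<pi> v * x) = cut3_sum (\<lambda>a c b. psign (int (length v) + 1) (\<pi> a c b * x)) v"
      by (rule cut3_sum_map[of "\<lambda>y. psign (int (length v) + 1) (y * x)"]) (simp_all add: distrib_right psign_add)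
    also have "\<dots> = cut3_sum (\<lambda>a c b. R1 a c (b @ [x])) v"
      by (rule cut3_sum_cong)
        (auto simp: R1_def \<pi>_def psign_mult_left intro!: psign_cong)
    also have "\<dots> = cut3_sum R1 w"
      by (simp add: snoc cut3_sum_snoc R1_def)
    finally show ?thesis by (simp add: snoc right_part_def add.commute)
  qed (simp add: right_part_def R1_def cut3_sum_def)
  have HM: "merge_sum (cut3_sum \<pi>) w = cut3_sum MA w + cut3_sum S1 w + cut3_sum S2 w + cut3_sum MB w"
  proof -
    have A: "merge_sum (\<lambda>a. \<pi> a c b) a = MA a c b" for a c b :: "'a list"
      unfolding \<pi>_def merge_sum_psign_length[of "\<lambda>l. int ((l + 1) * (length c + 1))"] MA_def
      by (cases a) simp_all
    have C: "psign (int (length a)) (merge_sum (\<lambda>c. \<pi> a c b) c) = S1 a c b + S2 a c b" for a c b :: "'a list"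
    proof (cases "c = []")
      case False
      then have len: "length c - 1 + 1 = length c" by (cases c) auto
      have slot: "f (a @ (- x + - psign k y) # b) = - f (a @ x # b) + - psign k (f (a @ y # b))" for x y k
        by (simp only: multilinear_add[OF f(1)] multilinear_minus[OF f(1)] multilinear_psign[OF f(1)])
      show ?thesis
        unfolding \<pi>_def merge_sum_psign_length[of "\<lambda>l. int ((length a + 1) * (l + 1))"] len
          merge_in_slot[OF f(1)] merge_cocycle[OF g] if_not_P[OF False] slot S1_def S2_def
        unfolding psign_add psign_psign psign_minus
        by (intro arg_cong2[where f = "(+)"] psign_cong) auto
    qed (simp add: S1_def S2_def)
    have B: "psign (int (length a) + int (length c)) (merge_sum (\<pi> a c) b) = MB a c b" for a c b :: "'a list"
      unfolding \<pi>_def merge_sum_psign MB_def by (auto intro!: psign_cong)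
    show ?thesis
      unfolding merge_sum_cut3 A B C cut3_sum_add by (simp add: ac_simps)
  qed
  have S1: "cut3_sum S1 w = cut3_sum J1 w"
  proof -
    define h where "h a x c b = psign (int ((length a + 1) * length c)) (f (a @ (x * g c) # b))" for a x c b
    have "cut3_sum J1 w = cut3_sum (\<lambda>a c b. if a = [] then 0 else h (butlast a) (last a) c b) w"
    proof (rule cut3_sum_cong)
      fix a c b
      show "J1 a c b = (if a = [] then 0 else h (butlast a) (last a) c b)"
        by (cases a rule: rev_cases) (auto simp: J1_def h_def intro!: psign_cong)
    qed
    also have "\<dots> = cut3_sum S1 w"
      unfolding cut3_sum_shift12
    proof (rule cut3_sum_cong)
      fix a c b
      show "(if c = [] then 0 else h a (hd c) (tl c) b) = S1 a c b"
        by (cases c) (auto simp: S1_def h_def intro!: psign_cong)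
    qed
    finally show ?thesis ..
  qed
  have S2: "cut3_sum S2 w = cut3_sum J2 w"
  proof -
    define h where "h a c x b = psign (int (length a * length c) + 1) (f (a @ (g c * x) # b))" for a c x b
    have "cut3_sum S2 w = cut3_sum (\<lambda>a c b. if c = [] then 0 else h a (butlast c) (last c) b) w"
    proof (rule cut3_sum_cong)
      fix a c b
      show "S2 a c b = (if c = [] then 0 else h a (butlast c) (last c) b)"
        by (cases c rule: rev_cases) (auto simp: S2_def h_def intro!: psign_cong)
    qed
    also have "\<dots> = cut3_sum J2 w"
      unfolding cut3_sum_shift23 by (rule cut3_sum_cong) (simp add: J2_def h_def)
    finally show ?thesis .
  qed
  have "0 = cut3_sum (\<lambda>a c b. psign (?\<rho> a c) (hochschild f (a @ g c # b))) w"
    by (simp add: f cut3_sum_def cut_sum_0)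
  also have "\<dots> = cut3_sum L0 w + cut3_sum R0 w + (left_part (cut3_sum \<pi>) w + merge_sum (cut3_sum \<pi>) w + right_part (cut3_sum \<pi>) w)"
    unfolding expand cut3_sum_add HL HR HM S1 S2 by (simp add: ac_simps)
  also have "cut3_sum L0 w = cup_product g f w"
    unfolding L0_def cut3_sum_Nil_1 cup_product_def ..
  also have "cut3_sum R0 w = cut_sum (\<lambda>a c. psign (int (length a * length c) + 1) (f a * g c)) w"
    unfolding R0_def cut3_sum_Nil_3 ..
  finally show ?thesis
    unfolding hochschild_parts[symmetric] \<pi>_def[abs_def] by simp
qed

theorem cup_graded_commutative:
  assumes f: "f \<in> cochains scale p" "hochschild f = 0" and g: "g \<in> cochains scale q" "hochschild g = 0"
  shows "cup_product g f - psign (p * q) (cup_product f g) \<in> coboundaries scale (p + q)"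
proof -
  define h where "h = cut3_sum (\<lambda>a c b. psign (int ((length a + 1) * (length c + 1))) (f (a @ g c # b)))"
  note flin = cochain_mlin[OF f(1)] and glin = cochain_mlin[OF g(1)]
  have "mlin h"
    unfolding h_def
  proof (rule mlin_cut3_sum)
    fix a b c :: "'a list"
    show "mlin (\<lambda>a. psign (int ((length a + 1) * (length b + 1))) (f (a @ g b # c)))"
      by (rule mlin_psign_length[of scale _ "\<lambda>l. (l + 1) * (length b + 1)"])
        (auto intro: multilinear_suffix[OF flin] vector_space_axioms)
    show "mlin (\<lambda>b. psign (int ((length a + 1) * (length b + 1))) (f (a @ g b # c)))"
      by (rule mlin_psign_length[of scale _ "\<lambda>l. (length a + 1) * (l + 1)"])
        (auto intro: mlin_comp flin glin vector_space_axioms)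
    show "mlin (\<lambda>c. psign (int ((length a + 1) * (length b + 1))) (f (a @ g b # c)))"
      using multilinear_prefix[OF flin, of "a @ [g b]"]
      by (intro mlin_psign_length[of scale _ "\<lambda>_. (length a + 1) * (length b + 1)"] vector_space_axioms) simp
  qed (rule vector_space_axioms)
  moreover have "h w = 0" if "int (length w) \<noteq> p + q - 1" for w
  proof -
    have "h w = cut3_sum (\<lambda>a c b. 0) w"
      unfolding h_def
    proof (rule cut3_sum_cong)
      fix a c b assume w: "a @ c @ b = w"
      show "psign (int ((length a + 1) * (length c + 1))) (f (a @ g c # b)) = 0"
      proof (cases "int (length c) = q")
        case True
        then have "int (length (a @ g c # b)) \<noteq> p" using that w by auto
        then show ?thesis using cochain_support[OF f(1)] by simp
      next
        case False
        then show ?thesis using cochain_support[OF g(1)] multilinear_0[OF flin] by simp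
      qed
    qed
    then show ?thesis by (simp add: cut3_sum_def cut_sum_0)
  qed
  ultimately have h: "h \<in> cochains scale (p + q - 1)"
    by (simp add: cochains_iff)
  have "(cup_product g f - psign (p * q) (cup_product f g)) w = hochschild (- h) w" for w
  proof -
    have "cut_sum (\<lambda>a c. psign (int (length a * length c) + 1) (f a * g c)) w
        = cut_sum (\<lambda>a c. psign (p * q + 1) (f a * g c)) w"
    proof (rule cut_sum_cong)
      fix a c
      show "psign (int (length a * length c) + 1) (f a * g c) = psign (p * q + 1) (f a * g c)"
        using cochain_support[OF f(1), of a] cochain_support[OF g(1), of c]
        by (cases "int (length a) = p"; cases "int (length c) = q") auto
    qed
    then have "cut_sum (\<lambda>a c. psign (int (length a * length c) + 1) (f a * g c)) w
        = - psign (p * q) (cup_product f g) w"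
      unfolding cup_product_def psign_apply cut_sum_psign cut_sum_minus[symmetric] minus_psign .
    then have "cup_product g f w + - psign (p * q) (cup_product f g) w + hochschild h w = 0"
      using graded_commutativity_length[OF flin f(2) g(2), of w] unfolding h_def by simp
    then show ?thesis
      by (simp add: hochschild_minus eq_neg_iff_add_eq_0)
  qed
  then show ?thesis
    using cochain.minus_closed[of h "p + q - 1"] h by (auto simp: coboundaries_def intro!: image_eqI[of _ _ "- h"])
qed

lemma gerstenhaber_circ_composition:
  assumes f: "f \<in> cochains scale (int p)" and g: "g \<in> cochains scale (int q)"
  shows "gerstenhaber_circ p q f g = composition f g"
proof
  fix w
  show "gerstenhaber_circ p q f g w = composition f g w"
  proof (cases "length w + 1 = p + q")
    case True
    have term0: "f (take i w @ g (take k (drop i w)) # drop k (drop i w)) = 0"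
      if "k \<noteq> q" "i \<le> length w" "k \<le> length w - i" for i k
      using that cochain_support[OF g, of "take k (drop i w)"] multilinear_0[OF cochain_mlin[OF f]] by simp
    have inner: "(\<Sum>k \<le> length w - i. psign (int (i * (k + 1))) (f (take i w @ g (take k (drop i w)) # drop k (drop i w))))
       = (if i < p then psign (int i * (int q - 1)) (f (take i w @ [g (take q (drop i w))] @ drop (i + q) w)) else 0)"
      if "i \<le> length w" for i
    proof (cases "i < p")
      case True
      have "(\<Sum>k \<le> length w - i. psign (int (i * (k + 1))) (f (take i w @ g (take k (drop i w)) # drop k (drop i w))))
        = (\<Sum>k \<in> {q}. psign (int (i * (k + 1))) (f (take i w @ g (take k (drop i w)) # drop k (drop i w))))"
      proof (rule sum.mono_neutral_right)
        show "\<forall>k \<in> {..length w - i} - {q}. psign (int (i * (k + 1)))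
            (f (take i w @ g (take k (drop i w)) # drop k (drop i w))) = 0"
          using term0[OF _ that] by simp
      qed (use \<open>length w + 1 = p + q\<close> True that in auto)
      then show ?thesis using True by (auto simp: add.commute intro!: psign_cong)
    next
      case False
      then show ?thesis
        using \<open>length w + 1 = p + q\<close> that term0[OF _ that] by (auto intro!: sum.neutral simp del: drop_drop)
    qed
    have "composition f g w = (\<Sum>i \<le> length w. \<Sum>k \<le> length w - i. psign (int (i * (k + 1)))
        (f (take i w @ g (take k (drop i w)) # drop k (drop i w))))"
      unfolding composition_def cut3_sum_def cut_sum_index
      by (intro sum.cong) (auto simp: min_def simp del: drop_drop)
    also have "\<dots> = (\<Sum>i \<le> length w. if i < p then psign (int i * (int q - 1))
        (f (take i w @ [g (take q (drop i w))] @ drop (i + q) w)) else 0)"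
      by (intro sum.cong refl inner) simp
    also have "\<dots> = (\<Sum>i \<in> {..<p}. psign (int i * (int q - 1))
        (f (take i w @ [g (take q (drop i w))] @ drop (i + q) w)))"
    proof -
      have "(\<Sum>i \<le> length w. if i < p then psign (int i * (int q - 1))
          (f (take i w @ [g (take q (drop i w))] @ drop (i + q) w)) else 0)
        = (\<Sum>i \<in> {..<p} \<inter> {..length w}. psign (int i * (int q - 1))
          (f (take i w @ [g (take q (drop i w))] @ drop (i + q) w)))"
        unfolding Int_commute[of "{..<p}"] by (subst sum.inter_restrict) simp_all
      also have "\<dots> = (\<Sum>i \<in> {..<p}. psign (int i * (int q - 1))
          (f (take i w @ [g (take q (drop i w))] @ drop (i + q) w)))"
      proof (rule sum.mono_neutral_left)
        show "\<forall>i \<in> {..<p} - {..<p} \<inter> {..length w}. psign (int i * (int q - 1))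
          (f (take i w @ [g (take q (drop i w))] @ drop (i + q) w)) = 0"
        proof
          fix i assume i: "i \<in> {..<p} - {..<p} \<inter> {..length w}"
          then have "q = 0" "i = p - 1" "length w = p - 1" using True by auto
          then show "psign (int i * (int q - 1)) (f (take i w @ [g (take q (drop i w))] @ drop (i + q) w)) = 0"
            using i by auto
        qed
      qed auto
      finally show ?thesis .
    qed
    also have "\<dots> = gerstenhaber_circ p q f g w"
      unfolding gerstenhaber_circ_def using True
      by simp (rule sum.reindex_bij_witness[of _ "\<lambda>i. i - 1" Suc], auto simp: add.commute)
    finally show ?thesis ..
  next
    case False
    have "composition f g w = cut3_sum (\<lambda>a c b. 0) w"
      unfolding composition_def
    proof (rule cut3_sum_cong)
      fix a c b assume w: "a @ c @ b = w"
      show "psign (int (length a * (length c + 1))) (f (a @ g c # b)) = 0"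
      proof (cases "length c = q")
        case True
        then have "int (length (a @ g c # b)) \<noteq> int p" using False w by auto
        then show ?thesis using cochain_support[OF f] by simp
      next
        case False
        then show ?thesis using cochain_support[OF g] multilinear_0[OF cochain_mlin[OF f]] by simp
      qed
    qed
    then show ?thesis using False by (simp add: gerstenhaber_circ_def cut3_sum_def cut_sum_0)
  qed
qed

end

section \<open>Half of the rotations of a cup product\<close>

text \<open>The arguments are the lengths of the four factors. The first sign belongs to the summands of the cocycle identity of \<open>f\<close>,
  the second one to the summands of the homotopy whose differential is compared with it. Up to a common sign they are determined by two requirements: the outer
  multiplications telescope, and a merge inside \<open>a\<close>, \<open>b\<close> or \<open>d\<close> has the same sign in the identity and in the differential.\<close>

definition boundary_sign :: "nat \<Rightarrow> nat \<Rightarrow> nat \<Rightarrow> nat \<Rightarrow> int" where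
  "boundary_sign a b c d = int (a * (a + b + d) + (a + b) * (c + 1))"

definition homotopy_sign :: "nat \<Rightarrow> nat \<Rightarrow> nat \<Rightarrow> nat \<Rightarrow> int" where
  "homotopy_sign a b c d = int (a + a * (a + b + 1 + d) + (a + b + 1) * (c + 1))"

context algebra_with_inner_product
begin

text \<open>The terms of \<open>\<Delta>(f g)\<close> in which the last letter of the word is an argument of \<open>f\<close>: it is the last letter of the
  nonempty factor \<open>d\<close>.\<close>

definition half_rotation :: "'a cochain \<Rightarrow> 'a cochain \<Rightarrow> 'a list \<Rightarrow> 'k" where
  "half_rotation f g = cut3_sum (\<lambda>a c d. if d = [] then 0
     else psign (int ((length a + length c + 1) * (length a + length c + length d - 1)))
       (ip (f (d @ a)) (g c)))"

text \<open>As in \<open>half_rotation\<close>, but \<open>g\<close> is inserted into \<open>f\<close>. In the cyclic word, cut open between \<open>a\<close> and \<open>b\<close>, the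
  value of \<open>g\<close> precedes the last letter of the original word, which is the last letter of \<open>d\<close>.\<close>

definition rotation_homotopy :: "'a cochain \<Rightarrow> 'a cochain \<Rightarrow> 'a list \<Rightarrow> 'k" where
  "rotation_homotopy f g = cut4_sum (\<lambda>a b c d. if d = [] then 0
     else psign (homotopy_sign (length a) (length b) (length c) (length d))
       (ip (f (b @ g c # d @ a)) unit))"

lemma form_unit: "form f (z @ [unit]) = ip (f z) unit"
  by (rule form_snoc)

lemma mform_ip: "mlin f \<Longrightarrow> mform (\<lambda>z. ip (f z) x)"
  by (simp add: multilinear_def ip_add_left ip_scale_left)

text \<open>The cocycle identity of \<open>f\<close>, paired with the unit, is summed over all rotated words in which the factor \<open>c\<close> is replaced by \<open>g c\<close>
  and this value precedes the last letter \<open>z\<close>. An outer multiplication with a letter \<open>x\<close> cancels against the one for the rotation in which \<open>x\<close> has moved to the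
  other end. The exceptions are the words that begin with \<open>g c\<close> (first sum) or end with \<open>z\<close> (second sum). The merges form the
  differential of the homotopy as in \<open>graded_commutativity_length\<close>. The exception is the product of \<open>g c\<close> with \<open>z\<close> (third sum), for which the
  homotopy has no counterpart because \<open>z\<close> is never an argument of \<open>g\<close>.\<close>

lemma rotation_homotopy_identity:
  assumes f: "mlin f" "hochschild f = 0" and g: "hochschild g = 0"
  shows "cut3_sum (\<lambda>a c d. if d = [] then 0 else
        psign (int (length a * (length c + length d))) (ip (f (d @ a)) (g c))) (L @ [z])
    + cut3_sum (\<lambda>b c d. psign (int (length b * (length c + 1) + length b + length d))
        (ip (f (b @ g c # d)) z)) L
    + cut3_sum (\<lambda>a b c. psign (int (length a * length b + length a + 1 + (length a + length b) * length c))
        (ip (f (b @ (g c * z) # a)) unit)) L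
    + cyclic_differential (rotation_homotopy f g) (L @ [z]) = 0"
proof -
  let ?M = "L @ [z]"
  let ?F = "\<lambda>w. ip (f w) unit"
  let ?s = "\<lambda>a b c d. boundary_sign (length a) (length b) (length c) (length d)"
  let ?t = "\<lambda>a b c d. homotopy_sign (length a) (length b) (length c) (length d)"
  note sign_defs = boundary_sign_def homotopy_sign_def
  have F: "mform ?F" by (rule mform_ip[OF f(1)])
  define \<psi> where "\<psi> a b c d = (if d = [] then 0 else psign (?t a b c d) (?F (b @ g c # d @ a)))"
    for a b c d :: "'a list"
  \<comment> \<open>\<open>T1\<close> and \<open>T2\<close>: outer multiplications, which telescope; \<open>Z0\<close>, \<open>FG\<close>, \<open>DG\<close>: the three exceptional sums;
    \<open>M\<close>, \<open>J\<close>, \<open>S\<close>: merges inside a factor, merges of neighbouring factors, and merges inside \<open>c\<close> rewritten by the cocycle identity of \<open>g\<close>\<close>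
  define T1 where "T1 a b c d = (if b = [] then 0 else if d = [] then 0 else
      psign (?s a b c d) (form f (tl b @ g c # d @ a @ [hd b])))" for a b c d :: "'a list"
  define T2 where "T2 a b c d = (if a = [] then 0 else if d = [] then 0 else
      psign (?s a b c d + int (length b + length d + length a + 1)) (form f (b @ g c # d @ butlast a @ [last a])))"
    for a b c d :: "'a list"
  define Z0 where "Z0 a b c d = (if b = [] then if d = [] then 0 else
      psign (int (length a * (length c + length d))) (ip (f (d @ a)) (g c)) else 0)" for a b c d :: "'a list"
  define FG where "FG a b c d = (if a = [] then if d = [] then 0 else
      psign (int (length b * (length c + 1) + length b + length d + 1)) (ip (f (b @ g c # butlast d)) (last d)) else 0)"
    for a b c d :: "'a list"
  define DG where "DG a b c d = (if d = [] then 0 else if tl d = [] then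
      psign (?s a b c d + int (length b) + 1) (?F (b @ (g c * hd d) # a)) else 0)" for a b c d :: "'a list"
  define MA where "MA a b c d = (if d = [] then 0 else
      psign (?s a b c d + int (length b + 1 + length d)) (merge_sum (\<lambda>w. ?F (b @ g c # d @ w)) a))"
    for a b c d :: "'a list"
  define MB where "MB a b c d = (if d = [] then 0 else
      psign (?s a b c d) (merge_sum (\<lambda>w. ?F (w @ g c # d @ a)) b))" for a b c d :: "'a list"
  define MD where "MD a b c d = (if d = [] then 0 else
      psign (?s a b c d + int (length b) + 1) (merge_sum (\<lambda>w. ?F (b @ g c # w @ a)) d))" for a b c d :: "'a list"
  define J1 where "J1 a b c d = (if b = [] then 0 else if d = [] then 0 else
      psign (?s a b c d + int (length b)) (?F (butlast b @ (last b * g c) # d @ a)))" for a b c d :: "'a list"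
  define J2 where "J2 a b c d = (if d = [] then 0 else if tl d = [] then 0 else
      psign (?s a b c d + int (length b) + 1) (?F (b @ (g c * hd d) # tl d @ a)))" for a b c d :: "'a list"
  define J3 where "J3 a b c d = (if a = [] then 0 else if d = [] then 0 else
      psign (?s a b c d + int (length b + 1 + length d)) (?F (b @ g c # butlast d @ (last d * hd a) # tl a)))"
    for a b c d :: "'a list"
  define S1 where "S1 a b c d = (if c = [] then 0 else if d = [] then 0 else
      psign (int (length a + length b) + ?t a b (tl c) d + 1) (?F (b @ (hd c * g (tl c)) # d @ a)))"
    for a b c d :: "'a list"
  define S2 where "S2 a b c d = (if c = [] then 0 else if d = [] then 0 else
      psign (int (length a + length b + length c) + ?t a b (butlast c) d + 1) (?F (b @ (g (butlast c) * last c) # d @ a)))"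
    for a b c d :: "'a list"
  have expand: "(if d = [] then 0 else psign (?s a b c d) (form (hochschild f) ((b @ g c # d @ a) @ [unit])))
      = T1 a b c d + T2 a b c d + Z0 a b c d + FG a b c d + DG a b c d + MA a b c d + MB a b c d + MD a b c d
        + J1 a b c d + J2 a b c d + J3 a b c d" for a b c d
  proof (cases "d = []")
    case True
    then show ?thesis
      by (simp add: T1_def T2_def Z0_def FG_def DG_def MA_def MB_def MD_def J1_def J2_def J3_def)
  next
    case d: False
    let ?w = "b @ g c # d @ a"
    have rot: "psign (?s a b c d) (form f (rotate1 ?w)) = T1 a b c d + Z0 a b c d"
    proof (cases b)
      case Nil
      then show ?thesis using d form_snoc[of f "d @ a" "g c"]
        by (auto simp: T1_def Z0_def boundary_sign_def intro!: psign_cong)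
    next
      case (Cons x b')
      then show ?thesis using d by (simp add: T1_def Z0_def)
    qed
    have last: "psign (?s a b c d) (psign (int (length ?w)) (form f ?w)) = T2 a b c d + FG a b c d"
    proof (cases a rule: rev_cases)
      case Nil
      then show ?thesis using d form_snoc[of f "b @ g c # butlast d" "last d"]
        by (auto simp: T2_def FG_def boundary_sign_def intro!: psign_cong)
    next
      case (snoc a' x)
      then show ?thesis using d
        by (auto simp: T2_def FG_def boundary_sign_def intro!: psign_cong)
    qed
    have tail: "merge_sum (\<lambda>w. ?F (b @ w)) (g c # d @ a) =
        - ?F (b @ (g c * hd d) # tl d @ a) + - merge_sum (\<lambda>w. ?F (b @ g c # w)) (d @ a)"
      using d by (cases d) simp_all
    have J1: "psign (?s a b c d + int (length b)) (junction ?F b (g c # d @ a)) = J1 a b c d"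
      using d by (simp add: J1_def junction_def)
    have J2: "psign (?s a b c d + int (length b)) (- ?F (b @ (g c * hd d) # tl d @ a)) = J2 a b c d + DG a b c d"
      using d by (auto simp: J2_def DG_def psign_minus)
    have J3: "psign (?s a b c d + int (length b) + 1 + int (length d)) (junction (\<lambda>w. ?F (b @ g c # w)) d a) = J3 a b c d"
      using d by (auto simp: J3_def junction_def ac_simps)
    have "psign (?s a b c d) (merge_sum ?F ?w) = MB a b c d + (J2 a b c d + DG a b c d)
        + (MD a b c d + MA a b c d + J3 a b c d) + J1 a b c d"
      unfolding merge_sum_append[of _ b] tail merge_sum_append[of _ d] minus_psign psign_add psign_psign
      unfolding J1[symmetric] J2[symmetric] J3[symmetric]
      unfolding MA_def MB_def MD_def
      using d by (simp add: psign_minus psign_add ac_simps del: minus_add_distrib)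
    then have merge: "psign (?s a b c d) (merge_sum (\<lambda>w. form f (w @ [unit])) ?w) = MB a b c d + (J2 a b c d + DG a b c d)
        + (MD a b c d + MA a b c d + J3 a b c d) + J1 a b c d"
      unfolding form_unit .
    have ne: "?w \<noteq> []" by simp
    show ?thesis
      unfolding form_hochschild cyclic_differential_unit_right[OF ne] psign_add rot last merge
      using d by (simp add: ac_simps)
  qed
  have H: "rotation_homotopy f g = cut4_sum \<psi>"
    unfolding rotation_homotopy_def \<psi>_def ..
  have merge_H: "merge_sum (cut4_sum \<psi>) ?M = cut4_sum MA ?M + cut4_sum MB ?M + cut4_sum MD ?M
      + cut4_sum S1 ?M + cut4_sum S2 ?M"
  proof -
    have A: "merge_sum (\<lambda>a. \<psi> a b c d) a = MA a b c d" for a b c d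
    proof (cases "d = [] \<or> a = []")
      case True
      then show ?thesis by (auto simp: \<psi>_def MA_def)
    next
      case False
      then obtain x a' where a: "a = x # a'" by (cases a) auto
      show ?thesis
        using False merge_sum_psign_length[of "\<lambda>l. homotopy_sign l (length b) (length c) (length d)" "\<lambda>a. ?F (b @ g c # d @ a)" a]
        by (simp add: \<psi>_def MA_def) (auto simp: a sign_defs intro!: psign_cong)
    qed
    have B: "psign (int (length a)) (merge_sum (\<lambda>b. \<psi> a b c d) b) = MB a b c d" for a b c d
    proof (cases "d = [] \<or> b = []")
      case True
      then show ?thesis by (auto simp: \<psi>_def MB_def)
    next
      case False
      then obtain x b' where b: "b = x # b'" by (cases b) auto
      show ?thesis
        using False merge_sum_psign_length[of "\<lambda>l. homotopy_sign (length a) l (length c) (length d)" "\<lambda>b. ?F (b @ g c # d @ a)" b]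
        by (simp add: \<psi>_def MB_def) (auto simp: b sign_defs intro!: psign_cong)
    qed
    have C: "psign (int (length a) + int (length b)) (merge_sum (\<lambda>c. \<psi> a b c d) c) = S1 a b c d + S2 a b c d" for a b c d
    proof (cases "d = [] \<or> c = []")
      case True
      then show ?thesis by (auto simp: \<psi>_def S1_def S2_def)
    next
      case False
      then have c: "c \<noteq> []" and d: "d \<noteq> []" by auto
      have slot: "?F (b @ (- x + - psign k y) # v) = - ?F (b @ x # v) + - psign k (?F (b @ y # v))" for x y k v
        by (simp only: multilinear_add[OF F] multilinear_minus[OF F] multilinear_psign[OF F])
      have "merge_sum (\<lambda>c. ?F (b @ g c # d @ a)) c = ?F (b @ merge_sum g c # d @ a)"
        using multilinear_add[OF F] multilinear_0[OF F]
        by (intro merge_sum_map[of "\<lambda>x. ?F (b @ x # d @ a)"]) simp_all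
      then have "merge_sum (\<lambda>c. ?F (b @ g c # d @ a)) c = - ?F (b @ (hd c * g (tl c)) # d @ a)
          + - psign (int (length c)) (?F (b @ (g (butlast c) * last c) # d @ a))"
        unfolding merge_cocycle[OF g] if_not_P[OF c] slot .
      then have "merge_sum (\<lambda>c. \<psi> a b c d) c = psign (homotopy_sign (length a) (length b) (length c - 1) (length d))
          (- ?F (b @ (hd c * g (tl c)) # d @ a) + - psign (int (length c)) (?F (b @ (g (butlast c) * last c) # d @ a)))"
        using d merge_sum_psign_length[of "\<lambda>l. homotopy_sign (length a) (length b) l (length d)" "\<lambda>c. ?F (b @ g c # d @ a)" c]
        by (simp add: \<psi>_def)
      then show ?thesis
        unfolding S1_def S2_def if_not_P[OF c] if_not_P[OF d]
        by (simp only: psign_add psign_psign psign_minus length_tl length_butlast)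
          (intro arg_cong2[where f = "(+)"] psign_cong; auto)
    qed
    have D: "psign (int (length a) + int (length b) + int (length c)) (merge_sum (\<psi> a b c) d) = MD a b c d" for a b c d
    proof (cases "length d < 2")
      case True
      then show ?thesis by (cases d; cases "tl d") (auto simp: \<psi>_def MD_def)
    next
      case False
      then obtain x y d' where d: "d = x # y # d'" by (cases d; cases "tl d") auto
      have "merge_sum (\<psi> a b c) d = merge_sum (\<lambda>d. psign (homotopy_sign (length a) (length b) (length c) (length d)) (?F (b @ g c # d @ a))) d"
        by (rule merge_sum_cong) (auto simp: \<psi>_def d)
      then show ?thesis
        using merge_sum_psign_length[of "\<lambda>l. homotopy_sign (length a) (length b) (length c) l" "\<lambda>d. ?F (b @ g c # d @ a)" d]
        by (simp add: MD_def d del: merge_sum.simps) (auto simp: sign_defs simp del: merge_sum.simps intro!: psign_cong)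
    qed
    show ?thesis
      unfolding merge_sum_cut4 A B C D cut4_sum_add by (simp add: ac_simps)
  qed
  have wrap_H: "wrap (cut4_sum \<psi>) ?M = cut4_sum J3 ?M"
  proof (cases L)
    case Nil
    have "cut4_sum J3 ([] @ [z]) = cut4_sum (\<lambda>a b c d. J3 a b c (d @ [z])) []"
      by (rule cut4_sum_snoc) (simp add: J3_def)
    then show ?thesis
      by (simp add: Nil wrap_def cut4_sum_def cut3_sum_def J3_def)
  next
    case (Cons x N)
    have "cut4_sum J3 (x # N @ [z]) = cut4_sum (\<lambda>a b c d. J3 (x # a) b c d) (N @ [z])"
      by (rule cut4_sum_Cons) (simp add: J3_def)
    also have "\<dots> = cut4_sum (\<lambda>a b c d. J3 (x # a) b c (d @ [z])) N"
      by (rule cut4_sum_snoc) (simp add: J3_def)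
    also have "\<dots> = cut4_sum (\<lambda>a b c d. \<psi> a b c (d @ [z * x])) N"
      by (rule cut4_sum_cong) (auto simp: J3_def \<psi>_def sign_defs intro!: psign_cong)
    also have "\<dots> = cut4_sum \<psi> (N @ [z * x])"
      by (rule cut4_sum_snoc[symmetric]) (simp add: \<psi>_def)
    finally show ?thesis by (simp add: Cons wrap_def)
  qed
  have T: "cut4_sum T1 ?M + cut4_sum T2 ?M = 0"
  proof -
    define h where "h a x b c d = (if d = [] then 0 else psign (boundary_sign (length a + 1) (length b) (length c) (length d)
        + int (length b + length d + length a)) (form f (b @ g c # d @ a @ [x])))" for a x b c and d :: "'a list"
    have "cut4_sum T2 ?M = cut4_sum (\<lambda>a b c d. if a = [] then 0 else h (butlast a) (last a) b c d) ?M"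
    proof (rule cut4_sum_cong)
      fix a b c d
      show "T2 a b c d = (if a = [] then 0 else h (butlast a) (last a) b c d)"
        by (cases a rule: rev_cases) (auto simp: T2_def h_def intro!: psign_cong)
    qed
    also have "\<dots> = cut4_sum (\<lambda>a b c d. if b = [] then 0 else h a (hd b) (tl b) c d) ?M"
      by (rule cut4_sum_shift12)
    also have "\<dots> = cut4_sum (\<lambda>a b c d. - T1 a b c d) ?M"
    proof (rule cut4_sum_cong)
      fix a b c d
      show "(if b = [] then 0 else h a (hd b) (tl b) c d) = - T1 a b c d"
        by (cases b) (auto simp: T1_def h_def minus_psign sign_defs intro!: psign_cong)
    qed
    also have "\<dots> = - cut4_sum T1 ?M"
      by (rule cut4_sum_map[symmetric]) simp_all
    finally show ?thesis by simp
  qed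
  have S1: "cut4_sum S1 ?M = cut4_sum J1 ?M"
  proof -
    define h where "h a b x c d = (if d = [] then 0 else psign (boundary_sign (length a) (length b + 1) (length c) (length d)
        + int (length b) + 1) (?F (b @ (x * g c) # d @ a)))" for a b x c and d :: "'a list"
    have "cut4_sum J1 ?M = cut4_sum (\<lambda>a b c d. if b = [] then 0 else h a (butlast b) (last b) c d) ?M"
    proof (rule cut4_sum_cong)
      fix a b c d
      show "J1 a b c d = (if b = [] then 0 else h a (butlast b) (last b) c d)"
        by (cases b rule: rev_cases) (auto simp: J1_def h_def intro!: psign_cong)
    qed
    also have "\<dots> = cut4_sum (\<lambda>a b c d. if c = [] then 0 else h a b (hd c) (tl c) d) ?M"
      by (rule cut4_sum_shift23)
    also have "\<dots> = cut4_sum S1 ?M"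
    proof (rule cut4_sum_cong)
      fix a b c d
      show "(if c = [] then 0 else h a b (hd c) (tl c) d) = S1 a b c d"
        by (cases c) (auto simp: S1_def h_def sign_defs intro!: psign_cong)
    qed
    finally show ?thesis ..
  qed
  have S2: "cut4_sum S2 ?M = cut4_sum J2 ?M"
  proof -
    define h where "h a b c x d = (if d = [] then 0 else psign (boundary_sign (length a) (length b) (length c) (length d + 1)
        + int (length b) + 1) (?F (b @ (g c * x) # d @ a)))" for a b c x and d :: "'a list"
    have "cut4_sum S2 ?M = cut4_sum (\<lambda>a b c d. if c = [] then 0 else h a b (butlast c) (last c) d) ?M"
    proof (rule cut4_sum_cong)
      fix a b c d
      show "S2 a b c d = (if c = [] then 0 else h a b (butlast c) (last c) d)"
        by (cases c rule: rev_cases) (auto simp: S2_def h_def sign_defs intro!: psign_cong)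
    qed
    also have "\<dots> = cut4_sum (\<lambda>a b c d. if d = [] then 0 else h a b c (hd d) (tl d)) ?M"
      by (rule cut4_sum_shift34)
    also have "\<dots> = cut4_sum J2 ?M"
    proof (rule cut4_sum_cong)
      fix a b c d
      show "(if d = [] then 0 else h a b c (hd d) (tl d)) = J2 a b c d"
        by (cases d) (auto simp: J2_def h_def intro!: psign_cong)
    qed
    finally show ?thesis .
  qed
  have Z: "cut4_sum Z0 ?M = cut3_sum (\<lambda>a c d. if d = [] then 0 else
        psign (int (length a * (length c + length d))) (ip (f (d @ a)) (g c))) ?M"
    unfolding Z0_def by (rule cut4_sum_Nil_2)
  have FG: "cut4_sum FG ?M = cut3_sum (\<lambda>b c d. psign (int (length b * (length c + 1) + length b + length d))
        (ip (f (b @ g c # d)) z)) L"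
  proof -
    have "cut4_sum FG ?M = cut3_sum (\<lambda>b c d. if d = [] then 0 else psign (int (length b * (length c + 1) + length b + length d + 1))
        (ip (f (b @ g c # butlast d)) (last d))) ?M"
      unfolding FG_def by (rule cut4_sum_Nil_1)
    also have "\<dots> = cut3_sum (\<lambda>b c d. if d @ [z] = [] then 0 else psign (int (length b * (length c + 1) + length b + length (d @ [z]) + 1))
        (ip (f (b @ g c # butlast (d @ [z]))) (last (d @ [z])))) L"
      by (rule cut3_sum_snoc) simp
    also have "\<dots> = cut3_sum (\<lambda>b c d. psign (int (length b * (length c + 1) + length b + length d))
        (ip (f (b @ g c # d)) z)) L"
      by (rule cut3_sum_cong) (auto intro!: psign_cong)
    finally show ?thesis .
  qed
  have DG: "cut4_sum DG ?M = cut3_sum (\<lambda>a b c. psign (int (length a * length b + length a + 1 + (length a + length b) * length c))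
        (ip (f (b @ (g c * z) # a)) unit)) L"
  proof -
    have "cut4_sum DG ?M = cut4_sum (\<lambda>a b c d. DG a b c (d @ [z])) L"
      by (rule cut4_sum_snoc) (simp add: DG_def)
    also have "\<dots> = cut4_sum (\<lambda>a b c d. if d = [] then psign (int (length a * length b + length a + 1 + (length a + length b) * length c))
        (ip (f (b @ (g c * z) # a)) unit) else 0) L"
    proof (rule cut4_sum_cong)
      fix a b c d
      show "DG a b c (d @ [z]) = (if d = [] then psign (int (length a * length b + length a + 1 + (length a + length b) * length c))
        (ip (f (b @ (g c * z) # a)) unit) else 0)"
        by (cases d) (auto simp: DG_def sign_defs intro!: psign_cong)
    qed
    finally show ?thesis unfolding cut4_sum_Nil_4 .
  qed
  have "0 = cut4_sum (\<lambda>a b c d. if d = [] then 0 else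
      psign (?s a b c d) (form (hochschild f) ((b @ g c # d @ a) @ [unit]))) ?M"
    unfolding form_unit by (simp add: f(2) cut4_sum_def cut3_sum_def cut_sum_0)
  also have "\<dots> = (cut4_sum T1 ?M + cut4_sum T2 ?M) + cut4_sum Z0 ?M + cut4_sum FG ?M + cut4_sum DG ?M
      + (merge_sum (cut4_sum \<psi>) ?M + wrap (cut4_sum \<psi>) ?M)"
    unfolding expand cut4_sum_add merge_H wrap_H S1 S2 by (simp add: ac_simps)
  finally show ?thesis
    unfolding T Z FG DG H cyclic_differential_def by simp
qed

lemma mform_rotation_homotopy:
  assumes f: "mlin f" and g: "mlin g"
  shows "mform (rotation_homotopy f g)"
  unfolding rotation_homotopy_def
proof (rule mlin_cut4_sum[OF _ _ _ _ vector_space_field])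
  let ?F = "\<lambda>w. ip (f w) unit"
  have F: "mform ?F" by (rule mform_ip[OF f])
  have mult: "k * psign s x = psign s (k * x)" for k x :: 'k and s
    by (rule psign_mult_right)
  note F_slot = multilinear_add[OF F] multilinear_scale[OF F]
  fix a b c d :: "'a list"
  note a_slot = multilinear_add[OF F, of "b @ g c # d @ u" for u, simplified]
    multilinear_scale[OF F, of "b @ g c # d @ u" for u, simplified]
  note d_slot = multilinear_add[OF F, of "b @ g c # u" for u, simplified]
    multilinear_scale[OF F, of "b @ g c # u" for u, simplified]
  show "mform (\<lambda>a. if d = [] then 0 else psign (homotopy_sign (length a) (length b) (length c) (length d)) (?F (b @ g c # d @ a)))"
    by (simp add: multilinear_def a_slot psign_add mult)
  show "mform (\<lambda>b. if d = [] then 0 else psign (homotopy_sign (length a) (length b) (length c) (length d)) (?F (b @ g c # d @ a)))"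
    by (simp add: multilinear_def F_slot psign_add mult)
  show "mform (\<lambda>c. if d = [] then 0 else psign (homotopy_sign (length a) (length b) (length c) (length d)) (?F (b @ g c # d @ a)))"
    by (simp add: multilinear_def F_slot multilinear_add[OF g] multilinear_scale[OF g] psign_add mult)
  show "mform (\<lambda>d. if d = [] then 0 else psign (homotopy_sign (length a) (length b) (length c) (length d)) (?F (b @ g c # d @ a)))"
    by (simp add: multilinear_def d_slot psign_add mult)
qed

lemma rotation_homotopy_support:
  assumes f: "f \<in> cochains scale p" and g: "g \<in> cochains scale q" and M: "int (length M) \<noteq> p + q - 1"
  shows "rotation_homotopy f g M = 0"
proof -
  have "rotation_homotopy f g M = cut4_sum (\<lambda>a b c d. 0) M"
    unfolding rotation_homotopy_def
  proof (rule cut4_sum_cong)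
    fix a b c d assume abcd: "a @ b @ c @ d = M"
    have "f (b @ g c # d @ a) = 0"
    proof (cases "int (length c) = q")
      case True
      then have "int (length (b @ g c # d @ a)) \<noteq> p" using M abcd by auto
      then show ?thesis by (rule cochain_support[OF f])
    next
      case False
      then show ?thesis
        using cochain_support[OF g] multilinear_0[OF cochain_mlin[OF f]] by simp
    qed
    then show "(if d = [] then 0 else psign (homotopy_sign (length a) (length b) (length c) (length d))
        (ip (f (b @ g c # d @ a)) unit)) = 0" by simp
  qed
  then show ?thesis by (simp add: cut4_sum_def cut3_sum_def cut_sum_0)
qed

lemma form_cup_Delta:
  assumes "mlin f"
  shows "form (cup_product (Delta unit ip f) g) (L @ [z]) =
    cut3_sum (\<lambda>a b c. psign (int ((length a + 1) * (length a + length b))) (ip (f (b @ (g c * z) # a)) unit)) L"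
proof -
  have "form (cup_product (Delta unit ip f) g) (L @ [z]) = ip (cut_sum (\<lambda>x y. Delta unit ip f x * g y) L) z"
    by (simp add: form_snoc cup_product_def)
  also have "\<dots> = cut_sum (\<lambda>x y. form (Delta unit ip f) (x @ [g y * z])) L"
    by (subst cut_sum_map[of "\<lambda>x. ip x z"]) (simp_all add: ip_add_left ip_invariant form_snoc)
  also have "\<dots> = cut_sum (\<lambda>x y. cut_sum (\<lambda>a b. psign (int ((length a + 1) * (length a + length b)))
      (ip (f (b @ (g y * z) # a)) unit)) x) L"
    unfolding form_Delta[OF assms] rotation_sum_cut cut_sum_snoc form_unit
    by (simp add: algebra_simps)
  finally show ?thesis by (simp add: cut3_sum_assoc)
qed

text \<open>For cochains of fixed degrees the three sums of \<open>rotation_homotopy_identity\<close> are, up to sign, half of the rotations, the composition and the product with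
  \<open>\<Delta> f\<close>.\<close>

lemma half_rotation_cohomologous:
  assumes f: "f \<in> cochains scale p" "hochschild f = 0" and g: "g \<in> cochains scale q" "hochschild g = 0"
  shows "\<exists>h \<in> cochains scale (p + q - 2). \<forall>M. half_rotation f g M =
    form (cup_product (Delta unit ip f) g - psign ((p + 1) * q) (composition f g) + hochschild h) M"
proof
  let ?s = "(p + 1) * (q + 1)"
  let ?h = "cochain_of (rotation_homotopy f g)"
  note flin = cochain_mlin[OF f(1)] and glin = cochain_mlin[OF g(1)]
  have h: "?h \<in> cochains scale (p + q - 2)"
    by (rule cochain_of_cochains[OF mform_rotation_homotopy[OF flin glin]])
      (rule rotation_homotopy_support[OF f(1) g(1)], simp)
  then show "psign (?s + 1) ?h \<in> cochains scale (p + q - 2)"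
    using cochain.psign_closed[of ?h "p + q - 2"] by simp
  have "rotation_homotopy f g [] = 0"
    by (simp add: rotation_homotopy_def cut4_sum_def cut3_sum_def)
  then have form_h: "form ?h = rotation_homotopy f g"
    using form_cochain_of[OF mform_rotation_homotopy[OF flin glin]] by (intro ext) (metis form_Nil)
  have f_zero: "f w = 0" if "int (length w) \<noteq> p" for w
    using cochain_support[OF f(1) that] .
  have g_zero: "f (u @ g c # v) = 0" "f (u @ (g c * x) # v) = 0" "ip y (g c) = 0" if "int (length c) \<noteq> q" for u c v x y
    using cochain_support[OF g(1) that] multilinear_0[OF flin] by simp_all
  show "\<forall>M. half_rotation f g M = form (cup_product (Delta unit ip f) g
      - psign ((p + 1) * q) (composition f g) + hochschild (psign (?s + 1) ?h)) M"
  proof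
    fix M
    show "half_rotation f g M = form (cup_product (Delta unit ip f) g
      - psign ((p + 1) * q) (composition f g) + hochschild (psign (?s + 1) ?h)) M"
    proof (cases M rule: rev_cases)
      case Nil
      then show ?thesis by (simp add: half_rotation_def cut3_sum_def)
    next
      case (snoc L z)
      have Z: "cut3_sum (\<lambda>a c d. if d = [] then 0 else
          psign (int (length a * (length c + length d))) (ip (f (d @ a)) (g c))) M = psign ?s (half_rotation f g M)"
        unfolding half_rotation_def cut3_sum_map[of "psign ?s", OF psign_zero psign_add]
      proof (rule cut3_sum_cong)
        fix a c d :: "'a list"
        show "(if d = [] then 0 else psign (int (length a * (length c + length d))) (ip (f (d @ a)) (g c)))
          = psign ?s (if d = [] then 0 else psign (int ((length a + length c + 1) * (length a + length c + length d - 1)))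
              (ip (f (d @ a)) (g c)))"
        proof (cases "d = [] \<or> int (length c) \<noteq> q \<or> int (length (d @ a)) \<noteq> p")
          case True
          then show ?thesis using f_zero[of "d @ a"] g_zero(3) by auto
        next
          case False
          then obtain x d' where d: "d = x # d'" by (cases d) auto
          have "q = int (length c)" "p = int (length d') + 1 + int (length a)" using False d by auto
          then show ?thesis by (auto simp: d intro!: psign_cong)
        qed
      qed
      have C: "cut3_sum (\<lambda>b c d. psign (int (length b * (length c + 1) + length b + length d)) (ip (f (b @ g c # d)) z)) L
          = psign (p + 1) (form (composition f g) M)"
      proof -
        have "psign (p + 1) (form (composition f g) M)
          = cut3_sum (\<lambda>b c d. psign (p + 1) (ip (psign (int (length b * (length c + 1))) (f (b @ g c # d))) z)) L"
          unfolding snoc form_snoc composition_def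
          by (rule cut3_sum_map[of "\<lambda>x. psign (p + 1) (ip x z)"]) (simp_all add: ip_add_left psign_add)
        also have "\<dots> = cut3_sum (\<lambda>b c d. psign (int (length b * (length c + 1) + length b + length d)) (ip (f (b @ g c # d)) z)) L"
        proof (rule cut3_sum_cong)
          fix b c d :: "'a list"
          show "psign (p + 1) (ip (psign (int (length b * (length c + 1))) (f (b @ g c # d))) z)
            = psign (int (length b * (length c + 1) + length b + length d)) (ip (f (b @ g c # d)) z)"
          proof (cases "int (length (b @ g c # d)) = p")
            case True
            then have "p = int (length b) + 1 + int (length d)" by simp
            then show ?thesis by (auto simp: ip_psign_left intro!: psign_cong)
          qed (simp add: f_zero ip_psign_left)
        qed
        finally show ?thesis ..
      qed
      have D: "cut3_sum (\<lambda>a b c. psign (int (length a * length b + length a + 1 + (length a + length b) * length c))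
            (ip (f (b @ (g c * z) # a)) unit)) L
          = psign ((p + 1) * q + p) (form (cup_product (Delta unit ip f) g) M)"
        unfolding snoc form_cup_Delta[OF flin] cut3_sum_map[of "psign ((p + 1) * q + p)", OF psign_zero psign_add]
      proof (rule cut3_sum_cong)
        fix a b c :: "'a list"
        show "psign (int (length a * length b + length a + 1 + (length a + length b) * length c)) (ip (f (b @ (g c * z) # a)) unit)
          = psign ((p + 1) * q + p) (psign (int ((length a + 1) * (length a + length b))) (ip (f (b @ (g c * z) # a)) unit))"
        proof (cases "int (length (b @ (g c * z) # a)) = p \<and> int (length c) = q")
          case True
          then have "p = int (length b) + 1 + int (length a)" "q = int (length c)" by auto
          then show ?thesis by (auto intro!: psign_cong)
        next
          case False
          then show ?thesis using f_zero[of "b @ (g c * z) # a"] g_zero(2) by auto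
        qed
      qed
      have "psign ?s (half_rotation f g M) + psign (p + 1) (form (composition f g) M)
          + psign ((p + 1) * q + p) (form (cup_product (Delta unit ip f) g) M)
          + cyclic_differential (rotation_homotopy f g) M = 0"
        using rotation_homotopy_identity[OF flin f(2) g(2), of L z] unfolding snoc[symmetric] Z C D .
      then have "psign (?s + 1) (psign ?s (half_rotation f g M) + psign (p + 1) (form (composition f g) M)
          + psign ((p + 1) * q + p) (form (cup_product (Delta unit ip f) g) M)
          + form (hochschild ?h) M) = 0"
        by (simp add: form_hochschild form_h)
      moreover have "psign (?s + 1) (psign ?s x) = - x" "psign (?s + 1) (psign ((p + 1) * q + p) x) = x"
        "psign (?s + 1) (psign (p + 1) x) = - psign ((p + 1) * q) x" for x :: 'k
        by (auto simp: psign_def)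
      ultimately have "- half_rotation f g M - psign ((p + 1) * q) (form (composition f g) M)
          + form (cup_product (Delta unit ip f) g) M + psign (?s + 1) (form (hochschild ?h) M) = 0"
        by (simp only: psign_add add_uminus_conv_diff)
      then show ?thesis
        by (simp add: form_add form_diff form_psign hochschild_psign algebra_simps eq_neg_iff_add_eq_0)
    qed
  qed
qed

section \<open>The Batalin-Vilkovisky identity\<close>

text \<open>Invariance turns \<open>\<langle>(f g)(\<dots>), 1\<rangle>\<close> into a pairing of a value of \<open>f\<close> with a value of \<open>g\<close>. This is symmetric, so the terms in which the last letter
  goes to \<open>g\<close> are half of the rotations for the pair \<open>g, f\<close>.\<close>

lemma form_Delta_cup:
  assumes f: "f \<in> cochains scale p" and g: "g \<in> cochains scale q"
  shows "form (Delta unit ip (cup_product f g)) M = half_rotation f g M + psign (p * q) (half_rotation g f M)"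
proof -
  let ?s = "\<lambda>u v. int ((length u + 1) * (length u + length v - 1))"
  have cup_unit: "form (cup_product f g) (w @ [unit]) = cut_sum (\<lambda>x y. ip (f x) (g y)) w" for w
    unfolding form_unit cup_product_def
    by (subst cut_sum_map[of "\<lambda>x. ip x unit"]) (simp_all add: ip_add_left ip_invariant unit_right)
  have "form (Delta unit ip (cup_product f g)) M
      = cut_sum (\<lambda>u v. if v = [] then 0 else psign (?s u v) (cut_sum (\<lambda>x y. ip (f x) (g y)) (v @ u))) M"
    by (simp add: form_Delta cup_mlin cochain_mlin[OF f] cochain_mlin[OF g] cup_unit rotation_sum_cut)
  also have "\<dots> = cut_sum (\<lambda>u v. cut_sum (\<lambda>x y. if v = [] then 0 else psign (?s u v) (ip (f (v @ x)) (g y))) u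
      + cut_sum (\<lambda>x y. if y = [] then 0 else psign (?s u v) (ip (f x) (g (y @ u)))) v) M"
  proof (rule cut_sum_cong)
    fix u v :: "'a list"
    show "(if v = [] then 0 else psign (?s u v) (cut_sum (\<lambda>x y. ip (f x) (g y)) (v @ u)))
      = cut_sum (\<lambda>x y. if v = [] then 0 else psign (?s u v) (ip (f (v @ x)) (g y))) u
      + cut_sum (\<lambda>x y. if y = [] then 0 else psign (?s u v) (ip (f x) (g (y @ u)))) v"
    proof (cases "v = []")
      case True
      then show ?thesis by (simp add: cut_sum_0)
    next
      case False
      have *: "psign k (if y = [] then 0 else t) = (if y = [] then 0 else psign k t)" for k and t :: 'k and y :: "'a list"
        by simp
      then show ?thesis
        unfolding cut_sum_append psign_add cut_sum_psign * using False by (simp add: add.commute)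
    qed
  qed
  also have "\<dots> = half_rotation f g M + psign (p * q) (half_rotation g f M)"
  proof -
    have "cut_sum (\<lambda>u v. cut_sum (\<lambda>x y. if v = [] then 0 else psign (?s u v) (ip (f (v @ x)) (g y))) u) M
       = cut_sum (\<lambda>u v. cut_sum (\<lambda>x y. if v = [] then 0 else psign (int ((length x + length y + 1) * (length x + length y + length v - 1))) (ip (f (v @ x)) (g y))) u) M"
      by (intro cut_sum_cong) auto
    also have "\<dots> = half_rotation f g M"
      unfolding half_rotation_def cut3_sum_assoc ..
    finally have first: "cut_sum (\<lambda>u v. cut_sum (\<lambda>x y. if v = [] then 0 else psign (?s u v) (ip (f (v @ x)) (g y))) u) M
       = half_rotation f g M" .
    have "cut_sum (\<lambda>u v. cut_sum (\<lambda>x y. if y = [] then 0 else psign (?s u v) (ip (f x) (g (y @ u)))) v) M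
       = cut_sum (\<lambda>u v. cut_sum (\<lambda>x y. psign (p * q) (if y = [] then 0 else
            psign (int ((length u + length x + 1) * (length u + length x + length y - 1))) (ip (g (y @ u)) (f x)))) v) M"
    proof (intro cut_sum_cong)
      fix u v x y :: "'a list" assume "u @ v = M" and xy: "x @ y = v"
      show "(if y = [] then 0 else psign (?s u v) (ip (f x) (g (y @ u)))) = psign (p * q) (if y = [] then 0 else
            psign (int ((length u + length x + 1) * (length u + length x + length y - 1))) (ip (g (y @ u)) (f x)))"
      proof (cases "y = [] \<or> int (length x) \<noteq> p \<or> int (length (y @ u)) \<noteq> q")
        case True
        then show ?thesis
          using cochain_support[OF f, of x] cochain_support[OF g, of "y @ u"] by auto
      next
        case False
        then obtain z y' where y: "y = z # y'" by (cases y) auto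
        have "p = int (length x)" "q = int (length y') + 1 + int (length u)" using False y by auto
        then show ?thesis
          unfolding xy[symmetric] by (auto simp: y ip_symmetric[of "f x"] intro!: psign_cong)
      qed
    qed
    also have "\<dots> = psign (p * q) (half_rotation g f M)"
      unfolding half_rotation_def cut3_sum_def cut_sum_psign ..
    finally have second: "cut_sum (\<lambda>u v. cut_sum (\<lambda>x y. if y = [] then 0 else psign (?s u v) (ip (f x) (g (y @ u)))) v) M
       = psign (p * q) (half_rotation g f M)" .
    show ?thesis unfolding cut_sum_add first second ..
  qed
  finally show ?thesis .
qed

lemma Delta_cocycle:
  assumes "f \<in> cocycles p"
  shows "Delta unit ip f \<in> cocycles (p - 1)"
proof -
  have f: "f \<in> cochains scale p" "hochschild f = 0" using assms by auto
  have "connes_cochain f \<in> cocycles (p - 1)"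
    using connes_hochschild[OF cochain_mlin[OF f(1)]] connes_cochains[OF f(1)] f(2)
      chain.D_0 by simp
  moreover have "Delta unit ip f - connes_cochain f \<in> cocycles (p - 1)"
    using Delta_connes[OF f] HH.W_carrier by blast
  ultimately show ?thesis
    using cocycle.add_closed[of "Delta unit ip f - connes_cochain f" "p - 1" "connes_cochain f"] by simp
qed

lemma cup_cocycle: "f \<in> cocycles p \<Longrightarrow> g \<in> cocycles q \<Longrightarrow> cup_product f g \<in> cocycles (p + q)"
  by (simp add: cup_cochains hochschild_cup_cochain[of f p g])

lemma cup_coboundary_left:
  assumes "k \<in> coboundaries scale p" "g \<in> cocycles q"
  shows "cup_product k g \<in> coboundaries scale (p + q)"
proof -
  obtain h where h: "h \<in> cochains scale (p - 1)" "k = hochschild h"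
    using assms by (auto simp: coboundaries_def)
  have "cup_product k g = hochschild (cup_product h g)"
    using assms(2) by (simp add: h hochschild_cup_cochain[OF h(1)])
  moreover have "cup_product h g \<in> cochains scale (p + q - 1)"
    using cup_cochains[OF h(1), of g q] assms(2) by (simp add: algebra_simps)
  ultimately show ?thesis by (auto simp: coboundaries_def)
qed

lemma cup_coboundary_right:
  assumes "f \<in> cocycles p" "k \<in> coboundaries scale q"
  shows "cup_product f k \<in> coboundaries scale (p + q)"
proof -
  obtain h where h: "h \<in> cochains scale (q - 1)" "k = hochschild h"
    using assms by (auto simp: coboundaries_def)
  have "cup_product f k = psign p (hochschild (cup_product f h))"
    using assms(1) by (simp add: h hochschild_cup_cochain[of f p])
  moreover have "cup_product f h \<in> cochains scale (p + q - 1)"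
    using cup_cochains[of f p, OF _ h(1)] assms(1) by (simp add: algebra_simps)
  ultimately show ?thesis
    by (auto simp: coboundaries_def intro!: coboundaries_psign[unfolded coboundaries_def])
qed

text \<open>Both halves of \<open>\<Delta>(f g)\<close> are replaced by cohomologous expressions, and in the second one the factors of \<open>\<Delta>(g) f\<close> are exchanged.\<close>

theorem batalin_vilkovisky:
  assumes f: "f \<in> cocycles p" and g: "g \<in> cocycles q"
  shows "Delta unit ip (cup_product f g) - cup_product (Delta unit ip f) g
      - psign p (cup_product f (Delta unit ip g))
      + psign ((p + 1) * q) (composition f g - psign ((p - 1) * (q - 1)) (composition g f))
    \<in> coboundaries scale (p + q - 1)"
proof -
  have f': "f \<in> cochains scale p" "hochschild f = 0" and g': "g \<in> cochains scale q" "hochschild g = 0"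
    using f g by auto
  have Dg: "Delta unit ip g \<in> cochains scale (q - 1)" "hochschild (Delta unit ip g) = 0"
    using Delta_cocycle[OF g] by auto
  obtain h1 where h1: "h1 \<in> cochains scale (p + q - 2)" "\<And>M. half_rotation f g M =
    form (cup_product (Delta unit ip f) g - psign ((p + 1) * q) (composition f g) + hochschild h1) M"
    using half_rotation_cohomologous[OF f' g'] by blast
  obtain h2 where h2: "h2 \<in> cochains scale (q + p - 2)" "\<And>M. half_rotation g f M =
    form (cup_product (Delta unit ip g) f - psign ((q + 1) * p) (composition g f) + hochschild h2) M"
    using half_rotation_cohomologous[OF g' f'] by blast
  define k where "k = cup_product (Delta unit ip g) f - psign (p * (q - 1)) (cup_product f (Delta unit ip g))"
  have k: "k \<in> coboundaries scale (p + q - 1)"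
    using cup_graded_commutative[OF f' Dg] by (simp add: k_def algebra_simps)
  have Delta_cup: "Delta unit ip (cup_product f g)
    = cup_product (Delta unit ip f) g - psign ((p + 1) * q) (composition f g) + hochschild h1
      + psign (p * q) (cup_product (Delta unit ip g) f - psign ((q + 1) * p) (composition g f) + hochschild h2)"
    by (rule form_ext) (simp only: form_Delta_cup[OF f'(1) g'(1)] h1(2) h2(2) form_add form_psign)
  have "cup_product (Delta unit ip g) f = k + psign (p * (q - 1)) (cup_product f (Delta unit ip g))"
    by (simp add: k_def)
  moreover have "psign (p * q) (psign (p * (q - 1)) x) = psign p x"
    "psign (p * q) (psign ((q + 1) * p) x) = psign p x"
    "psign ((p + 1) * q) (psign ((p - 1) * (q - 1)) x) = - psign p x" for x :: "'a cochain"
    by (auto simp: psign_def)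
  ultimately have "Delta unit ip (cup_product f g) - cup_product (Delta unit ip f) g
      - psign p (cup_product f (Delta unit ip g))
      + psign ((p + 1) * q) (composition f g - psign ((p - 1) * (q - 1)) (composition g f))
    = hochschild h1 + psign (p * q) (hochschild h2) + psign (p * q) k"
    unfolding Delta_cup by (simp only: psign_add psign_diff) (simp add: algebra_simps)
  moreover have "hochschild h1 \<in> coboundaries scale (p + q - 1)" "hochschild h2 \<in> coboundaries scale (p + q - 1)"
    using h1(1) h2(1) by (auto simp: coboundaries_def algebra_simps)
  ultimately show ?thesis
    using k by (simp add: HH.W_add coboundaries_psign)
qed

section \<open>The induced structure on cohomology\<close>

sublocale ops: compatible_operations scale cochain_ops
  by unfold_locales (rule A_infinity_cochain_ops, rule compatible_cochain_ops)

lemma cochain_ops_single: "cochain_ops [p] [f] = connes_cochain f"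
  by (simp add: cochain_ops_def chain.boerjeson_single)

lemma cochain_ops_pair:
  "cochain_ops [p, q] [f, g] = connes_cochain (cup_product f g) - cup_product (connes_cochain f) g
    - psign p (cup_product f (connes_cochain g))"
  by (simp add: cochain_ops_def chain.boerjeson_pair)

lemma HH_class_representative: "\<xi> \<in> carrier (HH scale p) \<Longrightarrow> f \<in> \<xi> \<Longrightarrow> f \<in> cocycles p \<and> cls p f = \<xi>"
proof -
  assume "\<xi> \<in> carrier (HH scale p)" and f: "f \<in> \<xi>"
  then obtain h where h: "h \<in> cocycles p" "\<xi> = cls p h"
    unfolding carrier_HH by blast
  then have "f - h \<in> coboundaries scale p" using f by (simp only: mem_HH_class)
  moreover have "f \<in> cocycles p"
    using HH.cls_carrier[OF h(1)] f h(2) by (simp only: HH_class_def)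
  ultimately show ?thesis
    using h by (simp only: HH_class_eq_iff)
qed

lemma HH_class_nonempty: "\<xi> \<in> carrier (HH scale p) \<Longrightarrow> \<xi> \<noteq> {}"
proof -
  assume "\<xi> \<in> carrier (HH scale p)"
  then obtain h where "\<xi> = cls p h" unfolding carrier_HH by blast
  then have "h \<in> \<xi>" by (simp add: mem_HH_class HH.W_zero)
  then show ?thesis by blast
qed

lemma descended_single:
  assumes \<xi>: "\<xi> \<in> carrier (HH scale p)"
  shows "ops.descended [p] [\<xi>] = HH_Delta scale unit ip p \<xi>"
proof -
  have "cls (p - 1) (Delta unit ip f) = ops.descended [p] [\<xi>]" if "f \<in> \<xi>" for f
  proof -
    have f: "f \<in> cocycles p" "cls p f = \<xi>"
      using HH_class_representative[OF \<xi> that] by auto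
    have "ops.descended [p] [\<xi>] = cls (p - 1) (connes_cochain f)"
      using ops.descended_class[of "[p]" "[f]"] f by (simp add: homogeneous_def cochain_ops_single)
    also have "\<dots> = cls (p - 1) (Delta unit ip f)"
      by (rule sym, unfold HH_class_eq_iff) (use Delta_connes[of f p] f(1) in simp)
    finally show ?thesis ..
  qed
  then show ?thesis
    using HH_class_nonempty[OF \<xi>] unfolding HH_Delta_def by blast
qed

text \<open>The Connes operator may be replaced by \<open>\<Delta>\<close>, since products of cocycles with coboundaries are coboundaries.\<close>

lemma cochain_ops_pair_bracket:
  assumes f: "f \<in> cocycles (int p)" and g: "g \<in> cocycles (int q)"
  shows "cochain_ops [int p, int q] [f, g] + psign ((int p + 1) * int q) (gerstenhaber_bracket p q f g)
    \<in> coboundaries scale (int p + int q - 1)"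
proof -
  let ?D = "Delta unit ip" and ?B = "connes_cochain" and ?W = "coboundaries scale (int p + int q - 1)"
  let ?e = "\<lambda>f. ?D f - ?B f"
  have e: "?e h \<in> coboundaries scale (r - 1)" if "h \<in> cocycles r" for h r
    using Delta_connes that by simp
  have e1: "?e (cup_product f g) \<in> ?W"
    using e[OF cup_cocycle[OF f g]] .
  have e2: "cup_product (?e f) g \<in> ?W"
    using cup_coboundary_left[OF e[OF f] g] by (simp add: algebra_simps)
  have e3: "cup_product f (?e g) \<in> ?W"
    using cup_coboundary_right[OF f e[OF g]] by (simp add: algebra_simps)
  have "gerstenhaber_bracket p q f g = composition f g - psign ((int p - 1) * (int q - 1)) (composition g f)"
    using f g by (simp add: gerstenhaber_bracket_def gerstenhaber_circ_composition)
  then have bv: "?D (cup_product f g) - cup_product (?D f) g - psign (int p) (cup_product f (?D g))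
      + psign ((int p + 1) * int q) (gerstenhaber_bracket p q f g) \<in> ?W"
    using batalin_vilkovisky[OF f g] by simp
  have "(?D (cup_product f g) - cup_product (?D f) g - psign (int p) (cup_product f (?D g))
      + psign ((int p + 1) * int q) (gerstenhaber_bracket p q f g))
      - ?e (cup_product f g) + cup_product (?e f) g + psign (int p) (cup_product f (?e g)) \<in> ?W"
    by (rule HH.W_add[OF HH.W_add[OF HH.W_diff[OF bv e1] e2] coboundaries_psign[OF e3]])
  then show ?thesis
    by (simp add: cochain_ops_pair chain.cup_diff_left chain.cup_diff_right psign_diff algebra_simps)
qed

text \<open>The bracket of cocycles agrees up to sign with a cochain operation modulo coboundaries. Hence it is a cocycle, its class does not depend on the
  representatives, and the union that defines the bracket of classes is a single class.\<close>

lemma descended_pair: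
  assumes \<xi>: "\<xi> \<in> carrier (HH scale (int p))" and \<eta>: "\<eta> \<in> carrier (HH scale (int q))"
  shows "ops.descended [int p, int q] [\<xi>, \<eta>] = signed (HH scale (int p + int q - 1)) ((int p + 1) * int q + 1)
    (HH_bracket scale p q \<xi> \<eta>)"
proof -
  let ?d = "int p + int q - 1" and ?k = "(int p + 1) * int q"
  have bracket: "gerstenhaber_bracket p q f g \<in> cocycles ?d"
      "ops.descended [int p, int q] [\<xi>, \<eta>] = cls ?d (psign (?k + 1) (gerstenhaber_bracket p q f g))"
    if "f \<in> \<xi>" "g \<in> \<eta>" for f g
  proof -
    have f: "f \<in> cocycles (int p)" "cls (int p) f = \<xi>" and g: "g \<in> cocycles (int q)" "cls (int q) g = \<eta>"
      using HH_class_representative[OF \<xi> that(1)] HH_class_representative[OF \<eta> that(2)] by auto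
    let ?m = "cochain_ops [int p, int q] [f, g]"
    have hom: "homogeneous (cocycle_space scale) [int p, int q] [f, g]"
      using f g by (simp add: homogeneous_def)
    have m: "?m \<in> cocycles ?d"
      using ops.op_cocycle[OF _ hom] by simp
    note w = cochain_ops_pair_bracket[OF f(1) g(1)]
    then have "?m + psign ?k (gerstenhaber_bracket p q f g) \<in> cocycles ?d"
      using HH.W_carrier by blast
    then have "psign ?k (gerstenhaber_bracket p q f g) \<in> cocycles ?d"
      using cocycle.diff_closed[OF _ m] by fastforce
    then have "psign ?k (psign ?k (gerstenhaber_bracket p q f g)) \<in> cocycles ?d"
      by (rule cocycle.psign_closed)
    then show "gerstenhaber_bracket p q f g \<in> cocycles ?d"
      by (simp add: psign_def del: carrier_cocycle_space split: if_splits)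
    have "ops.descended [int p, int q] [\<xi>, \<eta>] = cls ?d ?m"
      using ops.descended_class[OF _ hom] f g by simp
    also have "\<dots> = cls ?d (psign (?k + 1) (gerstenhaber_bracket p q f g))"
      using w by (simp add: HH_class_eq_iff minus_psign[symmetric])
    finally show "ops.descended [int p, int q] [\<xi>, \<eta>] = cls ?d (psign (?k + 1) (gerstenhaber_bracket p q f g))" .
  qed
  obtain f0 g0 where fg: "f0 \<in> \<xi>" "g0 \<in> \<eta>"
    using HH_class_nonempty[OF \<xi>] HH_class_nonempty[OF \<eta>] by blast
  have "cls ?d (gerstenhaber_bracket p q f g) = cls ?d (gerstenhaber_bracket p q f0 g0)" if "f \<in> \<xi>" "g \<in> \<eta>" for f g
  proof -
    have "psign (?k + 1) (gerstenhaber_bracket p q f g - gerstenhaber_bracket p q f0 g0) \<in> coboundaries scale ?d"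
      using trans[OF bracket(2)[OF that, symmetric] bracket(2)[OF fg]] unfolding HH_class_eq_iff psign_diff .
    then have "psign (?k + 1) (psign (?k + 1) (gerstenhaber_bracket p q f g - gerstenhaber_bracket p q f0 g0)) \<in> coboundaries scale ?d"
      by (rule coboundaries_psign)
    then show ?thesis by (simp add: HH_class_eq_iff psign_def split: if_splits)
  qed
  then have "HH_bracket scale p q \<xi> \<eta> = cls ?d (gerstenhaber_bracket p q f0 g0)"
    using fg unfolding HH_bracket_def by blast
  then show ?thesis
    using bracket[OF fg] by (simp only: signed_HH_class)
qed

end

theorem theorem8:
  fixes scale :: "'k::field_char_0 \<Rightarrow> 'a::ring \<Rightarrow> 'a"
    and Basis :: "'a set" and unit :: 'a and ip :: "'a \<Rightarrow> 'a \<Rightarrow> 'k"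
  assumes "algebra_with_inner_product scale Basis unit ip"
  shows "\<exists>\<mu> m.
    A_infinity_structure (cochain_space scale) \<mu> \<and>
    compatible_with_hochschild scale \<mu> \<and>
    induces_on_HH scale \<mu> m \<and>
    A_infinity_structure (HH scale) m \<and>
    (\<forall>p. \<forall>\<xi> \<in> carrier (HH scale p). m [p] [\<xi>] = HH_Delta scale unit ip p \<xi>) \<and>
    (\<exists>s :: nat \<Rightarrow> nat \<Rightarrow> int.
      \<forall>p q. \<forall>\<xi> \<in> carrier (HH scale (int p)). \<forall>\<eta> \<in> carrier (HH scale (int q)).
        m [int p, int q] [\<xi>, \<eta>]
          = signed (HH scale (int p + int q - 1)) (s p q) (HH_bracket scale p q \<xi> \<eta>))"
proof -
  interpret algebra_with_inner_product scale Basis unit ip by fact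
  show ?thesis
  proof (intro exI conjI allI ballI)
    show "A_infinity_structure (cochain_space scale) cochain_ops"
      by (rule A_infinity_cochain_ops)
    show "compatible_with_hochschild scale cochain_ops"
      by (rule compatible_cochain_ops)
    show "induces_on_HH scale cochain_ops ops.descended"
      by (rule ops.induces_descended)
    show "A_infinity_structure (HH scale) ops.descended"
      by (rule ops.A_infinity_descended)
    show "ops.descended [p] [\<xi>] = HH_Delta scale unit ip p \<xi>" if "\<xi> \<in> carrier (HH scale p)" for p \<xi>
      by (rule descended_single[OF that])
    show "ops.descended [int p, int q] [\<xi>, \<eta>] = signed (HH scale (int p + int q - 1))
        ((\<lambda>p q. (int p + 1) * int q + 1) p q) (HH_bracket scale p q \<xi> \<eta>)"
      if "\<xi> \<in> carrier (HH scale (int p))" "\<eta> \<in> carrier (HH scale (int q))" for p q \<xi> \<eta>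
      by (rule descended_pair[OF that])
  qed
qed

end
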